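(* Let $L>0$ and $\delta>0$ be fixed. Then there is $k_1\in(0,1)$ such that, for $c=c(k)$ and $\varphi_{c(k)}$ given by the explicit formulas in the context, the mapping $$k\in(0,k_1)\ \longmapsto\ \varphi_{c(k)}\in H^n_{per}([0,L])\cap H_0,\qquad n\in\mathbb N,$$ is well defined and smooth. Moreover, for every $k\in(0,k_1)$ the function $\varphi_k=\varphi_{c(k)}$ satisfies $$-c(k)\,\varphi_k+\varphi_k^2-\mathcal M_\delta\varphi_k=A(k),\qquad A(k)=\frac1L\int_0^L\varphi_k^2(x)\,dx .$$
   Context: For $k\in(0,1)$ put $k'=\sqrt{1-k^2}$; $K(k)$, $E(k)$ are the complete elliptic integrals of the first and second kind (modulus $k$); $\mathrm{sn},\mathrm{cn},\mathrm{dn}(\cdot;k)$ are the Jacobi elliptic functions of modulus $k$; $Z(u;k)=\int_0^u\big[\mathrm{dn}^2(s;k)-E(k)/K(k)\big]ds$ is the Jacobi zeta function, extended holomorphically to the strip $|\mathrm{Im}\,u|<K(k')$. For $L,\delta>0$ and $k$ with $\frac{2\delta}{L}\frac{K(k)}{K(k')}<1$, define $$\varphi_{c(k)}(x)=\frac{2K(k)i}{L}\Big[Z\Big(\tfrac{2K(k)}{L}(x-i\delta);k\Big)-Z\Big(\tfrac{2K(k)}{L}(x+i\delta);k\Big)\Big],\quad x\in\mathbb R,$$ $$c(k)=\frac1\delta-\frac{8\pi\delta K(k)}{L^2K(k')}-\frac{4K(k)}{L}Z\Big(\tfrac{4\delta K(k)}{L};k'\Big)-\frac{4K(k)}{L}\,\frac{\mathrm{cn}\big(\tfrac{4\delta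 K(k)}{L};k'\big)\,\mathrm{dn}\big(\tfrac{4\delta K(k)}{L};k'\big)}{\mathrm{sn}\big(\tfrac{4\delta K(k)}{L};k'\big)} .$$ $H^n_{per}([0,L])$ is the $L$-periodic Sobolev space of order $n$; $H_0=\{f\in L^2([0,L]):\int_0^Lf\,dx=0\}$. $\mathcal M_\delta$ is the Fourier multiplier on $L$-periodic functions given by $\widehat{\mathcal M_\delta g}(n)=\theta_\delta(n)\widehat g(n)$, $n\in\mathbb Z$, with $\theta_\delta(n)=\frac{2\pi n}{L}\coth\big(\frac{2\pi n\delta}{L}\big)-\frac1\delta$ for $n\ne0$ and $\theta_\delta(0)=0$, where $\widehat g(n)=\frac1L\int_0^Lg(x)e^{-2\pi i n x/L}dx$. *)

theory Defs
  imports "HOL-Complex_Analysis.Complex_Analysis"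
begin

definition ellip_K :: "real \<Rightarrow> real" where
  "ellip_K k = (LBINT t=0..pi/2. 1 / sqrt (1 - k\<^sup>2 * (sin t)\<^sup>2))"

definition ellip_E :: "real \<Rightarrow> real" where
  "ellip_E k = (LBINT t=0..pi/2. sqrt (1 - k\<^sup>2 * (sin t)\<^sup>2))"

definition comp_modulus :: "real \<Rightarrow> real" where
  "comp_modulus k = sqrt (1 - k\<^sup>2)"

text \<open>The interval integral is oriented, so \<open>ellip_F k\<close> is odd. For \<open>0 < k < 1\<close> it is an
  increasing bijection of the real line, and the amplitude is its inverse.\<close>

definition ellip_F :: "real \<Rightarrow> real \<Rightarrow> real" where
  "ellip_F k x = (LBINT t=0..x. 1 / sqrt (1 - k\<^sup>2 * (sin t)\<^sup>2))"

definition jacobi_am :: "real \<Rightarrow> real \<Rightarrow> real" where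
  "jacobi_am k = inv (ellip_F k)"

definition jacobi_sn :: "real \<Rightarrow> real \<Rightarrow> real" where
  "jacobi_sn k u = sin (jacobi_am k u)"

definition jacobi_cn :: "real \<Rightarrow> real \<Rightarrow> real" where
  "jacobi_cn k u = cos (jacobi_am k u)"

definition jacobi_dn :: "real \<Rightarrow> real \<Rightarrow> real" where
  "jacobi_dn k u = sqrt (1 - k\<^sup>2 * (jacobi_sn k u)\<^sup>2)"

definition jacobi_zeta :: "real \<Rightarrow> real \<Rightarrow> real" where
  "jacobi_zeta k u = (LBINT s=0..u. (jacobi_dn k s)\<^sup>2 - ellip_E k / ellip_K k)"

definition zeta_strip :: "real \<Rightarrow> complex set" where
  "zeta_strip k = {u. \<bar>Im u\<bar> < ellip_K (comp_modulus k)}"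

definition is_zeta_extension :: "real \<Rightarrow> (complex \<Rightarrow> complex) \<Rightarrow> bool" where
  "is_zeta_extension k f \<longleftrightarrow>
     f holomorphic_on zeta_strip k \<and>
     (\<forall>u::real. f (complex_of_real u) = complex_of_real (jacobi_zeta k u))"

text \<open>The values outside the strip are unspecified; on the strip the extension is
  unique, see \<open>zeta_extension_unique\<close>.\<close>

definition jacobi_zeta_ext :: "real \<Rightarrow> complex \<Rightarrow> complex" where
  "jacobi_zeta_ext k = (SOME f. is_zeta_extension k f)"

lemma zeta_extension_unique:
  assumes f: "is_zeta_extension k f" and g: "is_zeta_extension k g" and u: "u \<in> zeta_strip k"
  shows "f u = g u"
proof -
  have strip: "zeta_strip k = {u. Im u < ellip_K (comp_modulus k)} \<inter>
      {u. - ellip_K (comp_modulus k) < Im u}"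
    by (auto simp: zeta_strip_def)
  have "open (zeta_strip k)"
    unfolding strip by (intro open_Int open_halfspace_Im_lt open_halfspace_Im_gt)
  moreover have "convex (zeta_strip k)"
    unfolding strip by (intro convex_Int convex_halfspace_Im_lt convex_halfspace_Im_gt)
  then have "connected (zeta_strip k)"
    by (rule convex_connected)
  moreover have pos: "0 < ellip_K (comp_modulus k)"
    using u by (auto simp: zeta_strip_def)
  then have "0 \<in> zeta_strip k" "\<real> \<subseteq> zeta_strip k"
    by (auto simp: zeta_strip_def elim!: Reals_cases)
  moreover have "(0::complex) islimpt \<real>"
    unfolding islimpt_approachable
  proof (intro allI impI)
    fix e :: real assume "0 < e"
    then show "\<exists>x'\<in>\<real>. x' \<noteq> (0::complex) \<and> dist x' 0 < e"
      by (intro bexI[of _ "complex_of_real (e/2)"]) auto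
  qed
  moreover have "(\<lambda>z. f z - g z) holomorphic_on zeta_strip k"
    using f g by (auto simp: is_zeta_extension_def intro!: holomorphic_intros)
  moreover have "f z - g z = 0" if "z \<in> \<real>" for z
    using that f g by (auto simp: is_zeta_extension_def elim!: Reals_cases)
  ultimately have "f u - g u = 0"
    using analytic_continuation[of "\<lambda>z. f z - g z" "zeta_strip k" "\<real>" 0 u] u by blast
  then show ?thesis by simp
qed

text \<open>Elements are represented by complex-valued \<open>L\<close>-periodic functions on the line.\<close>

definition fourier_coeff :: "real \<Rightarrow> (real \<Rightarrow> complex) \<Rightarrow> int \<Rightarrow> complex" where
  "fourier_coeff L g m =
     1 / L * (LBINT x:{0..L}. g x * exp (- (2 * pi * \<i> * m * x / L)))"

definition L2_per :: "real \<Rightarrow> (real \<Rightarrow> complex) set" where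
  "L2_per L = {g. (\<forall>x. g (x + L) = g x) \<and> set_borel_measurable lborel {0..L} g \<and>
     set_integrable lborel {0..L} (\<lambda>x. (cmod (g x))\<^sup>2)}"

definition H_per :: "nat \<Rightarrow> real \<Rightarrow> (real \<Rightarrow> complex) set" where
  "H_per n L = {g \<in> L2_per L.
     (\<lambda>m::int. (1 + (real_of_int m)\<^sup>2) ^ n * (cmod (fourier_coeff L g m))\<^sup>2) summable_on UNIV}"

definition H_per_norm :: "nat \<Rightarrow> real \<Rightarrow> (real \<Rightarrow> complex) \<Rightarrow> real" where
  "H_per_norm n L g = sqrt (L *
     (\<Sum>\<^sub>\<infinity>m\<in>(UNIV :: int set). (1 + (real_of_int m)\<^sup>2) ^ n * (cmod (fourier_coeff L g m))\<^sup>2))"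

definition H_0 :: "real \<Rightarrow> (real \<Rightarrow> complex) set" where
  "H_0 L = {g \<in> L2_per L. (LBINT x:{0..L}. g x) = 0}"

text \<open>A curve \<open>f\<close> in \<open>H\<^sup>n \<inter> H\<^sub>0\<close>, parametrised by a set \<open>I\<close> of reals, is smooth if it has
  derivatives \<open>D j\<close> of every order \<open>j\<close> in that space, difference quotients converging in the
  norm of \<open>H\<^sup>n\<close>.\<close>

definition smooth_curve :: "nat \<Rightarrow> real \<Rightarrow> real set \<Rightarrow> (real \<Rightarrow> real \<Rightarrow> complex) \<Rightarrow> bool" where
  "smooth_curve n L I f \<longleftrightarrow>
     (\<exists>D :: nat \<Rightarrow> real \<Rightarrow> real \<Rightarrow> complex.
        (\<forall>k\<in>I. D 0 k = f k) \<and>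
        (\<forall>j. \<forall>k\<in>I. D j k \<in> H_per n L \<inter> H_0 L \<and>
           ((\<lambda>t. H_per_norm n L (\<lambda>x. (D j t x - D j k x) / (t - k) - D (Suc j) k x))
              \<longlongrightarrow> 0) (at k within I)))"

definition symbol :: "real \<Rightarrow> real \<Rightarrow> int \<Rightarrow> real" where
  "symbol L \<delta> m = (if m = 0 then 0 else
     2 * pi * m / L * (cosh (2 * pi * m * \<delta> / L) / sinh (2 * pi * m * \<delta> / L)) - 1 / \<delta>)"

text \<open>The series converges absolutely for \<open>g\<close> in \<open>H\<^sup>2\<close>, so there its sum is the
  continuous function whose coefficients are those of \<open>g\<close> times the symbol.\<close>

definition M_op :: "real \<Rightarrow> real \<Rightarrow> (real \<Rightarrow> complex) \<Rightarrow> real \<Rightarrow> complex" where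
  "M_op L \<delta> g x =
     (\<Sum>\<^sub>\<infinity>m\<in>(UNIV :: int set). symbol L \<delta> m * fourier_coeff L g m * exp (2 * pi * \<i> * m * x / L))"

definition wave :: "real \<Rightarrow> real \<Rightarrow> real \<Rightarrow> real \<Rightarrow> complex" where
  "wave L \<delta> k x = 2 * ellip_K k * \<i> / L *
     (jacobi_zeta_ext k (2 * ellip_K k / L * (x - \<i> * \<delta>)) -
      jacobi_zeta_ext k (2 * ellip_K k / L * (x + \<i> * \<delta>)))"

definition wave_speed :: "real \<Rightarrow> real \<Rightarrow> real \<Rightarrow> real" where
  "wave_speed L \<delta> k = (let k' = comp_modulus k; u = 4 * \<delta> * ellip_K k / L in
     1 / \<delta> - 8 * pi * \<delta> * ellip_K k / (L\<^sup>2 * ellip_K k')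
       - 4 * ellip_K k / L * jacobi_zeta k' u
       - 4 * ellip_K k / L * (jacobi_cn k' u * jacobi_dn k' u / jacobi_sn k' u))"

end

theory Submission
  imports Defs "HOL-Real_Asymp.Real_Asymp"
begin

text \<open>Jacobi's imaginary transformation and the addition theorem express the real and imaginary
  parts of \<open>Z(u + iv; k)\<close> through the real Jacobi functions of \<open>u\<close> (modulus \<open>k\<close>) and of \<open>v\<close>
  (modulus \<open>k'\<close>). These formulas satisfy the Cauchy-Riemann equations in the strip, so they are the
  continuation of \<open>Z\<close>, and the wave is \<open>4K/L\<close> times the imaginary part \<open>P - Y\<close> on the line
  \<open>v = 2K\<delta>/L\<close>, where \<open>Y\<close> depends on \<open>v\<close> only.

  A shift of contours relates the Fourier coefficients on all horizontal lines to each other. As \<open>v\<close>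
  tends to \<open>K'\<close>, the periodic function \<open>P\<close> tends to \<open>\<pi>\<close> times the delta distribution, which yields
  Legendre's relation (from the mean value) and the coefficients
  \<open>(2\<pi>/L) sinh(2\<pi>m\<delta>/L) / sinh(\<pi>mK'/K)\<close> of the wave. They are holomorphic in \<open>k\<close> and decay
  exponentially, locally uniformly in \<open>k\<close>, so Cauchy's inequalities give smoothness in every \<open>H\<^sup>n\<close>.

  Since \<open>coth\<close> turns \<open>sinh\<close> into \<open>cosh\<close>, the operator \<open>M\<close> maps the wave to a multiple of the real part
  \<open>R\<close> of \<open>Z'\<close> on the same line, up to \<open>- \<phi>/\<delta>\<close>. The equation then reduces to \<open>R = 2P\<^sup>2 + (p'/p) P + const\<close>
  with \<open>p = sn cn dn\<close> at \<open>v\<close>; the duplication formulas identify \<open>p'/p\<close> with the terms of the wave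
  speed, and the constant is found by taking mean values.\<close>

section \<open>Jacobi elliptic functions on the real line\<close>

text \<open>Only the real Jacobi functions are given, and the continued zeta function is an
  unspecified choice; so everything complex is built from explicit real formulas. The delta limit
  reflects the simple pole of Z with residue 1 at iK': close to it, Im Z resembles the Poisson
  kernel (K' - v) / (u^2 + (K' - v)^2), of mass pi. After the contour shift one number per m is
  still unknown, and this single limit fixes all of them. The equation closes because of a Riccati
  identity. Put y = dn^2(u; k), t = sn^2(v; k') and P = y p / (1 - y t). Since dt/dv = 2p, one gets
  dP/dv = (p'/p) P + 2 P^2. As R = d(P - Y)/dv, it is quadratic in P with coefficients that depend
  on v alone, and the wave speed is the value for which the terms linear in P cancel. The speed is
  stated at the argument 4 K \<delta> / L = 2v while the wave lives at height v, which is why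
  duplication enters.\<close>

lemma interval_integral_DERIV:
  fixes f :: "real \<Rightarrow> real"
  assumes "continuous_on UNIV f"
  shows "((\<lambda>u::real. LBINT y=0..u. f y) has_real_derivative f x) (at x)"
proof -
  let ?b = "\<bar>x\<bar> + 1"
  have "((\<lambda>u. LBINT y=ereal 0..ereal u. f y) has_vector_derivative f x) (at x within {-?b..?b})"
    using continuous_on_subset[OF assms] by (intro interval_integral_FTC2) auto
  moreover have "at x within {-?b..?b} = at x"
    by (rule at_within_interior) (auto simp: interior_atLeastAtMost_real)
  ultimately show ?thesis
    by (simp add: has_real_derivative_iff_has_vector_derivative zero_ereal_def)
qed

text \<open>Oddness, quasi-periodicity and the addition theorems all come down to this: a vanishing
  derivative and one point where both sides are known.\<close>

lemma DERIV_zero_imp_eq: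
  fixes f :: "real \<Rightarrow> real"
  assumes "\<And>x. (f has_real_derivative 0) (at x)"
  shows "f x = f y"
  using DERIV_isconst_all[of f x y] assms by auto

text \<open>Periodicity makes \<open>I (x + pi) - I x\<close> constant; with evenness the reflected
  sum \<open>I (pi - x) + I x\<close> is constant too, and its fixed point \<open>pi/2\<close> gives
  \<open>I pi = 2 * I (pi/2)\<close>. Serves the incomplete integrals of both kinds.\<close>

lemma interval_integral_pi_periodic:
  fixes f :: "real \<Rightarrow> real"
  assumes cont: "continuous_on UNIV f" and per: "\<And>x. f (x + pi) = f x" and ev: "\<And>x. f (- x) = f x"
  shows "(LBINT y=0..ereal (x + pi). f y) = (LBINT y=0..ereal x. f y) + 2 * (LBINT y=0..ereal (pi/2). f y)"
proof -
  define I where "I = (\<lambda>u::real. LBINT y=0..ereal u. f y)"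
  have D: "(I has_real_derivative f x) (at x)" for x
    unfolding I_def by (rule interval_integral_DERIV[OF cont])
  have I0: "I 0 = 0" by (simp add: I_def zero_ereal_def)
  have "((\<lambda>x. I (x + pi) - I x) has_real_derivative 0) (at x)" for x
    by (rule derivative_eq_intros DERIV_chain2[OF D] refl)+ (simp add: per)
  from DERIV_zero_imp_eq[OF this, of x 0] have "I (x + pi) = I x + I pi" by (simp add: I0)
  moreover have "f (pi - x) = f x" for x using per[of "-x"] ev[of x] by (simp add: add.commute)
  then have "((\<lambda>x. I (pi - x) + I x) has_real_derivative 0) (at x)" for x
    by (auto intro!: derivative_eq_intros DERIV_chain2[OF D])
  from DERIV_zero_imp_eq[OF this, of "pi/2" 0] have "I pi = 2 * I (pi/2)" by (simp add: I0)
  ultimately show ?thesis by (simp add: I_def)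
qed

lemma Delta_sq_pos:
  fixes k :: real
  assumes "0 < k" "k < 1"
  shows "0 < 1 - k\<^sup>2 * (sin t)\<^sup>2"
proof -
  have "k\<^sup>2 * (sin t)\<^sup>2 \<le> k\<^sup>2 * 1" by (intro mult_left_mono) (auto simp: abs_square_le_1)
  moreover have "k\<^sup>2 < 1" using assms by (simp add: power_less_one_iff)
  ultimately show ?thesis by simp
qed

lemma cont_inv_Delta:
  assumes "0 < k" "k < 1"
  shows "continuous_on S (\<lambda>t. 1 / sqrt (1 - k\<^sup>2 * (sin t)\<^sup>2))"
  using Delta_sq_pos[OF assms] by (intro continuous_intros) (metis less_irrefl real_sqrt_eq_zero_cancel_iff)

lemma ellip_F_deriv:
  assumes "0 < k" "k < 1"
  shows "(ellip_F k has_real_derivative 1 / sqrt (1 - k\<^sup>2 * (sin x)\<^sup>2)) (at x)"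
  unfolding ellip_F_def[abs_def] by (rule interval_integral_DERIV[OF cont_inv_Delta[OF assms]])

lemma inv_Delta_ge_1:
  assumes "0 < k" "k < 1"
  shows "1 \<le> 1 / sqrt (1 - k\<^sup>2 * (sin x)\<^sup>2)"
  using Delta_sq_pos[OF assms, of x] by (simp add: divide_simps)

lemma ellip_F_0 [simp]: "ellip_F k 0 = 0"
  by (simp add: ellip_F_def zero_ereal_def)

lemma ellip_F_half_pi: "ellip_F k (pi/2) = ellip_K k"
  by (simp add: ellip_F_def ellip_K_def)

text \<open>The integrand is at least 1. This one estimate yields strict monotonicity, surjectivity
  and the positivity of K.\<close>

lemma ellip_F_diff_ge:
  assumes "0 < k" "k < 1" "x \<le> y"
  shows "y - x \<le> ellip_F k y - ellip_F k x"
proof -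
  have "ellip_F k x - x \<le> ellip_F k y - y"
  proof (rule DERIV_nonneg_imp_nondecreasing[OF assms(3)])
    fix t
    show "\<exists>z. ((\<lambda>x. ellip_F k x - x) has_real_derivative z) (at t) \<and> 0 \<le> z"
      by (rule exI conjI derivative_eq_intros ellip_F_deriv[OF assms(1,2)] refl)+
         (use inv_Delta_ge_1[OF assms(1,2)] in auto)
  qed
  then show ?thesis by simp
qed

lemma ellip_F_strict_mono:
  assumes "0 < k" "k < 1"
  shows "strict_mono (ellip_F k)"
  using ellip_F_diff_ge[OF assms] by (intro strict_monoI) (smt (verit))

lemma isCont_ellip_F:
  assumes "0 < k" "k < 1"
  shows "isCont (ellip_F k) x"
  using ellip_F_deriv[OF assms] by (rule DERIV_isCont)

text \<open>Turns the \<open>inv\<close> in \<open>jacobi_am\<close> into a two-sided inverse;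
  linear growth encloses y between the values at -|y| and |y|.\<close>

lemma ellip_F_bij:
  assumes "0 < k" "k < 1"
  shows "bij (ellip_F k)"
proof (rule bijI)
  show "inj (ellip_F k)" using ellip_F_strict_mono[OF assms] by (rule strict_mono_imp_inj_on)
  have "\<exists>x. ellip_F k x = y" for y
  proof -
    have "\<exists>x\<ge>-\<bar>y\<bar>. x \<le> \<bar>y\<bar> \<and> ellip_F k x = y"
      using ellip_F_diff_ge[OF assms, of 0 "\<bar>y\<bar>"] ellip_F_diff_ge[OF assms, of "-\<bar>y\<bar>" 0]
      by (intro IVT) (auto intro: isCont_ellip_F[OF assms])
    then show ?thesis by blast
  qed
  then show "surj (ellip_F k)" by (metis surj_def)
qed

lemma ellip_F_am:
  assumes "0 < k" "k < 1"
  shows "ellip_F k (jacobi_am k u) = u"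
  unfolding jacobi_am_def using ellip_F_bij[OF assms] by (simp add: bij_is_surj surj_f_inv_f)

lemma am_ellip_F:
  assumes "0 < k" "k < 1"
  shows "jacobi_am k (ellip_F k x) = x"
  unfolding jacobi_am_def using ellip_F_bij[OF assms] by (simp add: bij_is_inj inv_f_f)

lemma jacobi_dn_pos:
  assumes "0 < k" "k < 1"
  shows "0 < jacobi_dn k u"
  using Delta_sq_pos[OF assms] by (simp add: jacobi_dn_def jacobi_sn_def)

lemma jacobi_am_isCont:
  assumes "0 < k" "k < 1"
  shows "isCont (jacobi_am k) u"
proof -
  have "isCont (jacobi_am k) (ellip_F k (jacobi_am k u))"
    by (rule isCont_inverse_function[where d=1])
       (auto simp: am_ellip_F[OF assms] isCont_ellip_F[OF assms])
  then show ?thesis by (simp add: ellip_F_am[OF assms])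
qed

lemma jacobi_am_deriv:
  assumes "0 < k" "k < 1"
  shows "(jacobi_am k has_real_derivative jacobi_dn k u) (at u)"
proof -
  have "(jacobi_am k has_real_derivative inverse (1 / sqrt (1 - k\<^sup>2 * (sin (jacobi_am k u))\<^sup>2))) (at u)"
    by (rule DERIV_inverse_function[where f = "ellip_F k" and a = "u - 1" and b = "u + 1"])
       (use Delta_sq_pos[OF assms] less_irrefl in \<open>auto simp: ellip_F_am[OF assms] jacobi_am_isCont[OF assms]
          intro!: ellip_F_deriv[OF assms]\<close>, metis less_irrefl)
  then show ?thesis by (simp add: jacobi_dn_def jacobi_sn_def)
qed

lemma jacobi_sn_cn: "(jacobi_cn k u)\<^sup>2 = 1 - (jacobi_sn k u)\<^sup>2"
  by (simp add: jacobi_sn_def jacobi_cn_def cos_squared_eq)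

lemma jacobi_dn_sn:
  assumes "0 < k" "k < 1"
  shows "(jacobi_dn k u)\<^sup>2 = 1 - k\<^sup>2 * (jacobi_sn k u)\<^sup>2"
  using Delta_sq_pos[OF assms] by (simp add: jacobi_dn_def jacobi_sn_def less_imp_le)

lemma jacobi_sn_deriv:
  assumes "0 < k" "k < 1"
  shows "(jacobi_sn k has_real_derivative jacobi_cn k u * jacobi_dn k u) (at u)"
  unfolding jacobi_sn_def[abs_def] jacobi_cn_def
  by (rule derivative_eq_intros jacobi_am_deriv[OF assms] refl)+

lemma jacobi_cn_deriv:
  assumes "0 < k" "k < 1"
  shows "(jacobi_cn k has_real_derivative - (jacobi_sn k u * jacobi_dn k u)) (at u)"
  unfolding jacobi_cn_def[abs_def] jacobi_sn_def
  by (rule derivative_eq_intros jacobi_am_deriv[OF assms] refl)+ simp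

lemma jacobi_dn_deriv:
  assumes "0 < k" "k < 1"
  shows "(jacobi_dn k has_real_derivative - (k\<^sup>2 * jacobi_sn k u * jacobi_cn k u)) (at u)"
proof -
  have nz: "jacobi_dn k u > 0" by (rule jacobi_dn_pos[OF assms])
  then have "1 - k\<^sup>2 * (jacobi_sn k u)\<^sup>2 > 0" by (simp add: jacobi_dn_def)
  then have "((\<lambda>u. sqrt (1 - k\<^sup>2 * (jacobi_sn k u)\<^sup>2)) has_real_derivative
      - (k\<^sup>2 * (2 * jacobi_sn k u * (jacobi_cn k u * jacobi_dn k u))) / (2 * jacobi_dn k u)) (at u)"
    by (auto intro!: derivative_eq_intros jacobi_sn_deriv[OF assms] simp: jacobi_dn_def field_simps)
  moreover have "(\<lambda>u. sqrt (1 - k\<^sup>2 * (jacobi_sn k u)\<^sup>2)) = jacobi_dn k"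
    by (simp add: jacobi_dn_def fun_eq_iff)
  ultimately show ?thesis using nz by (simp add: field_simps)
qed

section \<open>Periods, special values, parity and signs\<close>

lemma ellip_F_add_pi:
  assumes "0 < k" "k < 1"
  shows "ellip_F k (x + pi) = ellip_F k x + 2 * ellip_K k"
  unfolding ellip_F_def ellip_K_def by (rule interval_integral_pi_periodic[OF cont_inv_Delta[OF assms]]) simp_all

lemma jacobi_am_shift:
  assumes "0 < k" "k < 1"
  shows "jacobi_am k (u + 2 * ellip_K k) = jacobi_am k u + pi"
  by (metis am_ellip_F[OF assms] ellip_F_am[OF assms] ellip_F_add_pi[OF assms])

lemma jacobi_am_0 [simp]:
  assumes "0 < k" "k < 1"
  shows "jacobi_am k 0 = 0"
  using am_ellip_F[OF assms, of 0] by simp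

lemma jacobi_am_K [simp]:
  assumes "0 < k" "k < 1"
  shows "jacobi_am k (ellip_K k) = pi / 2"
  using am_ellip_F[OF assms, of "pi/2"] by (simp add: ellip_F_half_pi)

lemma jacobi_values:
  assumes "0 < k" "k < 1"
  shows "jacobi_sn k 0 = 0" "jacobi_cn k 0 = 1" "jacobi_dn k 0 = 1"
    "jacobi_sn k (ellip_K k) = 1" "jacobi_cn k (ellip_K k) = 0"
  using assms by (simp_all add: jacobi_sn_def jacobi_cn_def jacobi_dn_def)

lemma jacobi_shift:
  assumes "0 < k" "k < 1"
  shows "jacobi_sn k (u + 2 * ellip_K k) = - jacobi_sn k u"
    "jacobi_cn k (u + 2 * ellip_K k) = - jacobi_cn k u"
    "jacobi_dn k (u + 2 * ellip_K k) = jacobi_dn k u"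
  by (simp_all add: jacobi_sn_def jacobi_cn_def jacobi_dn_def jacobi_am_shift[OF assms])

lemma jacobi_am_strict_mono:
  assumes "0 < k" "k < 1" "u < v"
  shows "jacobi_am k u < jacobi_am k v"
  by (metis assms ellip_F_am linorder_not_le strict_mono_less_eq[OF ellip_F_strict_mono])

lemma jacobi_am_minus:
  assumes "0 < k" "k < 1"
  shows "jacobi_am k (- u) = - jacobi_am k u"
proof -
  have "((\<lambda>x. ellip_F k (- x) + ellip_F k x) has_real_derivative 0) (at x)" for x
    by (auto intro!: derivative_eq_intros DERIV_chain2[OF ellip_F_deriv[OF assms]] ellip_F_deriv[OF assms])
  from DERIV_zero_imp_eq[OF this, of _ 0] have "ellip_F k (- x) = - ellip_F k x" for x
    by (simp add: eq_neg_iff_add_eq_0)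
  then show ?thesis by (metis am_ellip_F[OF assms] ellip_F_am[OF assms])
qed

lemma ellip_K_pos:
  assumes "0 < k" "k < 1"
  shows "ellip_K k > 0"
proof -
  have "pi / 2 \<le> ellip_K k"
    using ellip_F_diff_ge[OF assms, of 0 "pi/2"] by (simp add: ellip_F_half_pi)
  then show ?thesis using pi_half_gt_zero by linarith
qed

lemma jacobi_sn_pos:
  assumes "0 < k" "k < 1" "0 < u" "u < 2 * ellip_K k"
  shows "jacobi_sn k u > 0"
  using jacobi_am_strict_mono[OF assms(1,2), of 0 u] jacobi_am_strict_mono[OF assms(1,2), of u "2 * ellip_K k"]
    jacobi_am_shift[OF assms(1,2), of 0] assms
  by (simp add: jacobi_sn_def sin_gt_zero)

lemma jacobi_cn_pos:
  assumes "0 < k" "k < 1" "\<bar>u\<bar> < ellip_K k"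
  shows "jacobi_cn k u > 0"
  using jacobi_am_strict_mono[OF assms(1,2), of "- ellip_K k" u] jacobi_am_strict_mono[OF assms(1,2), of u "ellip_K k"]
    assms jacobi_am_minus[OF assms(1,2), of "ellip_K k"]
  by (auto simp: jacobi_cn_def intro!: cos_gt_zero_pi)

lemma comp_modulus_bounds:
  assumes "0 < k" "k < 1"
  shows "0 < comp_modulus k" "comp_modulus k < 1" "(comp_modulus k)\<^sup>2 = 1 - k\<^sup>2"
proof -
  have "k\<^sup>2 < 1" using assms by (simp add: power_less_one_iff)
  then show "0 < comp_modulus k" "comp_modulus k < 1" "(comp_modulus k)\<^sup>2 = 1 - k\<^sup>2"
    using assms by (simp_all add: comp_modulus_def)
qed

lemma cont_jacobi_dn:
  assumes "0 < k" "k < 1"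
  shows "continuous_on S (jacobi_dn k)"
  by (meson jacobi_dn_deriv[OF assms] DERIV_isCont continuous_at_imp_continuous_on)

section \<open>The zeta function on the real line\<close>

lemma jacobi_zeta_deriv:
  assumes "0 < k" "k < 1"
  shows "(jacobi_zeta k has_real_derivative (jacobi_dn k u)\<^sup>2 - ellip_E k / ellip_K k) (at u)"
  unfolding jacobi_zeta_def[abs_def]
  by (rule interval_integral_DERIV) (intro continuous_intros cont_jacobi_dn[OF assms])

lemma jacobi_zeta_0 [simp]: "jacobi_zeta k 0 = 0"
  by (simp add: jacobi_zeta_def zero_ereal_def)

definition ellip_E_inc :: "real \<Rightarrow> real \<Rightarrow> real" where
  "ellip_E_inc k x = (LBINT t=0..x. sqrt (1 - k\<^sup>2 * (sin t)\<^sup>2))"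

text \<open>The substitution t = am s turns the integral of dn^2 into Legendre's incomplete integral
  of the second kind. In this form the period 2K and the zero at K can be read off: the linear term
  cancels the increments 2E and E.\<close>

lemma jacobi_zeta_eq:
  assumes "0 < k" "k < 1"
  shows "jacobi_zeta k u = ellip_E_inc k (jacobi_am k u) - ellip_E k / ellip_K k * u"
proof -
  have DE: "(ellip_E_inc k has_real_derivative sqrt (1 - k\<^sup>2 * (sin x)\<^sup>2)) (at x)" for x
    unfolding ellip_E_inc_def[abs_def] by (rule interval_integral_DERIV) (intro continuous_intros)
  have "((\<lambda>u. ellip_E_inc k (jacobi_am k u) - ellip_E k / ellip_K k * u - jacobi_zeta k u)
      has_real_derivative 0) (at u)" for u
    using jacobi_dn_pos[OF assms, of u] Delta_sq_pos[OF assms, of "jacobi_am k u"] ellip_K_pos[OF assms]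
    by (auto intro!: derivative_eq_intros DERIV_chain2[OF DE] jacobi_am_deriv[OF assms] jacobi_zeta_deriv[OF assms]
        simp: jacobi_dn_def jacobi_sn_def power2_eq_square)
  from DERIV_zero_imp_eq[OF this, of u 0] show ?thesis
    using assms by (simp add: ellip_E_inc_def zero_ereal_def)
qed

lemma jacobi_zeta_shift:
  assumes "0 < k" "k < 1"
  shows "jacobi_zeta k (u + 2 * ellip_K k) = jacobi_zeta k u"
proof -
  have "ellip_E_inc k (x + pi) = ellip_E_inc k x + 2 * ellip_E k" for x
    unfolding ellip_E_inc_def ellip_E_def
    by (rule interval_integral_pi_periodic) (auto intro!: continuous_intros)
  then show ?thesis using ellip_K_pos[OF assms]
    by (simp add: jacobi_zeta_eq[OF assms] jacobi_am_shift[OF assms] distrib_left)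
qed

lemma jacobi_zeta_K:
  assumes "0 < k" "k < 1"
  shows "jacobi_zeta k (ellip_K k) = 0"
  using assms ellip_K_pos[OF assms] by (simp add: jacobi_zeta_eq ellip_E_inc_def ellip_E_def)

section \<open>Continuation of the zeta function to the strip\<close>

text \<open>\<open>zeta_re\<close> and \<open>zeta_im\<close> are the parts of \<open>Z(u + iv)\<close>, \<open>zeta_R\<close> and \<open>zeta_W\<close> those of its derivative.
  In the classical formula for the imaginary part the linear term of \<open>zeta_Y\<close> is
  \<open>\<pi>v / (2KK')\<close>; the coefficient below is the one that the Cauchy-Riemann equations require, and
  the two agree by Legendre's relation.\<close>

definition zeta_p :: "real \<Rightarrow> real \<Rightarrow> real" where
  "zeta_p k v = jacobi_sn k v * jacobi_cn k v * jacobi_dn k v"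

definition zeta_p' :: "real \<Rightarrow> real \<Rightarrow> real" where
  "zeta_p' k v = (jacobi_cn k v)\<^sup>2 * (jacobi_dn k v)\<^sup>2 - (jacobi_sn k v)\<^sup>2 * (jacobi_dn k v)\<^sup>2
     - k\<^sup>2 * (jacobi_sn k v)\<^sup>2 * (jacobi_cn k v)\<^sup>2"

text \<open>The addition theorem at u and iv has the denominator 1 - k^2 sn^2(u) sn^2(iv). By sn(iv;
  k) = i sn(v; k') / cn(v; k') it becomes this expression after multiplication by cn^2(v; k'). In
  the closed strip it vanishes only where sn u = 0 and |v| = K', at the poles of Z.\<close>

definition zeta_den :: "real \<Rightarrow> real \<Rightarrow> real \<Rightarrow> real" where
  "zeta_den k u v = 1 - (jacobi_dn k u)\<^sup>2 * (jacobi_sn (comp_modulus k) v)\<^sup>2"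

definition zeta_P :: "real \<Rightarrow> real \<Rightarrow> real \<Rightarrow> real" where
  "zeta_P k u v = (jacobi_dn k u)\<^sup>2 * zeta_p (comp_modulus k) v / zeta_den k u v"

definition zeta_Y :: "real \<Rightarrow> real \<Rightarrow> real" where
  "zeta_Y k v = jacobi_zeta (comp_modulus k) v +
     (ellip_E k / ellip_K k - 1 + ellip_E (comp_modulus k) / ellip_K (comp_modulus k)) * v"

definition zeta_re :: "real \<Rightarrow> real \<Rightarrow> real \<Rightarrow> real" where
  "zeta_re k u v = jacobi_zeta k u + k\<^sup>2 * zeta_p k u * (jacobi_sn (comp_modulus k) v)\<^sup>2 / zeta_den k u v"

definition zeta_im :: "real \<Rightarrow> real \<Rightarrow> real \<Rightarrow> real" where
  "zeta_im k u v = zeta_P k u v - zeta_Y k v"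

definition zeta_R :: "real \<Rightarrow> real \<Rightarrow> real \<Rightarrow> real" where
  "zeta_R k u v = (jacobi_dn k u)\<^sup>2 * zeta_p' (comp_modulus k) v / zeta_den k u v + 2 * (zeta_P k u v)\<^sup>2
     - (jacobi_dn (comp_modulus k) v)\<^sup>2 + 1 - ellip_E k / ellip_K k"

definition zeta_W :: "real \<Rightarrow> real \<Rightarrow> real \<Rightarrow> real" where
  "zeta_W k u v = - 2 * k\<^sup>2 * zeta_p k u * zeta_p (comp_modulus k) v / (zeta_den k u v)\<^sup>2"

definition zeta_cx :: "real \<Rightarrow> complex \<Rightarrow> complex" where
  "zeta_cx k z = Complex (zeta_re k (Re z) (Im z)) (zeta_im k (Re z) (Im z))"

definition zeta_cx' :: "real \<Rightarrow> complex \<Rightarrow> complex" where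
  "zeta_cx' k z = Complex (zeta_R k (Re z) (Im z)) (zeta_W k (Re z) (Im z))"

lemma zeta_den_eq:
  assumes "0 < k" "k < 1"
  shows "zeta_den k u v = (jacobi_cn (comp_modulus k) v)\<^sup>2 + k\<^sup>2 * (jacobi_sn k u)\<^sup>2 * (jacobi_sn (comp_modulus k) v)\<^sup>2"
  by (simp add: zeta_den_def jacobi_dn_sn[OF assms] jacobi_sn_cn algebra_simps)

lemma zeta_den_pos:
  assumes "0 < k" "k < 1" "\<bar>v\<bar> < ellip_K (comp_modulus k)"
  shows "zeta_den k u v > 0"
  unfolding zeta_den_eq[OF assms(1,2)]
  using jacobi_cn_pos[OF comp_modulus_bounds(1,2)[OF assms(1,2)] assms(3)]
  by (intro add_pos_nonneg) auto

lemma has_derivative_Re_comp: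
  assumes "(f has_real_derivative f') (at (Re z))"
  shows "((\<lambda>z. f (Re z)) has_derivative (\<lambda>h. f' * Re h)) (at z)"
  using has_derivative_compose[OF bounded_linear_Re[THEN bounded_linear_imp_has_derivative] assms[unfolded has_field_derivative_def]]
  by simp

lemma has_derivative_Im_comp:
  assumes "(f has_real_derivative f') (at (Im z))"
  shows "((\<lambda>z. f (Im z)) has_derivative (\<lambda>h. f' * Im h)) (at z)"
  using has_derivative_compose[OF bounded_linear_Im[THEN bounded_linear_imp_has_derivative] assms[unfolded has_field_derivative_def]]
  by simp

lemma zeta_p_deriv:
  assumes "0 < k" "k < 1"
  shows "(zeta_p k has_real_derivative zeta_p' k u) (at u)"
  unfolding zeta_p_def[abs_def] zeta_p'_def
  by (rule derivative_eq_intros jacobi_sn_deriv[OF assms] jacobi_cn_deriv[OF assms] jacobi_dn_deriv[OF assms] refl)+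
     (simp add: power2_eq_square algebra_simps)

lemma jacobi_sn2_deriv:
  assumes "0 < k" "k < 1"
  shows "((\<lambda>u. (jacobi_sn k u)\<^sup>2) has_real_derivative 2 * zeta_p k u) (at u)"
  by (rule derivative_eq_intros jacobi_sn_deriv[OF assms] refl)+ (simp add: zeta_p_def)

lemma jacobi_dn2_deriv:
  assumes "0 < k" "k < 1"
  shows "((\<lambda>u. (jacobi_dn k u)\<^sup>2) has_real_derivative - 2 * k\<^sup>2 * zeta_p k u) (at u)"
  by (rule derivative_eq_intros jacobi_dn_deriv[OF assms] refl)+ (simp add: zeta_p_def)

lemma zeta_Y_deriv:
  assumes "0 < k" "k < 1"
  shows "(zeta_Y k has_real_derivative (jacobi_dn (comp_modulus k) v)\<^sup>2 - 1 + ellip_E k / ellip_K k) (at v)"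
  unfolding zeta_Y_def[abs_def]
  by (rule derivative_eq_intros jacobi_zeta_deriv[OF comp_modulus_bounds(1,2)[OF assms]] refl)+ simp

lemma zeta_p_sq:
  assumes "0 < k" "k < 1"
  shows "(zeta_p k u)\<^sup>2 = (jacobi_sn k u)\<^sup>2 * (1 - (jacobi_sn k u)\<^sup>2) * (1 - k\<^sup>2 * (jacobi_sn k u)\<^sup>2)"
  by (simp add: zeta_p_def power_mult_distrib jacobi_sn_cn jacobi_dn_sn[OF assms])

lemma zeta_p'_eq:
  assumes "0 < k" "k < 1"
  shows "zeta_p' k u = 1 - 2 * (1 + k\<^sup>2) * (jacobi_sn k u)\<^sup>2 + 3 * k\<^sup>2 * ((jacobi_sn k u)\<^sup>2)\<^sup>2"
  unfolding zeta_p'_def jacobi_sn_cn jacobi_dn_sn[OF assms] by algebra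

text \<open>The left side is the v-derivative of \<open>zeta_im\<close>, the right side the
  u-derivative of \<open>zeta_re\<close>. Apart from E/K both are rational in sn^2(u; k), sn^2(v;
  k') and k^2, because \<open>zeta_p\<close> enters only through its square.\<close>

lemma zeta_cauchy_riemann:
  assumes "0 < k" "k < 1" "\<bar>v\<bar> < ellip_K (comp_modulus k)"
  shows "zeta_R k u v = (jacobi_dn k u)\<^sup>2 - ellip_E k / ellip_K k +
     k\<^sup>2 * (jacobi_sn (comp_modulus k) v)\<^sup>2 *
       (zeta_p' k u * zeta_den k u v - 2 * k\<^sup>2 * (zeta_p k u)\<^sup>2 * (jacobi_sn (comp_modulus k) v)\<^sup>2) / (zeta_den k u v)\<^sup>2"
proof -
  define S T D where "S = (jacobi_sn k u)\<^sup>2" and "T = (jacobi_sn (comp_modulus k) v)\<^sup>2" and "D = zeta_den k u v"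
  note k' = comp_modulus_bounds[OF assms(1,2)]
  have D: "D = 1 - (1 - k\<^sup>2 * S) * T" "D \<noteq> 0"
    using zeta_den_pos[OF assms, of u] by (simp_all add: D_def zeta_den_def jacobi_dn_sn[OF assms(1,2)] S_def T_def)
  \<comment> \<open>\<open>p1\<close> and \<open>p\<close> stand for the squares of
    \<open>zeta_p\<close> at v and u, whereas \<open>p1'\<close> and \<open>p'\<close> stand for
    \<open>zeta_p'\<close> itself.\<close>
  define p1 p1' p p' where "p1 = T * (1 - T) * (1 - (1 - k\<^sup>2) * T)"
    and "p1' = 1 - 2 * (2 - k\<^sup>2) * T + 3 * (1 - k\<^sup>2) * T\<^sup>2"
    and "p = S * (1 - S) * (1 - k\<^sup>2 * S)" and "p' = 1 - 2 * (1 + k\<^sup>2) * S + 3 * k\<^sup>2 * S\<^sup>2"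
  have "(1 - k\<^sup>2 * S) * p1' * D + 2 * (1 - k\<^sup>2 * S)\<^sup>2 * p1 - (1 - (1 - k\<^sup>2) * T) * D\<^sup>2 + D\<^sup>2
      = (1 - k\<^sup>2 * S) * D\<^sup>2 + k\<^sup>2 * T * (p' * D - 2 * k\<^sup>2 * p * T)"
    unfolding D p1_def p1'_def p_def p'_def by algebra
  then have "((1 - k\<^sup>2 * S) * p1' * D + 2 * (1 - k\<^sup>2 * S)\<^sup>2 * p1 - (1 - (1 - k\<^sup>2) * T) * D\<^sup>2 + D\<^sup>2) / D\<^sup>2
      = ((1 - k\<^sup>2 * S) * D\<^sup>2 + k\<^sup>2 * T * (p' * D - 2 * k\<^sup>2 * p * T)) / D\<^sup>2" by simp
  then have "(1 - k\<^sup>2 * S) * p1' / D + 2 * ((1 - k\<^sup>2 * S)\<^sup>2 * p1 / D\<^sup>2) - (1 - (1 - k\<^sup>2) * T) + 1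
      = (1 - k\<^sup>2 * S) + k\<^sup>2 * T * (p' * D - 2 * k\<^sup>2 * p * T) / D\<^sup>2"
    using D(2) by (simp add: add_divide_distrib diff_divide_distrib power2_eq_square)
  moreover have "p1 = (zeta_p (comp_modulus k) v)\<^sup>2" "p1' = zeta_p' (comp_modulus k) v"
    by (simp_all add: p1_def p1'_def zeta_p_sq[OF k'(1,2)] zeta_p'_eq[OF k'(1,2)] k'(3) T_def)
  moreover have "p = (zeta_p k u)\<^sup>2" "p' = zeta_p' k u"
    by (simp_all add: p_def p'_def zeta_p_sq[OF assms(1,2)] zeta_p'_eq[OF assms(1,2)] S_def)
  ultimately show ?thesis
    by (simp add: zeta_R_def zeta_P_def jacobi_dn_sn[OF assms(1,2)] jacobi_dn_sn[OF k'(1,2)] k'(3)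
        power_divide power_mult_distrib flip: S_def T_def D_def)
qed

lemma zeta_den_deriv:
  assumes "0 < k" "k < 1"
  shows "((\<lambda>z. zeta_den k (Re z) (Im z)) has_derivative (\<lambda>h.
      2 * k\<^sup>2 * zeta_p k (Re z) * (jacobi_sn (comp_modulus k) (Im z))\<^sup>2 * Re h
      - 2 * (jacobi_dn k (Re z))\<^sup>2 * zeta_p (comp_modulus k) (Im z) * Im h)) (at z)"
  unfolding zeta_den_def
  by (rule derivative_eq_intros has_derivative_Re_comp[OF jacobi_dn2_deriv[OF assms]]
      has_derivative_Im_comp[OF jacobi_sn2_deriv[OF comp_modulus_bounds(1,2)[OF assms]]] refl)+
     (simp add: fun_eq_iff algebra_simps)

lemma zeta_re_deriv:
  assumes "0 < k" "k < 1" "\<bar>Im z\<bar> < ellip_K (comp_modulus k)"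
  shows "((\<lambda>z. zeta_re k (Re z) (Im z)) has_derivative
     (\<lambda>h. zeta_R k (Re z) (Im z) * Re h - zeta_W k (Re z) (Im z) * Im h)) (at z)"
proof -
  define D where "D = zeta_den k (Re z) (Im z)"
  have D: "D \<noteq> 0" using zeta_den_pos[OF assms, of "Re z"] by (simp add: D_def)
  let ?t = "(jacobi_sn (comp_modulus k) (Im z))\<^sup>2"
  have "((\<lambda>z. k\<^sup>2 * zeta_p k (Re z) * (jacobi_sn (comp_modulus k) (Im z))\<^sup>2) has_derivative
      (\<lambda>h. k\<^sup>2 * zeta_p' k (Re z) * ?t * Re h + k\<^sup>2 * zeta_p k (Re z) * (2 * zeta_p (comp_modulus k) (Im z)) * Im h)) (at z)"
    by (rule has_derivative_Re_comp[OF zeta_p_deriv[OF assms(1,2)]]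
      has_derivative_Im_comp[OF jacobi_sn2_deriv[OF comp_modulus_bounds(1,2)[OF assms(1,2)]]] derivative_eq_intros refl)+
      (simp add: fun_eq_iff algebra_simps)
  note has_derivative_add[OF has_derivative_Re_comp[OF jacobi_zeta_deriv[OF assms(1,2)]]
      has_derivative_divide'[OF this zeta_den_deriv[OF assms(1,2)] D[unfolded D_def]]]
  moreover have "((jacobi_dn k (Re z))\<^sup>2 - ellip_E k / ellip_K k) * Re h +
      ((k\<^sup>2 * zeta_p' k (Re z) * ?t * Re h + k\<^sup>2 * zeta_p k (Re z) * (2 * zeta_p (comp_modulus k) (Im z)) * Im h) * D
       - k\<^sup>2 * zeta_p k (Re z) * ?t * (2 * k\<^sup>2 * zeta_p k (Re z) * ?t * Re h
      - 2 * (jacobi_dn k (Re z))\<^sup>2 * zeta_p (comp_modulus k) (Im z) * Im h)) / (D * D)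
      = zeta_R k (Re z) (Im z) * Re h - zeta_W k (Re z) (Im z) * Im h" for h
  proof -
    \<comment> \<open>In the coefficient of \<open>Im h\<close> the two terms of the quotient rule
      combine to a multiple of \<open>D\<close> + dn^2 \<open>?t\<close>, which this relation
      collapses to 1.\<close>
    have "D + (jacobi_dn k (Re z))\<^sup>2 * ?t = 1" by (simp add: D_def zeta_den_def)
    then show ?thesis
      unfolding zeta_W_def zeta_cauchy_riemann[OF assms] D_def[symmetric] using D
      by (simp add: divide_simps power2_eq_square) algebra
  qed
  ultimately show ?thesis unfolding zeta_re_def D_def by simp
qed

lemma zeta_im_deriv:
  assumes "0 < k" "k < 1" "\<bar>Im z\<bar> < ellip_K (comp_modulus k)"
  shows "((\<lambda>z. zeta_im k (Re z) (Im z)) has_derivative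
     (\<lambda>h. zeta_W k (Re z) (Im z) * Re h + zeta_R k (Re z) (Im z) * Im h)) (at z)"
proof -
  define D where "D = zeta_den k (Re z) (Im z)"
  have D: "D \<noteq> 0" using zeta_den_pos[OF assms, of "Re z"] by (simp add: D_def)
  let ?t = "(jacobi_sn (comp_modulus k) (Im z))\<^sup>2" and ?y = "(jacobi_dn k (Re z))\<^sup>2"
  have "((\<lambda>z. (jacobi_dn k (Re z))\<^sup>2 * zeta_p (comp_modulus k) (Im z)) has_derivative
      (\<lambda>h. ?y * zeta_p' (comp_modulus k) (Im z) * Im h - 2 * k\<^sup>2 * zeta_p k (Re z) * zeta_p (comp_modulus k) (Im z) * Re h)) (at z)"
    by (rule has_derivative_Re_comp[OF jacobi_dn2_deriv[OF assms(1,2)]]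
      has_derivative_Im_comp[OF zeta_p_deriv[OF comp_modulus_bounds(1,2)[OF assms(1,2)]]] derivative_eq_intros refl)+
      (simp add: fun_eq_iff algebra_simps)
  note has_derivative_diff[OF 
      has_derivative_divide'[OF this zeta_den_deriv[OF assms(1,2)] D[unfolded D_def]] has_derivative_Im_comp[OF zeta_Y_deriv[OF assms(1,2)]]]
  moreover have "((?y * zeta_p' (comp_modulus k) (Im z) * Im h - 2 * k\<^sup>2 * zeta_p k (Re z) * zeta_p (comp_modulus k) (Im z) * Re h) * D
       - ?y * zeta_p (comp_modulus k) (Im z) * (2 * k\<^sup>2 * zeta_p k (Re z) * ?t * Re h
      - 2 * ?y * zeta_p (comp_modulus k) (Im z) * Im h)) / (D * D)
       - ((jacobi_dn (comp_modulus k) (Im z))\<^sup>2 - 1 + ellip_E k / ellip_K k) * Im h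
      = zeta_W k (Re z) (Im z) * Re h + zeta_R k (Re z) (Im z) * Im h" for h
  proof -
    have "D + ?y * ?t = 1" by (simp add: D_def zeta_den_def)
    then show ?thesis
      unfolding zeta_W_def zeta_R_def zeta_P_def D_def[symmetric] using D
      by (simp add: divide_simps power2_eq_square) algebra
  qed
  ultimately show ?thesis unfolding zeta_im_def zeta_P_def D_def by simp
qed

lemma zeta_cx_deriv:
  assumes "0 < k" "k < 1" "\<bar>Im z\<bar> < ellip_K (comp_modulus k)"
  shows "(zeta_cx k has_field_derivative zeta_cx' k z) (at z)"
proof -
  have "zeta_cx k = (\<lambda>z. of_real (zeta_re k (Re z) (Im z)) + \<i> * of_real (zeta_im k (Re z) (Im z)))"
    by (simp add: fun_eq_iff zeta_cx_def complex_eq_iff)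
  moreover have "((\<lambda>z. of_real (zeta_re k (Re z) (Im z)) + \<i> * of_real (zeta_im k (Re z) (Im z)))
      has_derivative (*) (zeta_cx' k z)) (at z)"
    by (rule derivative_eq_intros zeta_re_deriv[OF assms] zeta_im_deriv[OF assms] refl)+
       (simp add: fun_eq_iff zeta_cx'_def complex_eq_iff algebra_simps)
  ultimately show ?thesis by (simp add: has_field_derivative_def)
qed

lemma zeta_cx_holomorphic:
  assumes "0 < k" "k < 1"
  shows "zeta_cx k holomorphic_on zeta_strip k"
  unfolding holomorphic_on_def field_differentiable_def zeta_strip_def
  using zeta_cx_deriv[OF assms] has_field_derivative_at_within by blast

lemma zeta_Y_0 [simp]: "zeta_Y k 0 = 0"
  by (simp add: zeta_Y_def)

text \<open>Exhibiting \<open>zeta_cx\<close> proves that an extension exists, so the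
  \<open>SOME\<close> in \<open>jacobi_zeta_ext\<close> picks one; uniqueness then identifies the
  two on the strip.\<close>

lemma jacobi_zeta_ext_eq:
  assumes "0 < k" "k < 1" "z \<in> zeta_strip k"
  shows "jacobi_zeta_ext k z = zeta_cx k z"
proof -
  have "is_zeta_extension k (zeta_cx k)"
    using zeta_cx_holomorphic[OF assms(1,2)] comp_modulus_bounds[OF assms(1,2)]
    by (simp add: is_zeta_extension_def zeta_cx_def zeta_re_def zeta_im_def zeta_P_def zeta_p_def jacobi_values complex_of_real_def)
  then have "is_zeta_extension k (jacobi_zeta_ext k)"
    unfolding jacobi_zeta_ext_def by (rule someI[where P = "is_zeta_extension k"])
  then show ?thesis using \<open>is_zeta_extension k (zeta_cx k)\<close> assms(3) by (rule zeta_extension_unique)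
qed

lemma jacobi_sn_minus:
  assumes "0 < k" "k < 1"
  shows "jacobi_sn k (- u) = - jacobi_sn k u" "jacobi_cn k (- u) = jacobi_cn k u" "jacobi_dn k (- u) = jacobi_dn k u"
  by (simp_all add: jacobi_sn_def jacobi_cn_def jacobi_dn_def jacobi_am_minus[OF assms])

lemma jacobi_zeta_minus:
  assumes "0 < k" "k < 1"
  shows "jacobi_zeta k (- u) = - jacobi_zeta k u"
proof -
  have "((\<lambda>u. jacobi_zeta k (- u) + jacobi_zeta k u) has_real_derivative 0) (at u)" for u
    by (auto intro!: derivative_eq_intros DERIV_chain2[OF jacobi_zeta_deriv[OF assms]] jacobi_zeta_deriv[OF assms]
        simp: jacobi_sn_minus[OF assms])
  from DERIV_zero_imp_eq[OF this, of u 0] show ?thesis by (simp add: eq_neg_iff_add_eq_0)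
qed

text \<open>Schwarz reflection. It makes the two zeta values in \<open>wave\<close> conjugate, and
  it separates real and imaginary parts by means of the lines at heights v and -v.\<close>

lemma zeta_cx_cnj:
  assumes "0 < k" "k < 1"
  shows "zeta_cx k (cnj z) = cnj (zeta_cx k z)"
  using comp_modulus_bounds(1,2)[OF assms]
  by (simp add: zeta_cx_def complex_eq_iff zeta_re_def zeta_im_def zeta_P_def zeta_Y_def zeta_p_def zeta_den_def
      jacobi_sn_minus jacobi_zeta_minus)

lemma zeta_cx'_cnj:
  assumes "0 < k" "k < 1"
  shows "zeta_cx' k (cnj z) = cnj (zeta_cx' k z)"
  using comp_modulus_bounds(1,2)[OF assms]
  by (simp add: zeta_cx'_def complex_eq_iff zeta_R_def zeta_W_def zeta_P_def zeta_p_def zeta_p'_def zeta_den_def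
      jacobi_sn_minus)

lemma zeta_shift:
  assumes "0 < k" "k < 1"
  shows "zeta_re k (u + 2 * ellip_K k) v = zeta_re k u v" "zeta_im k (u + 2 * ellip_K k) v = zeta_im k u v"
    "zeta_R k (u + 2 * ellip_K k) v = zeta_R k u v" "zeta_W k (u + 2 * ellip_K k) v = zeta_W k u v"
  by (simp_all add: zeta_re_def zeta_im_def zeta_R_def zeta_W_def zeta_P_def zeta_den_def zeta_p_def
      jacobi_shift[OF assms] jacobi_zeta_shift[OF assms])

lemma zeta_cx_shift:
  assumes "0 < k" "k < 1"
  shows "zeta_cx k (z + of_real (2 * ellip_K k)) = zeta_cx k z"
  using zeta_shift[OF assms] by (simp add: zeta_cx_def)

section \<open>Addition theorems\<close>

text \<open>Both formulas are shown by differentiating along \<open>u + v = w\<close>.\<close>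

lemma jacobi_sn_add:
  assumes k: "0 < k" "k < 1"
  shows "jacobi_sn k (u + v) = (jacobi_sn k u * jacobi_cn k v * jacobi_dn k v + jacobi_sn k v * jacobi_cn k u * jacobi_dn k u)
     / (1 - k\<^sup>2 * (jacobi_sn k u)\<^sup>2 * (jacobi_sn k v)\<^sup>2)"
    and jacobi_zeta_add: "jacobi_zeta k (u + v) = jacobi_zeta k u + jacobi_zeta k v
      - k\<^sup>2 * jacobi_sn k u * jacobi_sn k v * jacobi_sn k (u + v)"
proof -
  define w where "w = u + v"
  have Dpos: "1 - k\<^sup>2 * (jacobi_sn k x)\<^sup>2 * (jacobi_sn k y)\<^sup>2 > 0" for x y
  proof -
    have "(k\<^sup>2 * (jacobi_sn k x)\<^sup>2) * (jacobi_sn k y)\<^sup>2 \<le> (k\<^sup>2 * (jacobi_sn k x)\<^sup>2) * 1"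
      by (intro mult_left_mono) (auto simp: jacobi_sn_def abs_square_le_1)
    then show ?thesis using Delta_sq_pos[OF k, of "jacobi_am k x"] by (simp add: jacobi_sn_def)
  qed
  define N D where "N = (\<lambda>x. jacobi_sn k x * (jacobi_cn k (w - x) * jacobi_dn k (w - x)) + jacobi_sn k (w - x) * (jacobi_cn k x * jacobi_dn k x))"
    and "D = (\<lambda>x. 1 - k\<^sup>2 * (jacobi_sn k x)\<^sup>2 * (jacobi_sn k (w - x))\<^sup>2)"
  note der = jacobi_sn_deriv[OF k] jacobi_cn_deriv[OF k] jacobi_dn_deriv[OF k] jacobi_zeta_deriv[OF k]
  have sqs: "(jacobi_cn k x)\<^sup>2 = 1 - (jacobi_sn k x)\<^sup>2" "(jacobi_dn k x)\<^sup>2 = 1 - k\<^sup>2 * (jacobi_sn k x)\<^sup>2" for x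
    by (rule jacobi_sn_cn jacobi_dn_sn[OF k])+
  have "((\<lambda>x. N x / D x) has_real_derivative 0) (at x)" for x
  proof -
    let ?s = "jacobi_sn k x" and ?c = "jacobi_cn k x" and ?d = "jacobi_dn k x"
    let ?S = "jacobi_sn k (w - x)" and ?C = "jacobi_cn k (w - x)" and ?E = "jacobi_dn k (w - x)"
    have "(N has_real_derivative ?c * ?d * ?C * ?E + ?s * (?S * ?E * ?E + k\<^sup>2 * ?S * ?C * ?C)
        - ?C * ?E * ?c * ?d - ?S * (?s * ?d * ?d + k\<^sup>2 * ?s * ?c * ?c)) (at x)"
      unfolding N_def by (rule derivative_eq_intros der DERIV_chain2[where f="jacobi_sn k"] DERIV_chain2[where f="jacobi_cn k"]
          DERIV_chain2[where f="jacobi_dn k"] refl)+ (simp add: algebra_simps)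
    moreover have "(D has_real_derivative - k\<^sup>2 * (2 * ?s * ?c * ?d * ?S\<^sup>2 - 2 * ?s\<^sup>2 * ?S * ?C * ?E)) (at x)"
      unfolding D_def by (rule derivative_eq_intros der DERIV_chain2[where f="jacobi_sn k"] refl)+ (simp add: algebra_simps)
    ultimately have "((\<lambda>x. N x / D x) has_real_derivative ((?c * ?d * ?C * ?E + ?s * (?S * ?E * ?E + k\<^sup>2 * ?S * ?C * ?C)
        - ?C * ?E * ?c * ?d - ?S * (?s * ?d * ?d + k\<^sup>2 * ?s * ?c * ?c)) * D x - N x *
        (- k\<^sup>2 * (2 * ?s * ?c * ?d * ?S\<^sup>2 - 2 * ?s\<^sup>2 * ?S * ?C * ?E))) / (D x * D x)) (at x)"
      using Dpos[of x "w - x"] by (intro DERIV_divide) (auto simp: D_def)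
    moreover have "(?c * ?d * ?C * ?E + ?s * (?S * ?E * ?E + k\<^sup>2 * ?S * ?C * ?C)
        - ?C * ?E * ?c * ?d - ?S * (?s * ?d * ?d + k\<^sup>2 * ?s * ?c * ?c)) * D x - N x *
        (- k\<^sup>2 * (2 * ?s * ?c * ?d * ?S\<^sup>2 - 2 * ?s\<^sup>2 * ?S * ?C * ?E)) = 0"
      unfolding N_def D_def using sqs[of x] sqs[of "w - x"] by algebra
    ultimately show ?thesis by simp
  qed
  from DERIV_zero_imp_eq[OF this, of _ 0]
  have ND: "N x / D x = jacobi_sn k w" for x using k by (simp add: N_def D_def jacobi_values)
  from ND[of u] show "jacobi_sn k (u + v) = (jacobi_sn k u * jacobi_cn k v * jacobi_dn k v + jacobi_sn k v * jacobi_cn k u * jacobi_dn k u)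
     / (1 - k\<^sup>2 * (jacobi_sn k u)\<^sup>2 * (jacobi_sn k v)\<^sup>2)"
    by (simp add: N_def D_def w_def mult.assoc)
  have "((\<lambda>x. jacobi_zeta k x + jacobi_zeta k (w - x) - k\<^sup>2 * jacobi_sn k x * jacobi_sn k (w - x) * jacobi_sn k w)
     has_real_derivative 0) (at x)" for x
  proof -
    let ?s = "jacobi_sn k x" and ?c = "jacobi_cn k x" and ?d = "jacobi_dn k x"
    let ?S = "jacobi_sn k (w - x)" and ?C = "jacobi_cn k (w - x)" and ?E = "jacobi_dn k (w - x)"
    \<comment> \<open>The derivative contains the constant factor sn w. Multiplying by
      \<open>D\<close> and inserting the addition theorem for sn leaves an identity in the functions
      at x and w - x only.\<close>
    have "jacobi_sn k w * D x = N x" using ND[of x] Dpos[of x "w - x"] by (simp add: D_def field_simps)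
    moreover have "((?d\<^sup>2 - ?E\<^sup>2) * D x - k\<^sup>2 * (?c * ?d * ?S - ?s * ?C * ?E) * N x) = 0"
      unfolding N_def D_def using sqs[of x] sqs[of "w - x"] by algebra
    ultimately have "((?d\<^sup>2 - ?E\<^sup>2) - k\<^sup>2 * (?c * ?d * ?S - ?s * ?C * ?E) * jacobi_sn k w) * D x = 0"
      by (simp add: left_diff_distrib mult.assoc)
    then have *: "(?d\<^sup>2 - ?E\<^sup>2) - k\<^sup>2 * (?c * ?d * ?S - ?s * ?C * ?E) * jacobi_sn k w = 0"
      using Dpos[of x "w - x"] by (simp add: D_def)
    show ?thesis
      by (rule derivative_eq_intros der DERIV_chain2[where f="jacobi_sn k"] DERIV_chain2[where f="jacobi_zeta k"] refl)+
         (use * in \<open>simp add: algebra_simps\<close>)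
  qed
  from DERIV_zero_imp_eq[OF this, of u 0]
  show "jacobi_zeta k (u + v) = jacobi_zeta k u + jacobi_zeta k v
      - k\<^sup>2 * jacobi_sn k u * jacobi_sn k v * jacobi_sn k (u + v)"
    using k by (simp add: w_def jacobi_values)
qed

text \<open>Since sn 2b = 2p/D with D = 1 - k^2 sn^4 b, the quotient cn dn / sn at 2b is half the
  logarithmic derivative of p/D in b, that is p'/(2p) - D'/(2D). The second term cancels the product
  k^2 sn^2 b sn 2b from the addition theorem for Z.\<close>

lemma jacobi_zeta_duplication:
  assumes k: "0 < k" "k < 1" and p: "zeta_p k b \<noteq> 0"
  shows "jacobi_zeta k (2 * b) + jacobi_cn k (2 * b) * jacobi_dn k (2 * b) / jacobi_sn k (2 * b)
     = 2 * jacobi_zeta k b + zeta_p' k b / (2 * zeta_p k b)"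
proof -
  define D where "D = (\<lambda>x. 1 - k\<^sup>2 * ((jacobi_sn k x)\<^sup>2)\<^sup>2)"
  have Dpos: "D x > 0" for x
  proof -
    have "(k\<^sup>2 * (jacobi_sn k x)\<^sup>2) * (jacobi_sn k x)\<^sup>2 \<le> (k\<^sup>2 * (jacobi_sn k x)\<^sup>2) * 1"
      by (intro mult_left_mono) (auto simp: jacobi_sn_def abs_square_le_1)
    then show ?thesis using Delta_sq_pos[OF k, of "jacobi_am k x"] 
      by (simp add: jacobi_sn_def D_def power2_eq_square mult.assoc)
  qed
  have dup: "jacobi_sn k (2 * x) = 2 * zeta_p k x / D x" for x
    using jacobi_sn_add[OF k, of x x] by (simp add: zeta_p_def D_def power2_eq_square mult_ac)
  have "((\<lambda>x. jacobi_sn k (2 * x)) has_real_derivative 2 * (jacobi_cn k (2 * b) * jacobi_dn k (2 * b))) (at b)"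
  proof -
    have "((\<lambda>x. 2 * x) has_real_derivative 2) (at b)" by (auto intro!: derivative_eq_intros)
    from DERIV_chain2[OF jacobi_sn_deriv[OF k] this] show ?thesis by (simp add: mult_ac)
  qed
  moreover have "((\<lambda>x. 2 * zeta_p k x / D x) has_real_derivative
     (2 * zeta_p' k b * D b - 2 * zeta_p k b * (- k\<^sup>2 * (2 * (jacobi_sn k b)\<^sup>2 * (2 * zeta_p k b)))) / (D b * D b)) (at b)"
    unfolding D_def
    by (rule derivative_eq_intros zeta_p_deriv[OF k] jacobi_sn2_deriv[OF k] refl)+
       (use Dpos[of b] in \<open>auto simp: D_def\<close>)
  ultimately have CD: "2 * (jacobi_cn k (2 * b) * jacobi_dn k (2 * b)) =
     (2 * zeta_p' k b * D b - 2 * zeta_p k b * (- k\<^sup>2 * (2 * (jacobi_sn k b)\<^sup>2 * (2 * zeta_p k b)))) / (D b * D b)"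
    using dup DERIV_unique by simp
  have Z: "jacobi_zeta k (2 * b) = 2 * jacobi_zeta k b - k\<^sup>2 * (jacobi_sn k b)\<^sup>2 * (2 * zeta_p k b / D b)"
    using jacobi_zeta_add[OF k, of b b] by (simp flip: dup add: power2_eq_square mult_ac)
  define c p' p Db s where "c = jacobi_cn k (2 * b) * jacobi_dn k (2 * b)" and "p' = zeta_p' k b"
    and "p = zeta_p k b" and "Db = D b" and "s = (jacobi_sn k b)\<^sup>2"
  have "c = (p' * Db + p * (k\<^sup>2 * (4 * s * p))) / (Db * Db)"
  proof -
    have "2 * c = (2 * p' * Db - 2 * p * (- k\<^sup>2 * (2 * s * (2 * p)))) / (Db * Db)"
      using CD unfolding c_def p'_def p_def Db_def s_def by simp
    also have "2 * p' * Db - 2 * p * (- k\<^sup>2 * (2 * s * (2 * p))) = 2 * (p' * Db + p * (k\<^sup>2 * (4 * s * p)))"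
      by algebra
    finally show ?thesis by (simp only: times_divide_eq_right[symmetric] mult_cancel_left) simp
  qed
  then have "c / (2 * p / Db) = p' / (2 * p) + k\<^sup>2 * s * (2 * p / Db)"
    using p Dpos[of b] by (simp add: p_def Db_def field_simps)
  then show ?thesis unfolding Z dup c_def p'_def p_def Db_def s_def by simp
qed

section \<open>Fourier coefficients and contour shifts\<close>

text \<open>Concentration is measured by one weight: where \<open>w\<close> vanishes
  \<open>f\<close> has the value \<open>c\<close>, and the mass seen through \<open>w\<close> tends
  to 0. This suits periodic kernels, whose mass may gather at both endpoints or at any translate of
  a point, and only an integral of \<open>P i x * w x\<close> has to be estimated.\<close>

lemma approximate_identity:
  fixes P :: "'i \<Rightarrow> real \<Rightarrow> real" and f :: "real \<Rightarrow> complex"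
  assumes w: "continuous_on {a..b} w" "\<And>x. x \<in> {a..b} \<Longrightarrow> 0 \<le> w x"
    and f: "continuous_on {a..b} f" "\<And>x. x \<in> {a..b} \<Longrightarrow> w x = 0 \<Longrightarrow> f x = c"
    and P: "\<forall>\<^sub>F i in F. continuous_on {a..b} (P i) \<and> (\<forall>x\<in>{a..b}. 0 \<le> P i x)"
    and mass: "((\<lambda>i. integral {a..b} (P i)) \<longlongrightarrow> l) F"
    and conc: "((\<lambda>i. integral {a..b} (\<lambda>x. P i x * w x)) \<longlongrightarrow> 0) F"
  shows "((\<lambda>i. integral {a..b} (\<lambda>x. P i x * f x)) \<longlongrightarrow> l * c) F"
proof -
  have key: "\<exists>C\<ge>0. \<forall>x\<in>{a..b}. cmod (f x - c) \<le> \<eta> + C * w x" if "\<eta> > 0" for \<eta>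
  proof -
    \<comment> \<open>On the compact set \<open>B\<close> the weight has a positive minimum, since a
      zero of \<open>w\<close> would force \<open>f x = c\<close>. The maximum of |f - c| divided by
      this minimum serves as \<open>C\<close>.\<close>
    define B where "B = {x \<in> {a..b}. cmod (f x - c) \<ge> \<eta>}"
    have "continuous_on {a..b} (\<lambda>x. cmod (f x - c))" by (intro continuous_intros f(1))
    from continuous_closed_preimage[OF this closed_atLeastAtMost, of "{\<eta>..}"]
    have "closed B" by (simp add: B_def vimage_def Collect_conj_eq[symmetric] Int_def)
    then have cB: "compact B" unfolding B_def
      by (metis (no_types, lifting) bounded_closed_interval bounded_subset compact_eq_bounded_closed mem_Collect_eq subsetI)
    show ?thesis
    proof (cases "B = {}")
      case True
      then show ?thesis by (intro exI[of _ 0]) (force simp: B_def)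
    next
      case False
      have sub: "B \<subseteq> {a..b}" by (auto simp: B_def)
      obtain x0 where x0: "x0 \<in> B" "\<And>x. x \<in> B \<Longrightarrow> w x0 \<le> w x"
        using continuous_attains_inf[OF cB False continuous_on_subset[OF w(1) sub]] by blast
      have "continuous_on B (\<lambda>x. cmod (f x - c))"
        by (intro continuous_intros continuous_on_subset[OF f(1) sub])
      then obtain x1 where x1: "x1 \<in> B" "\<And>x. x \<in> B \<Longrightarrow> cmod (f x - c) \<le> cmod (f x1 - c)"
        using continuous_attains_sup[OF cB False] by blast
      have "w x0 \<noteq> 0" using x0(1) f(2)[of x0] \<open>\<eta> > 0\<close> by (auto simp: B_def)
      then have pos: "w x0 > 0" using w(2)[of x0] x0(1) by (auto simp: B_def)
      show ?thesis
      proof (intro exI[of _ "cmod (f x1 - c) / w x0"] conjI ballI)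
        show "0 \<le> cmod (f x1 - c) / w x0" using pos by simp
        fix x assume x: "x \<in> {a..b}"
        show "cmod (f x - c) \<le> \<eta> + cmod (f x1 - c) / w x0 * w x"
        proof (cases "x \<in> B")
          case True
          have "cmod (f x - c) \<le> cmod (f x1 - c) * 1" using x1(2)[OF True] by simp
          also have "\<dots> \<le> cmod (f x1 - c) * (w x / w x0)"
            using x0(2)[OF True] pos by (intro mult_left_mono) auto
          finally show ?thesis using \<open>\<eta> > 0\<close> by simp
        next
          case False
          then have "cmod (f x - c) \<le> \<eta>" using x by (auto simp: B_def)
          moreover have "0 \<le> cmod (f x1 - c) / w x0 * w x" using pos w(2)[OF x] by simp
          ultimately show ?thesis by linarith
        qed
      qed
    qed
  qed
  have diff: "((\<lambda>i. integral {a..b} (\<lambda>x. P i x * f x) - integral {a..b} (P i) * c) \<longlongrightarrow> 0) F"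
  proof (rule tendstoI)
    fix e :: real assume e: "e > 0"
    \<comment> \<open>The \<open>+ 1\<close> keeps the denominator positive even if the mass
      \<open>l\<close> is 0; the limit of the bound is then at most e/2.\<close>
    define \<eta> where "\<eta> = e / (2 * (\<bar>l\<bar> + 1))"
    have "e / (2 * A) * A = e / 2" if "A > 0" for A using that by simp
    from this[of "\<bar>l\<bar> + 1"] have \<eta>: "\<eta> > 0" "\<eta> * (\<bar>l\<bar> + 1) = e / 2"
      using e by (simp_all add: \<eta>_def)
    obtain C where C: "C \<ge> 0" "\<And>x. x \<in> {a..b} \<Longrightarrow> cmod (f x - c) \<le> \<eta> + C * w x" using key[OF \<eta>(1)] by blast
    have "((\<lambda>i. \<eta> * integral {a..b} (P i) + C * integral {a..b} (\<lambda>x. P i x * w x)) \<longlongrightarrow> \<eta> * l + C * 0) F"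
      by (intro tendsto_intros mass conc)
    moreover have "\<eta> * l + C * 0 < e"
    proof -
      have "\<eta> * l \<le> \<eta> * (\<bar>l\<bar> + 1)" using \<eta> by (intro mult_left_mono) auto
      then show ?thesis using \<eta> e by simp
    qed
    ultimately have "\<forall>\<^sub>F i in F. \<eta> * integral {a..b} (P i) + C * integral {a..b} (\<lambda>x. P i x * w x) < e"
      by (rule order_tendstoD)
    with P show "\<forall>\<^sub>F i in F. dist (integral {a..b} (\<lambda>x. P i x * f x) - integral {a..b} (P i) * c) 0 < e"
    proof eventually_elim
      case (elim i)
      then have cP: "continuous_on {a..b} (P i)" and P0: "\<And>x. x \<in> {a..b} \<Longrightarrow> 0 \<le> P i x" by auto
      have i1: "(\<lambda>x. P i x * f x) integrable_on {a..b}" "(\<lambda>x. complex_of_real (P i x) * c) integrable_on {a..b}"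
        "(\<lambda>x. P i x * (f x - c)) integrable_on {a..b}"
        "(\<lambda>x. P i x * \<eta>) integrable_on {a..b}" "(\<lambda>x. P i x * w x * C) integrable_on {a..b}"
        "P i integrable_on {a..b}" 
        by (intro integrable_continuous_real continuous_intros cP f(1) w(1))+
      have "complex_of_real (integral {a..b} (P i)) * c = integral {a..b} (\<lambda>x. complex_of_real (P i x) * c)"
        using integral_linear[OF i1(6) bounded_linear_of_real[where 'a=complex]] by (simp add: o_def)
      then have "integral {a..b} (\<lambda>x. P i x * f x) - integral {a..b} (P i) * c = integral {a..b} (\<lambda>x. P i x * (f x - c))"
        using integral_diff[OF i1(1,2)] by (simp add: right_diff_distrib)
      also have "norm \<dots> \<le> integral {a..b} (\<lambda>x. P i x * \<eta> + P i x * w x * C)"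
      proof (rule integral_norm_bound_integral[OF i1(3) integrable_add[OF i1(4,5)]])
        fix x assume x: "x \<in> {a..b}"
        have "cmod (P i x * (f x - c)) = P i x * cmod (f x - c)" using P0[OF x] by (simp add: norm_mult)
        also have "\<dots> \<le> P i x * (\<eta> + C * w x)" by (intro mult_left_mono C(2) P0 x)
        finally show "cmod (P i x * (f x - c)) \<le> P i x * \<eta> + P i x * w x * C" by (simp add: algebra_simps)
      qed
      also have "\<dots> = \<eta> * integral {a..b} (P i) + C * integral {a..b} (\<lambda>x. P i x * w x)"
        using integral_add[OF i1(4,5)] by (simp add: mult.commute)
      finally show ?case using elim by simp
    qed
  qed
  have "((\<lambda>i. complex_of_real (integral {a..b} (P i)) * c) \<longlongrightarrow> of_real l * c) F"
    by (intro tendsto_intros mass)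
  from tendsto_add[OF diff this] show ?thesis by simp
qed

section \<open>Fourier exponentials and uniqueness of coefficients\<close>

abbreviation fourier_exp :: "real \<Rightarrow> int \<Rightarrow> real \<Rightarrow> complex" where
  "fourier_exp p m x \<equiv> exp (2 * pi * \<i> * m * x / p)"

lemma set_lebesgue_integral_eq_integral:
  fixes g :: "real \<Rightarrow> complex"
  assumes "continuous_on {0..p} g"
  shows "(LBINT x:{0..p}. g x) = integral {0..p} g"
  by (rule set_borel_integral_eq_integral(2)[OF borel_integrable_atLeastAtMost'[OF assms]])

lemma fourier_coeff_eq:
  assumes "continuous_on {0..p} g"
  shows "fourier_coeff p g m = 1 / p * integral {0..p} (\<lambda>x. g x * fourier_exp p (- m) x)"
proof -
  have "continuous_on {0..p} (\<lambda>x. g x * exp (- (2 * pi * \<i> * m * x / p)))"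
    by (cases "p = 0") (auto intro!: continuous_intros assms)
  then show ?thesis unfolding fourier_coeff_def by (subst set_lebesgue_integral_eq_integral) simp_all
qed

lemma fourier_exp_add: "fourier_exp p (m + n) x = fourier_exp p m x * fourier_exp p n x"
  by (simp add: algebra_simps add_divide_distrib flip: exp_add)

lemma fourier_exp_shift: "p \<noteq> 0 \<Longrightarrow> fourier_exp p m (x + p) = fourier_exp p m x"
  using exp_integer_2pi[of "of_int m"] by (simp add: algebra_simps add_divide_distrib exp_add)

lemma norm_fourier_exp [simp]: "norm (fourier_exp p m x) = 1"
  using norm_exp_i_times[of "2 * pi * m * x / p"] by (simp add: mult_ac)

lemma integral_fourier_exp:
  assumes "p > 0"
  shows "integral {0..p} (fourier_exp p m) = (if m = 0 then p else 0)"
proof (cases "m = 0")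
  case False
  define a where "a = 2 * pi * \<i> * m / p"
  have a: "a \<noteq> 0" using False assms by (simp add: a_def)
  have "((\<lambda>x. exp (a * complex_of_real x)) has_integral (exp (a * of_real p) / a - exp (a * of_real 0) / a)) {0..p}"
  proof (rule fundamental_theorem_of_calculus)
    fix x
    have "((\<lambda>x. exp (a * x) / a) has_field_derivative exp (a * of_real x)) (at (of_real x))"
      using a by (auto intro!: derivative_eq_intros)
    then show "((\<lambda>x. exp (a * of_real x) / a) has_vector_derivative exp (a * of_real x)) (at x within {0..p})"
      by (rule has_vector_derivative_real_field)
  qed (use assms in auto)
  moreover have "exp (a * of_real p) = 1"
    using fourier_exp_shift[of p m 0] assms by (simp add: a_def)
  moreover have "(\<lambda>x. exp (a * complex_of_real x)) = fourier_exp p m"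
    by (simp add: a_def fun_eq_iff)
  ultimately show ?thesis using False by (simp add: integral_unique)
qed (use assms in \<open>simp add: scaleR_conv_of_real\<close>)

text \<open>Integrating \<open>f\<close> against the Fejer kernel gives a finite combination of its
  Fourier coefficients, hence 0, while these integrals tend to p times \<open>f x0\<close>.\<close>

lemma fourier_coeff_unique_zero:
  assumes p: "p > 0" and cont: "continuous_on UNIV f" and per: "\<And>x. f (x + p) = f x"
    and zero: "\<And>m. fourier_coeff p f m = 0"
  shows "f x0 = 0"
proof -
  \<comment> \<open>\<open>P N\<close> is the Fejer kernel centred at \<open>x0\<close>.\<close>
  define e where "e = (\<lambda>x. fourier_exp p 1 (x - x0))"
  define S where "S = (\<lambda>N x. \<Sum>j<N. e x ^ j)"
  define P where "P = (\<lambda>N x. (cmod (S N x))\<^sup>2 / real N)"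
  \<comment> \<open>The geometric sum satisfies (e - 1) \<open>S N\<close> = e^N - 1, so with this
    weight \<open>P N x * w x\<close> is at most 4/N everywhere.\<close>
  define w where "w = (\<lambda>x. (cmod (e x - 1))\<^sup>2)"
  have ce: "continuous_on X e" for X unfolding e_def by (intro continuous_intros) (use p in auto)
  have e_pow: "e x ^ j = fourier_exp p (int j) (x - x0)" for j x
    unfolding e_def by (subst exp_of_nat_mult[symmetric]) (simp add: mult_ac)
  have sq: "complex_of_real ((cmod (S N x))\<^sup>2) = (\<Sum>j<N. \<Sum>l<N. fourier_exp p (int j - int l) x * fourier_exp p (int l - int j) x0)" for N x
  proof -
    have "complex_of_real ((cmod (S N x))\<^sup>2) = S N x * cnj (S N x)" by (simp only: complex_norm_square)
    also have "\<dots> = (\<Sum>j<N. \<Sum>l<N. e x ^ j * cnj (e x ^ l))"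
      by (simp add: S_def sum_product)
    also have "\<dots> = (\<Sum>j<N. \<Sum>l<N. fourier_exp p (int j - int l) x * fourier_exp p (int l - int j) x0)"
    proof (intro sum.cong refl)
      fix j l
      show "e x ^ j * cnj (e x ^ l) = fourier_exp p (int j - int l) x * fourier_exp p (int l - int j) x0"
        unfolding e_pow exp_cnj exp_add[symmetric] 
        by (rule arg_cong[where f=exp]) (use p in \<open>simp add: field_simps\<close>)
    qed
    finally show ?thesis .
  qed
  have int: "integral {0..p} (\<lambda>x. (cmod (S N x))\<^sup>2 * g x) =
      p * (\<Sum>j<N. \<Sum>l<N. fourier_coeff p g (int l - int j) * fourier_exp p (int l - int j) x0)"
    if g: "continuous_on {0..p} g" for g :: "real \<Rightarrow> complex" and N
  proof -
    have "integral {0..p} (\<lambda>x. (cmod (S N x))\<^sup>2 * g x) =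
      integral {0..p} (\<lambda>x. \<Sum>j<N. \<Sum>l<N. (g x * fourier_exp p (- (int l - int j)) x) * fourier_exp p (int l - int j) x0)"
      unfolding sq by (intro integral_cong) (simp add: sum_distrib_left mult_ac)
    also have "\<dots> = (\<Sum>j<N. \<Sum>l<N. integral {0..p} (\<lambda>x. (g x * fourier_exp p (- (int l - int j)) x) * fourier_exp p (int l - int j) x0))"
      by (subst integral_sum, simp, (intro integrable_continuous_real continuous_intros g; use p in simp),
          rule sum.cong[OF refl], subst integral_sum, simp, (intro integrable_continuous_real continuous_intros g; use p in simp), simp)
    also have "\<dots> = (\<Sum>j<N. \<Sum>l<N. p * (fourier_coeff p g (int l - int j) * fourier_exp p (int l - int j) x0))"
      unfolding fourier_coeff_eq[OF g] using p by (intro sum.cong refl) simp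
    finally show ?thesis by (simp add: sum_distrib_left)
  qed
  have "((\<lambda>N. integral {0..p} (\<lambda>x. P N x * f x)) \<longlongrightarrow> complex_of_real p * f x0) sequentially"
  proof (rule approximate_identity[where w = w])
    show "continuous_on {0..p} w" unfolding w_def by (intro continuous_intros ce)
    show "0 \<le> w x" for x by (simp add: w_def)
    show "continuous_on {0..p} f" using cont continuous_on_subset by blast
    \<comment> \<open>\<open>x0\<close> need not lie in [0, p]: the zeros of \<open>w\<close> are
      the translates of \<open>x0\<close> by whole periods, and periodicity carries the value
      over.\<close>
    show "f x = f x0" if "w x = 0" for x
    proof -
      have "e x = 1" using that by (simp add: w_def)
      then have "exp (of_real (2 * pi * (x - x0) / p) * \<i>) = 1" by (simp add: e_def mult_ac)
      then obtain n :: int where n: "2 * pi * (x - x0) / p = of_int (2 * n) * pi" 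
        using p by (auto simp: exp_eq_1)
      then have "2 * pi * ((x - x0) / p) = 2 * pi * of_int n" by simp
      then have "(x - x0) / p = of_int n" by (simp only: mult_cancel_left) simp
      then have x: "x = x0 + of_int n * p" using p by (simp add: field_simps)
      have per': "f (y + of_nat n * p) = f y" for y n
        by (induction n) (use per in \<open>auto simp: algebra_simps\<close>, metis add.commute add.assoc)
      show ?thesis
      proof (cases "n \<ge> 0")
        case True then show ?thesis using per'[of x0 "nat n"] x by simp
      next
        case False then show ?thesis using per'[of x "nat (-n)"] x by simp
      qed
    qed
    show "\<forall>\<^sub>F N in sequentially. continuous_on {0..p} (P N) \<and> (\<forall>x\<in>{0..p}. 0 \<le> P N x)"
      unfolding P_def S_def divide_inverse by (intro always_eventually allI conjI continuous_intros ce) auto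
    have one: "fourier_coeff p (\<lambda>_. 1) m = (if m = 0 then 1 else 0)" for m
      using integral_fourier_exp[OF p, of "- m"] p by (subst fourier_coeff_eq) auto
    have "integral {0..p} (P N) = p" if "N > 0" for N
    proof -
      have "continuous_on {0..p} (P N)"
        unfolding P_def S_def using that by (intro continuous_intros ce) auto
      from integral_linear[OF integrable_continuous_real[OF this] bounded_linear_of_real[where 'a=complex]]
      have "complex_of_real (integral {0..p} (P N)) = integral {0..p} (\<lambda>x. complex_of_real (P N x))"
        unfolding o_def by (rule sym)
      also have "\<dots> = integral {0..p} (\<lambda>x. (cmod (S N x))\<^sup>2 * (1::complex)) / N" by (simp add: P_def)
      also have "\<dots> = p * (\<Sum>j<N. \<Sum>l<N. (if l = j then 1 else 0) * fourier_exp p (int l - int j) x0) / N"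
        by (subst int) (simp_all add: one)
      also have "(\<Sum>j<N. \<Sum>l<N. (if l = j then 1 else 0) * fourier_exp p (int l - int j) x0) = (\<Sum>j<N. \<Sum>l<N. if l = j then 1 else 0)"
        by (intro sum.cong refl) simp
      also have "p * \<dots> / N = p" using that by simp
      finally show ?thesis using of_real_eq_iff by blast
    qed
    then have "\<forall>\<^sub>F N in sequentially. integral {0..p} (P N) = p"
      using eventually_gt_at_top[of 0] by (rule eventually_mono[rotated]) 
    then show "((\<lambda>N. integral {0..p} (P N)) \<longlongrightarrow> p) sequentially" by (rule tendsto_eventually)
    show "((\<lambda>N. integral {0..p} (\<lambda>x. P N x * w x)) \<longlongrightarrow> 0) sequentially"
    proof (rule Lim_null_comparison)
      show "\<forall>\<^sub>F N in sequentially. norm (integral {0..p} (\<lambda>x. P N x * w x)) \<le> 4 / real N * p"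
      proof (intro always_eventually allI)
        fix N
        have b: "P N x * w x \<le> 4 / real N" for x
        proof -
          have "(e x - 1) * S N x = e x ^ N - 1" unfolding S_def by (rule power_diff_1_eq[symmetric]) 
          then have "cmod (S N x) * cmod (e x - 1) = cmod (e x ^ N - 1)" by (metis norm_mult mult.commute)
          also have "\<dots> \<le> 1 + 1" by (rule order_trans[OF norm_triangle_ineq4]) (simp add: e_pow del: of_real_diff)
          finally have "(cmod (S N x) * cmod (e x - 1))\<^sup>2 \<le> 2\<^sup>2" by (intro power_mono) auto
          then show ?thesis by (simp add: P_def w_def power_mult_distrib divide_right_mono)
        qed
        have "continuous_on {0..p} (\<lambda>x. P N x * w x)"
          unfolding P_def S_def w_def divide_inverse by (intro continuous_intros ce)
        then have "norm (integral {0..p} (\<lambda>x. P N x * w x)) \<le> integral {0..p} (\<lambda>x. 4 / real N)"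
          using b by (intro integral_norm_bound_integral integrable_continuous_real) (auto simp: P_def w_def)
        then show "norm (integral {0..p} (\<lambda>x. P N x * w x)) \<le> 4 / real N * p" using p by (simp add: mult.commute)
      qed
      show "((\<lambda>N. 4 / real N * p) \<longlongrightarrow> 0) sequentially" by real_asymp
    qed
  qed
  moreover have "integral {0..p} (\<lambda>x. P N x * f x) = 0" for N
  proof -
    have "integral {0..p} (\<lambda>x. P N x * f x) = integral {0..p} (\<lambda>x. (cmod (S N x))\<^sup>2 * f x) / N"
      by (simp add: P_def)
    then show ?thesis using int[of f N] continuous_on_subset[OF cont] by (simp add: zero)
  qed
  ultimately have "complex_of_real p * f x0 = 0" by (simp only: LIMSEQ_const_iff)
  then show ?thesis using p by simp
qed

lemma fourier_coeff_lincomb: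
  assumes "continuous_on {0..p} f" "continuous_on {0..p} g"
  shows "fourier_coeff p (\<lambda>x. a * f x + b * g x) m = a * fourier_coeff p f m + b * fourier_coeff p g m"
proof -
  have c: "continuous_on {0..p} (fourier_exp p (-m))"
    by (cases "p = 0") (auto intro!: continuous_intros)
  have i: "(\<lambda>x. a * (f x * fourier_exp p (-m) x)) integrable_on {0..p}" "(\<lambda>x. b * (g x * fourier_exp p (-m) x)) integrable_on {0..p}"
    by (intro integrable_continuous_real continuous_intros assms c)+
  show ?thesis
    using integral_add[OF i] by (simp add: fourier_coeff_eq assms continuous_intros algebra_simps)
qed

lemma fourier_coeff_const:
  assumes "p > 0"
  shows "fourier_coeff p (\<lambda>_. c) m = (if m = 0 then c else 0)"
  using integral_fourier_exp[OF assms, of "- m"] assms by (subst fourier_coeff_eq) auto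

lemma fourier_coeff_0:
  assumes "continuous_on {0..p} g"
  shows "fourier_coeff p g 0 = 1 / p * (LBINT x:{0..p}. g x)"
  using assms by (simp add: fourier_coeff_def)

lemma fourier_coeff_scale:
  assumes L: "L > 0" and p: "p > 0" and cont: "continuous_on {0..p} g"
  shows "fourier_coeff L (\<lambda>x. g (p / L * x)) m = fourier_coeff p g m"
proof -
  have "continuous_on {0..L} (\<lambda>x. g (p / L * x))"
    by (rule continuous_on_compose2[OF cont]) (use L p in \<open>auto intro!: continuous_intros simp: field_simps\<close>)
  moreover have "((\<lambda>x. g x * fourier_exp p (- m) x) has_integral integral {0..p} (\<lambda>x. g x * fourier_exp p (- m) x)) (cbox 0 p)"
    using p by (simp add: cbox_interval) (intro integrable_integral integrable_continuous_real continuous_intros cont, auto)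
  from has_integral_affinity[OF this, of "p / L" 0]
  have "((\<lambda>x. g (p / L * x) * fourier_exp L (- m) x) has_integral
      (L / p) *\<^sub>R integral {0..p} (\<lambda>x. g x * fourier_exp p (- m) x)) ((\<lambda>x. L / p * x) ` {0..p})"
    using L p by (simp add: cbox_interval mult_ac)
  moreover have "(\<lambda>x. L / p * x) ` {0..p} = {0..L}"
    using L p image_mult_atLeastAtMost[of "L / p" 0 p] by simp
  ultimately show ?thesis
    using L p by (simp add: fourier_coeff_eq cont integral_unique scaleR_conv_of_real)
qed

text \<open>The derivative of the line integral in the height t is the integral of i F' over one
  period, which telescopes to i (F(p + it) - F(it)) = 0.\<close>

lemma periodic_line_integral:
  assumes p: "p > 0" and h: "\<bar>y\<bar> < h"
    and F: "\<And>z. \<bar>Im z\<bar> < h \<Longrightarrow> (F has_field_derivative F' z) (at z)"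
    and per: "\<And>z. \<bar>Im z\<bar> < h \<Longrightarrow> F (z + of_real p) = F z"
  shows "integral {0..p} (\<lambda>x. F (Complex x y)) = integral {0..p} (\<lambda>x. F (Complex x 0))"
proof -
  define S where "S = {z. \<bar>Im z\<bar> < h}"
  define U where "U = {-\<bar>y\<bar>..\<bar>y\<bar>}"
  have "open S" unfolding S_def by (intro open_Collect_less continuous_intros)
  have hol: "F holomorphic_on S" unfolding holomorphic_on_def field_differentiable_def S_def
    using F has_field_derivative_at_within by blast
  \<comment> \<open>\<open>F'\<close> is given only as a pointwise derivative; differentiation under
    the integral uses its continuity, which holomorphy supplies.\<close>
  have "continuous_on S (deriv F)"
    by (intro holomorphic_on_imp_continuous_on holomorphic_deriv hol \<open>open S\<close>)
  then have cF': "continuous_on S F'"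
    by (subst (asm) continuous_on_cong[OF refl, where g = F']) (auto simp: S_def intro: DERIV_imp_deriv F)
  have cF: "continuous_on S F" by (rule holomorphic_on_imp_continuous_on[OF hol])
  have US: "Complex x t \<in> S" if "t \<in> U" for x t using that h by (auto simp: S_def U_def)
  have D: "((\<lambda>t. integral (cbox 0 p) (\<lambda>x. F (Complex x t))) has_vector_derivative
      integral (cbox 0 p) (\<lambda>x. \<i> * F' (Complex x t))) (at t within U)" if t: "t \<in> U" for t
  proof (rule leibniz_rule_vector_derivative[OF _ _ _ t])
    fix s x assume s: "s \<in> U" 
    have "((\<lambda>s. of_real x + \<i> * of_real s) has_vector_derivative \<i>) (at s)"
      by (auto intro!: derivative_eq_intros)
    moreover have "(F has_field_derivative F' (Complex x s)) (at (of_real x + \<i> * of_real s))"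
      using F[of "Complex x s"] US[OF s] by (simp add: Complex_eq S_def)
    ultimately have "((F \<circ> (\<lambda>s. of_real x + \<i> * of_real s)) has_vector_derivative \<i> * F' (Complex x s)) (at s)"
      by (rule field_vector_diff_chain_at)
    then show "((\<lambda>s. F (Complex x s)) has_vector_derivative \<i> * F' (Complex x s)) (at s within U)"
      by (simp add: o_def Complex_eq has_vector_derivative_at_within)
  next
    fix s assume "s \<in> U"
    show "(\<lambda>x. F (Complex x s)) integrable_on cbox 0 p"
      unfolding cbox_interval Complex_eq
      by (intro integrable_continuous_real continuous_on_compose2[OF cF] continuous_intros)
         (use US[OF \<open>s \<in> U\<close>] in \<open>auto simp: Complex_eq\<close>)
  next
    show "continuous_on (U \<times> cbox 0 p) (\<lambda>(s, x). \<i> * F' (Complex x s))"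
      unfolding Complex_eq split_beta
      by (intro continuous_intros continuous_on_compose2[OF cF']) (use US in \<open>auto simp: Complex_eq\<close>)
  qed (simp add: U_def)
  have Z: "integral (cbox 0 p) (\<lambda>x. \<i> * F' (Complex x t)) = 0" if t: "t \<in> U" for t
  proof -
    have "((\<lambda>x. F' (Complex x t)) has_integral F (Complex p t) - F (Complex 0 t)) {0..p}"
    proof (rule fundamental_theorem_of_calculus)
      fix x
      have "((\<lambda>x. of_real x + \<i> * of_real t) has_vector_derivative 1) (at x)"
        by (auto intro!: derivative_eq_intros)
      moreover have "(F has_field_derivative F' (Complex x t)) (at (of_real x + \<i> * of_real t))"
        using F[of "Complex x t"] US[OF t] by (simp add: Complex_eq S_def)
      ultimately have "((F \<circ> (\<lambda>x. of_real x + \<i> * of_real t)) has_vector_derivative 1 * F' (Complex x t)) (at x)"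
        by (rule field_vector_diff_chain_at)
      then show "((\<lambda>x. F (Complex x t)) has_vector_derivative F' (Complex x t)) (at x within {0..p})"
        by (simp add: o_def Complex_eq has_vector_derivative_at_within)
    qed (use p in simp)
    moreover have "F (Complex p t) = F (Complex 0 t)"
      using per[of "Complex 0 t"] US[OF t] by (simp add: S_def complex_of_real_def plus_complex.code)
    ultimately have "((\<lambda>x. \<i> * F' (Complex x t)) has_integral \<i> * 0) {0..p}"
      by (intro has_integral_mult_right) simp
    then show ?thesis unfolding cbox_interval by (simp only: integral_unique mult_zero_right)
  qed
  have D0: "((\<lambda>t. integral (cbox 0 p) (\<lambda>x. F (Complex x t))) has_vector_derivative 0) (at t within U)" if "t \<in> U" for t
    using D[OF that] unfolding Z[OF that] .
  have "convex U" by (simp add: U_def)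
  then obtain c where "\<And>t. t \<in> U \<Longrightarrow> integral (cbox 0 p) (\<lambda>x. F (Complex x t)) = c"
    using has_vector_derivative_zero_constant[OF _ D0] by meson
  moreover have "y \<in> U" "0 \<in> U" by (auto simp: U_def abs_if)
  ultimately show ?thesis by (simp add: cbox_interval)
qed

text \<open>The line integral of F(z) exp(-2 pi i m z / p), again a periodic function, does not
  depend on the height, while at height y the exponential picks up the factor exp(2 pi m y /
  p).\<close>

lemma fourier_coeff_line_shift:
  assumes p: "p > 0" and h: "\<bar>y\<bar> < h"
    and F: "\<And>z. \<bar>Im z\<bar> < h \<Longrightarrow> (F has_field_derivative F' z) (at z)"
    and per: "\<And>z. \<bar>Im z\<bar> < h \<Longrightarrow> F (z + of_real p) = F z"
  shows "fourier_coeff p (\<lambda>x. F (Complex x y)) m = exp (- (2 * pi * m * y / p)) * fourier_coeff p (\<lambda>x. F (Complex x 0)) m"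
proof -
  define G where "G = (\<lambda>z. F z * exp (- (2 * pi * \<i> * m * z / p)))"
  have "integral {0..p} (\<lambda>x. G (Complex x y)) = integral {0..p} (\<lambda>x. G (Complex x 0))"
  proof (rule periodic_line_integral[OF p h])
    fix z assume z: "\<bar>Im z\<bar> < h"
    show "(G has_field_derivative (F' z * exp (- (2 * pi * \<i> * m * z / p)) -
       F z * (2 * pi * \<i> * m / p * exp (- (2 * pi * \<i> * m * z / p))))) (at z)"
      unfolding G_def using p by (auto intro!: derivative_eq_intros F[OF z])
    have "exp (- (2 * pi * \<i> * m * (z + of_real p) / p)) = exp (- (2 * pi * \<i> * m * z / p)) * exp (2 * of_int (- m) * pi * \<i>)"
      unfolding exp_add[symmetric] by (rule arg_cong[where f = exp]) (use p in \<open>simp add: field_simps\<close>)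
    also have "exp (2 * of_int (- m) * pi * \<i>) = 1"
      by (rule exp_integer_2pi) auto
    finally show "G (z + of_real p) = G z" using per[OF z] by (simp add: G_def)
  qed
  moreover have "G (Complex x t) = exp (2 * pi * m * t / p) * (F (Complex x t) * fourier_exp p (- m) x)" for x t
  proof -
    have "exp (- (2 * pi * \<i> * m * Complex x t / p)) = exp (of_real (2 * pi * m * t / p)) * fourier_exp p (- m) x"
      unfolding exp_add[symmetric] by (rule arg_cong[where f = exp]) (use p in \<open>simp add: Complex_eq field_simps\<close>)
    then show ?thesis by (simp only: G_def exp_of_real mult_ac)
  qed
  ultimately have eq: "exp (2 * pi * m * y / p) * integral {0..p} (\<lambda>x. F (Complex x y) * fourier_exp p (- m) x) =
      integral {0..p} (\<lambda>x. F (Complex x 0) * fourier_exp p (- m) x)" by simp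
  moreover have "continuous_on {0..p} (\<lambda>x. F (Complex x t))" if "\<bar>t\<bar> < h" for t
  proof -
    have "continuous_on {z. \<bar>Im z\<bar> < h} F"
      by (rule continuous_at_imp_continuous_on) (auto intro: DERIV_isCont F)
    then show ?thesis unfolding Complex_eq
      by (rule continuous_on_compose2) (use that in \<open>auto intro!: continuous_intros\<close>)
  qed
  moreover have "integral {0..p} (\<lambda>x. F (Complex x y) * fourier_exp p (- m) x) =
      exp (- (2 * pi * m * y / p)) * integral {0..p} (\<lambda>x. F (Complex x 0) * fourier_exp p (- m) x)"
    unfolding eq[symmetric] mult.assoc[symmetric] of_real_mult[symmetric] exp_add[symmetric] by simp
  ultimately show ?thesis using h by (simp only: fourier_coeff_eq abs_zero mult_ac)
qed

lemma fourier_coeff_vector_derivative: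
  assumes p: "p > 0" and f: "\<And>x. (f has_vector_derivative f' x) (at x)"
    and c: "continuous_on {0..p} f'" and per: "f p = f 0"
  shows "fourier_coeff p f' m = 2 * pi * \<i> * m / p * fourier_coeff p f m"
proof -
  let ?a = "2 * pi * \<i> * m / p"
  have "((\<lambda>x. f' x * fourier_exp p (- m) x - ?a * (f x * fourier_exp p (- m) x)) has_integral
      (f p * fourier_exp p (- m) p - f 0 * fourier_exp p (- m) 0)) {0..p}"
  proof (rule fundamental_theorem_of_calculus)
    fix x
    have "((\<lambda>z. exp (- ?a * z)) has_field_derivative - ?a * exp (- ?a * of_real x)) (at (of_real x))"
      using p by (auto intro!: derivative_eq_intros)
    then have "((\<lambda>x. exp (- ?a * of_real x)) has_vector_derivative - ?a * exp (- ?a * of_real x)) (at x)"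
      by (rule has_vector_derivative_real_field)
    moreover have "(\<lambda>x. exp (- ?a * of_real x)) = fourier_exp p (- m)" by (simp add: fun_eq_iff)
    ultimately have "(fourier_exp p (- m) has_vector_derivative - ?a * fourier_exp p (- m) x) (at x)" by metis
    note M = has_vector_derivative_mult[OF f this]
    show "((\<lambda>x. f x * fourier_exp p (- m) x) has_vector_derivative
      f' x * fourier_exp p (- m) x - ?a * (f x * fourier_exp p (- m) x)) (at x within {0..p})"
      by (rule has_vector_derivative_at_within, rule has_vector_derivative_eq_rhs[OF M])
         (simp only: right_diff_distrib left_diff_distrib minus_mult_left[symmetric] minus_mult_right[symmetric] mult_ac diff_conv_add_uminus add.commute)
  qed (use p in simp)
  moreover have "fourier_exp p (- m) p = fourier_exp p (- m) 0"
    using fourier_exp_shift[of p "- m" 0] p by simp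
  ultimately have *: "((\<lambda>x. f' x * fourier_exp p (- m) x - ?a * (f x * fourier_exp p (- m) x)) has_integral 0) {0..p}"
    using per by simp
  have cf: "continuous_on {0..p} f"
    using f has_vector_derivative_continuous by (blast intro: continuous_at_imp_continuous_on)
  have i: "(\<lambda>x. f' x * fourier_exp p (- m) x) integrable_on {0..p}" "(\<lambda>x. ?a * (f x * fourier_exp p (- m) x)) integrable_on {0..p}"
    by (intro integrable_continuous_real continuous_intros c cf; use p in simp)+
  have "integral {0..p} (\<lambda>x. f' x * fourier_exp p (- m) x) = ?a * integral {0..p} (\<lambda>x. f x * fourier_exp p (- m) x)"
    using integral_diff[OF i] integral_unique[OF *] by simp
  then show ?thesis by (simp add: fourier_coeff_eq c cf)
qed

section \<open>Fourier coefficients of the zeta function\<close>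

text \<open>The factor of \<open>zeta_P\<close> with an elementary antiderivative in u. For |v| < K'
  it is positive and its mass over a period is exactly pi, so it acts as the concentrating
  kernel.\<close>

definition zeta_Q :: "real \<Rightarrow> real \<Rightarrow> real \<Rightarrow> real" where
  "zeta_Q k u v = jacobi_cn (comp_modulus k) v * jacobi_dn (comp_modulus k) v * jacobi_dn k u / zeta_den k u v"

lemma zeta_P_Q: "zeta_P k u v = jacobi_sn (comp_modulus k) v * jacobi_dn k u * zeta_Q k u v"
  by (simp add: zeta_P_def zeta_Q_def zeta_p_def power2_eq_square)

lemma cont_jacobi:
  assumes "0 < k" "k < 1"
  shows "continuous_on S (jacobi_sn k)" "continuous_on S (jacobi_cn k)"
  by (meson jacobi_sn_deriv[OF assms] jacobi_cn_deriv[OF assms] DERIV_isCont continuous_at_imp_continuous_on)+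

lemma jacobi_dn_le_1: 
  assumes "0 < k" "k < 1"
  shows "jacobi_dn k u \<le> 1"
  by (simp add: jacobi_dn_def)

lemma cont_zeta_Q:
  assumes "0 < k" "k < 1" "\<bar>v\<bar> < ellip_K (comp_modulus k)"
  shows "continuous_on S (\<lambda>u. zeta_Q k u v)"
proof -
  have "continuous_on S (\<lambda>u. zeta_den k u v)"
    unfolding zeta_den_def by (intro continuous_intros cont_jacobi_dn assms)
  moreover have "zeta_den k u v \<noteq> 0" for u using zeta_den_pos[OF assms, of u] by simp
  ultimately show ?thesis unfolding zeta_Q_def by (intro continuous_intros cont_jacobi_dn assms) auto
qed

text \<open>The antiderivative \<open>H\<close> is the continuous branch of \<open>arctan (d1/c1 * tan (am u))\<close>.\<close>

lemma integral_zeta_Q: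
  assumes k: "0 < k" "k < 1" and v: "\<bar>v\<bar> < ellip_K (comp_modulus k)"
  shows "integral {0..2 * ellip_K k} (\<lambda>u. zeta_Q k u v) = pi"
proof -
  note k' = comp_modulus_bounds[OF k]
  define g where "g = jacobi_dn (comp_modulus k) v / jacobi_cn (comp_modulus k) v"
  have c1: "jacobi_cn (comp_modulus k) v > 0" by (rule jacobi_cn_pos[OF k'(1,2) v])
  have d1: "jacobi_dn (comp_modulus k) v > 0" by (rule jacobi_dn_pos[OF k'(1,2)])
  have g: "g > 0" using c1 d1 by (simp add: g_def)
  define H where "H = (\<lambda>u. jacobi_am k u + arctan ((g - 1) * (jacobi_sn k u * jacobi_cn k u) / ((jacobi_cn k u)\<^sup>2 + g * (jacobi_sn k u)\<^sup>2)))"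
  have "(H has_real_derivative zeta_Q k u v) (at u)" for u
  proof -
    define s c d where "s = jacobi_sn k u" and "c = jacobi_cn k u" and "d = jacobi_dn k u"
    have sc: "s\<^sup>2 + c\<^sup>2 = 1" using jacobi_sn_cn[of k u] by (simp add: s_def c_def)
    \<comment> \<open>The denominator in the tangent subtraction formula for arctan (g tan x) - x.
      It stays positive where cn vanishes, so the branch has no jump there.\<close>
    define E where "E = c\<^sup>2 + g * s\<^sup>2"
    have Epos: "E > 0"
    proof (cases "s = 0")
      case True then show ?thesis using sc by (simp add: E_def)
    next
      case False then show ?thesis using g by (auto simp: E_def intro!: add_nonneg_pos)
    qed
    define G where "G = c\<^sup>2 + g\<^sup>2 * s\<^sup>2"
    have EG: "E\<^sup>2 + ((g - 1) * (s * c))\<^sup>2 = G" unfolding E_def G_def using sc by algebra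
    have Gpos: "G > 0" using Epos by (simp flip: EG add: add_pos_nonneg)
    have den: "zeta_den k u v = (jacobi_cn (comp_modulus k) v)\<^sup>2 * G"
    proof -
      have "(jacobi_cn (comp_modulus k) v)\<^sup>2 * g\<^sup>2 = (jacobi_dn (comp_modulus k) v)\<^sup>2"
        using c1 by (simp add: g_def power_divide)
      then have "(jacobi_cn (comp_modulus k) v)\<^sup>2 * G = (jacobi_cn (comp_modulus k) v)\<^sup>2 * c\<^sup>2 + (jacobi_dn (comp_modulus k) v)\<^sup>2 * s\<^sup>2"
        by (simp add: G_def distrib_left flip: mult.assoc)
      also have "\<dots> = zeta_den k u v"
        unfolding zeta_den_eq[OF k] jacobi_dn_sn[OF k'(1,2)] jacobi_sn_cn[of "comp_modulus k"] k'(3) s_def[symmetric]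
        using sc by algebra
      finally show ?thesis by simp
    qed
    have q: "zeta_Q k u v = g * d / G"
      using c1 Gpos by (simp add: zeta_Q_def den g_def d_def power2_eq_square)
    have num: "((\<lambda>u. (g - 1) * (jacobi_sn k u * jacobi_cn k u)) has_real_derivative (g - 1) * (c * d * c - s * (s * d))) (at u)"
      unfolding s_def c_def d_def
      by (rule derivative_eq_intros jacobi_sn_deriv[OF k] jacobi_cn_deriv[OF k] refl)+ (simp add: algebra_simps)
    have E': "((\<lambda>u. (jacobi_cn k u)\<^sup>2 + g * (jacobi_sn k u)\<^sup>2) has_real_derivative 2 * (g - 1) * s * c * d) (at u)"
      unfolding s_def c_def d_def
      by (rule derivative_eq_intros jacobi_sn_deriv[OF k] jacobi_cn_deriv[OF k] refl)+ (simp add: algebra_simps)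
    have "((\<lambda>u. (g - 1) * (jacobi_sn k u * jacobi_cn k u) / ((jacobi_cn k u)\<^sup>2 + g * (jacobi_sn k u)\<^sup>2)) has_real_derivative
        (((g - 1) * (c * d * c - s * (s * d))) * E - (g - 1) * (s * c) * (2 * (g - 1) * s * c * d)) / (E * E)) (at u)"
      using DERIV_divide[OF num E'] Epos by (simp add: E_def s_def c_def)
    from DERIV_chain2[OF DERIV_arctan this]
    have "(H has_real_derivative d + inverse (1 + ((g - 1) * (s * c) / E)\<^sup>2) *
        ((((g - 1) * (c * d * c - s * (s * d))) * E - (g - 1) * (s * c) * (2 * (g - 1) * s * c * d)) / (E * E))) (at u)"
      unfolding H_def by (intro DERIV_add) (simp_all add: jacobi_am_deriv[OF k] s_def c_def d_def E_def)
    also have "inverse (1 + ((g - 1) * (s * c) / E)\<^sup>2) = E\<^sup>2 / G"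
      using Epos Gpos by (simp add: EG[symmetric] field_simps)
    also have "E\<^sup>2 / G * ((((g - 1) * (c * d * c - s * (s * d))) * E - (g - 1) * (s * c) * (2 * (g - 1) * s * c * d)) / (E * E))
       = (((g - 1) * (c * d * c - s * (s * d))) * E - (g - 1) * (s * c) * (2 * (g - 1) * s * c * d)) / G"
      using Epos by (simp add: power2_eq_square)
    also have "d + \<dots> = zeta_Q k u v"
    proof -
      have "d * G + (((g - 1) * (c * d * c - s * (s * d))) * E - (g - 1) * (s * c) * (2 * (g - 1) * s * c * d)) = g * d"
        unfolding G_def E_def using sc by algebra
      then show ?thesis using Gpos by (simp add: q field_simps)
    qed
    finally show ?thesis .
  qed
  then have "((\<lambda>u. zeta_Q k u v) has_integral (H (2 * ellip_K k) - H 0)) {0..2 * ellip_K k}"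
    using ellip_K_pos[OF k] by (intro fundamental_theorem_of_calculus)
      (auto simp: has_real_derivative_iff_has_vector_derivative intro: has_vector_derivative_at_within)
  \<comment> \<open>The arctan terms vanish at both ends because sn does; only the amplitude
    contributes.\<close>
  moreover have "H (2 * ellip_K k) - H 0 = pi"
    using jacobi_am_shift[OF k, of 0] jacobi_shift[OF k, of 0] k by (simp add: H_def jacobi_values)
  ultimately show ?thesis by (simp add: integral_unique)
qed

text \<open>\<open>zeta_P\<close> is \<open>zeta_Q\<close> times dn u and sn v. The first factor
  joins the test function and equals 1 at both endpoints; the second tends to 1. The mass gathers at
  the two endpoints, which are one point modulo the period, and \<open>f\<close> takes the same
  value \<open>c\<close> there.\<close>

lemma zeta_P_limit:
  fixes f :: "real \<Rightarrow> complex" and c :: complex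
  assumes k: "0 < k" "k < 1" and f: "continuous_on {0..2 * ellip_K k} f" "f 0 = c" "f (2 * ellip_K k) = c"
  shows "((\<lambda>v. integral {0..2 * ellip_K k} (\<lambda>u. complex_of_real (zeta_P k u v) * f u)) \<longlongrightarrow> pi * c)
     (at_left (ellip_K (comp_modulus k)))"
proof -
  note k' = comp_modulus_bounds[OF k]
  define K' where "K' = ellip_K (comp_modulus k)"
  have K': "K' > 0" using ellip_K_pos[OF k'(1,2)] by (simp add: K'_def)
  have ev: "\<forall>\<^sub>F v in at_left K'. 0 < v \<and> v < K'" using K' eventually_at_left_real by fastforce
  have s1: "((\<lambda>v. jacobi_sn (comp_modulus k) v) \<longlongrightarrow> 1) (at_left K')"
    using DERIV_isCont[OF jacobi_sn_deriv[OF k'(1,2), of K']] jacobi_values(4)[OF k'(1,2)]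
    by (simp add: isCont_def filterlim_at_split K'_def)
  have c1: "((\<lambda>v. jacobi_cn (comp_modulus k) v) \<longlongrightarrow> 0) (at_left K')"
    using DERIV_isCont[OF jacobi_cn_deriv[OF k'(1,2), of K']] jacobi_values(5)[OF k'(1,2)]
    by (simp add: isCont_def filterlim_at_split K'_def)
  have cd: "continuous_on S (jacobi_dn k)" for S by (rule cont_jacobi_dn[OF k])
  have "((\<lambda>v. integral {0..2 * ellip_K k} (\<lambda>u. complex_of_real (zeta_Q k u v) * (jacobi_dn k u * f u))) \<longlongrightarrow> of_real pi * c) (at_left K')"
  proof (rule approximate_identity[where w = "\<lambda>u. (jacobi_sn k u)\<^sup>2"])
    show "continuous_on {0..2 * ellip_K k} (\<lambda>u. (jacobi_sn k u)\<^sup>2)" by (intro continuous_intros cont_jacobi k)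
    show "continuous_on {0..2 * ellip_K k} (\<lambda>u. jacobi_dn k u * f u)" by (intro continuous_intros cd f)
    show "jacobi_dn k u * f u = c" if "u \<in> {0..2 * ellip_K k}" "(jacobi_sn k u)\<^sup>2 = 0" for u
    proof -
      have "u = 0 \<or> u = 2 * ellip_K k" using jacobi_sn_pos[OF k, of u] that by force
      then show ?thesis using f(2,3) jacobi_values(3)[OF k] jacobi_shift(3)[OF k, of 0] by auto
    qed
    show "\<forall>\<^sub>F v in at_left K'. continuous_on {0..2 * ellip_K k} (\<lambda>u. zeta_Q k u v) \<and> (\<forall>u\<in>{0..2 * ellip_K k}. 0 \<le> zeta_Q k u v)"
      using ev
    proof eventually_elim
      case (elim v)
      then have v: "\<bar>v\<bar> < ellip_K (comp_modulus k)" by (simp add: K'_def)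
      show ?case using cont_zeta_Q[OF k v] zeta_den_pos[OF k v] jacobi_cn_pos[OF k'(1,2) v] jacobi_dn_pos[OF k'(1,2)] jacobi_dn_pos[OF k]
        by (auto simp: zeta_Q_def intro!: divide_nonneg_pos mult_nonneg_nonneg less_imp_le)
    qed
    show "((\<lambda>v. integral {0..2 * ellip_K k} (\<lambda>u. zeta_Q k u v)) \<longlongrightarrow> pi) (at_left K')"
      by (rule tendsto_eventually, rule eventually_mono[OF ev], rule integral_zeta_Q[OF k]) (simp add: K'_def)
    show "((\<lambda>v. integral {0..2 * ellip_K k} (\<lambda>u. zeta_Q k u v * (jacobi_sn k u)\<^sup>2)) \<longlongrightarrow> 0) (at_left K')"
    proof (rule Lim_null_comparison)
      \<comment> \<open>From \<open>zeta_den\<close> >= k^2 sn^2(u; k) sn^2(v; k') and dn <= 1 the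
        weighted kernel is at most this, uniformly in u; it tends to 0 with cn(v; k').\<close>
      let ?b = "\<lambda>v. jacobi_cn (comp_modulus k) v / (k\<^sup>2 * (jacobi_sn (comp_modulus k) v)\<^sup>2)"
      show "\<forall>\<^sub>F v in at_left K'. norm (integral {0..2 * ellip_K k} (\<lambda>u. zeta_Q k u v * (jacobi_sn k u)\<^sup>2)) \<le> ?b v * (2 * ellip_K k)"
        using ev
      proof eventually_elim
        case (elim v)
        then have v: "\<bar>v\<bar> < ellip_K (comp_modulus k)" by (simp add: K'_def)
        have c1: "jacobi_cn (comp_modulus k) v > 0" by (rule jacobi_cn_pos[OF k'(1,2) v])
        have d1: "jacobi_dn (comp_modulus k) v > 0" by (rule jacobi_dn_pos[OF k'(1,2)])
        have s1: "jacobi_sn (comp_modulus k) v > 0" using elim K' by (intro jacobi_sn_pos[OF k'(1,2)]) (auto simp: K'_def)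
        have b: "norm (zeta_Q k u v * (jacobi_sn k u)\<^sup>2) \<le> ?b v" for u
        proof -
          have den: "zeta_den k u v > 0" by (rule zeta_den_pos[OF k v])
          have q0: "zeta_Q k u v * (jacobi_sn k u)\<^sup>2 \<ge> 0"
            using c1 d1 den jacobi_dn_pos[OF k, of u] by (simp add: zeta_Q_def)
          have "(jacobi_sn k u)\<^sup>2 * (k\<^sup>2 * (jacobi_sn (comp_modulus k) v)\<^sup>2) \<le> 1 * zeta_den k u v"
            by (simp add: zeta_den_eq[OF k] mult_ac)
          moreover have "jacobi_dn (comp_modulus k) v * jacobi_dn k u \<le> 1 * 1"
            using jacobi_dn_pos[OF k, of u] by (intro mult_mono jacobi_dn_le_1 k k') auto
          ultimately have "(jacobi_dn (comp_modulus k) v * jacobi_dn k u) * ((jacobi_sn k u)\<^sup>2 * (k\<^sup>2 * (jacobi_sn (comp_modulus k) v)\<^sup>2))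
              \<le> 1 * zeta_den k u v"
            by (intro mult_mono[where c = "(jacobi_sn k u)\<^sup>2 * (k\<^sup>2 * (jacobi_sn (comp_modulus k) v)\<^sup>2)"]) auto
          then have "jacobi_cn (comp_modulus k) v * ((jacobi_dn (comp_modulus k) v * jacobi_dn k u) * ((jacobi_sn k u)\<^sup>2 * (k\<^sup>2 * (jacobi_sn (comp_modulus k) v)\<^sup>2)))
              \<le> jacobi_cn (comp_modulus k) v * zeta_den k u v"
            using c1 by (intro mult_left_mono) auto
          then have "zeta_Q k u v * (jacobi_sn k u)\<^sup>2 \<le> ?b v"
            using den s1 k by (simp add: zeta_Q_def divide_simps mult_ac)
          with q0 show ?thesis by simp
        qed
        have "norm (integral {0..2 * ellip_K k} (\<lambda>u. zeta_Q k u v * (jacobi_sn k u)\<^sup>2)) \<le> integral {0..2 * ellip_K k} (\<lambda>u. ?b v)"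
          by (intro integral_norm_bound_integral b integrable_continuous_real continuous_intros cont_zeta_Q[OF k v] cont_jacobi k)
        also have "\<dots> = ?b v * (2 * ellip_K k)" using ellip_K_pos[OF k] by simp
        finally show ?case .
      qed
      have "((\<lambda>v. ?b v * (2 * ellip_K k)) \<longlongrightarrow> 0 / (k\<^sup>2 * 1\<^sup>2) * (2 * ellip_K k)) (at_left K')"
        by (intro tendsto_intros c1 s1) (use k in auto)
      then show "((\<lambda>v. ?b v * (2 * ellip_K k)) \<longlongrightarrow> 0) (at_left K')" by simp
    qed
  qed (use ellip_K_pos[OF k] in auto)
  then have "((\<lambda>v. complex_of_real (jacobi_sn (comp_modulus k) v) *
      integral {0..2 * ellip_K k} (\<lambda>u. complex_of_real (zeta_Q k u v) * (jacobi_dn k u * f u))) \<longlongrightarrow> of_real 1 * (of_real pi * c)) (at_left K')"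
    by (intro tendsto_intros s1)
  moreover have "complex_of_real (jacobi_sn (comp_modulus k) v) *
      integral {0..2 * ellip_K k} (\<lambda>u. complex_of_real (zeta_Q k u v) * (jacobi_dn k u * f u)) =
      integral {0..2 * ellip_K k} (\<lambda>u. complex_of_real (zeta_P k u v) * f u)" for v
    by (subst integral_mult_right[symmetric]) (intro integral_cong, simp add: zeta_P_Q mult_ac)
  ultimately show ?thesis by (simp add: K'_def)
qed

lemma zeta_cx'_holomorphic:
  assumes "0 < k" "k < 1"
  shows "zeta_cx' k holomorphic_on zeta_strip k"
proof -
  have "open (zeta_strip k)"
    unfolding zeta_strip_def by (intro open_Collect_less continuous_intros)
  then have "deriv (zeta_cx k) holomorphic_on zeta_strip k"
    by (intro holomorphic_deriv zeta_cx_holomorphic assms)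
  then show ?thesis
    by (rule holomorphic_transform) (auto simp: zeta_strip_def intro!: DERIV_imp_deriv zeta_cx_deriv assms)
qed

lemma continuous_zeta_lines:
  assumes k: "0 < k" "k < 1" and v: "\<bar>v\<bar> < ellip_K (comp_modulus k)"
  shows "continuous_on S (\<lambda>u. zeta_cx k (Complex u v))" "continuous_on S (\<lambda>u. zeta_cx' k (Complex u v))"
    "continuous_on S (\<lambda>u. complex_of_real (zeta_P k u v))"
proof -
  show "continuous_on S (\<lambda>u. zeta_cx k (Complex u v))" unfolding Complex_eq
    by (rule continuous_on_compose2[OF holomorphic_on_imp_continuous_on[OF zeta_cx_holomorphic[OF k]]])
       (use v in \<open>auto intro!: continuous_intros simp: zeta_strip_def\<close>)
  then have "continuous_on S (\<lambda>u. Im (zeta_cx k (Complex u v)) + zeta_Y k v)" by (intro continuous_intros)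
  then show "continuous_on S (\<lambda>u. complex_of_real (zeta_P k u v))"
    by (intro continuous_on_of_real) (simp add: zeta_cx_def zeta_im_def)
  show "continuous_on S (\<lambda>u. zeta_cx' k (Complex u v))" unfolding Complex_eq
    by (rule continuous_on_compose2[OF holomorphic_on_imp_continuous_on[OF zeta_cx'_holomorphic[OF k]]])
       (use v in \<open>auto intro!: continuous_intros simp: zeta_strip_def\<close>)
qed

lemma zeta_cx'_shift:
  assumes "0 < k" "k < 1"
  shows "zeta_cx' k (z + of_real (2 * ellip_K k)) = zeta_cx' k z"
  using zeta_shift[OF assms] by (simp add: zeta_cx'_def)

text \<open>By reflection \<open>zeta_im\<close> is a combination of \<open>zeta_cx\<close> on the
  lines at heights v and -v. Shifting both to height 0 yields the factors exp(-a) and exp(a), whose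
  difference is the sinh; for the real part of the derivative they are added and give the
  cosh.\<close>

lemma fourier_coeff_zeta_im_aux:
  assumes k: "0 < k" "k < 1" and v: "\<bar>v\<bar> < ellip_K (comp_modulus k)"
  shows "fourier_coeff (2 * ellip_K k) (\<lambda>u. of_real (zeta_im k u v)) m =
    of_real (sinh (pi * m * v / ellip_K k)) * (\<i> * fourier_coeff (2 * ellip_K k) (\<lambda>u. zeta_cx k (Complex u 0)) m)"
    and fourier_coeff_zeta_R_aux: "fourier_coeff (2 * ellip_K k) (\<lambda>u. of_real (zeta_R k u v)) m =
    of_real (pi * m / ellip_K k * cosh (pi * m * v / ellip_K k)) * (\<i> * fourier_coeff (2 * ellip_K k) (\<lambda>u. zeta_cx k (Complex u 0)) m)"
proof -
  define p where "p = 2 * ellip_K k"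
  have p: "p > 0" using ellip_K_pos[OF k] by (simp add: p_def)
  define f where "f = fourier_coeff p (\<lambda>u. zeta_cx k (Complex u 0)) m"
  define a where "a = pi * m * v / ellip_K k"
  have a: "2 * pi * m * v / p = a" by (simp add: p_def a_def)
  have a': "- (2 * pi * m * (- v) / p) = a" using a by simp
  have v': "\<bar>- v\<bar> < ellip_K (comp_modulus k)" using v by simp
  have per: "zeta_cx k (z + of_real p) = zeta_cx k z" "zeta_cx' k (z + of_real p) = zeta_cx' k z" for z
    unfolding p_def by (rule zeta_cx_shift[OF k] zeta_cx'_shift[OF k])+
  note shift = fourier_coeff_line_shift[OF p _ zeta_cx_deriv[OF k] per(1)]
  have "(\<lambda>u. of_real (zeta_im k u v)) = (\<lambda>u. (- \<i> / 2) * zeta_cx k (Complex u v) + (\<i> / 2) * zeta_cx k (Complex u (- v)))"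
  proof
    fix u
    have "zeta_cx k (Complex u (- v)) = cnj (zeta_cx k (Complex u v))"
      using zeta_cx_cnj[OF k, of "Complex u v"] by (simp add: complex_cnj)
    then show "of_real (zeta_im k u v) = (- \<i> / 2) * zeta_cx k (Complex u v) + (\<i> / 2) * zeta_cx k (Complex u (- v))"
      by (simp add: complex_eq_iff zeta_cx_def)
  qed
  then have "fourier_coeff p (\<lambda>u. of_real (zeta_im k u v)) m =
      (- \<i> / 2) * (exp (- a) * f) + (\<i> / 2) * (exp a * f)"
    by (simp only: fourier_coeff_lincomb[OF continuous_zeta_lines(1)[OF k v] continuous_zeta_lines(1)[OF k v']]
        shift[OF v, of m] shift[OF v', of m] f_def a a')
  also have "\<dots> = of_real (sinh a) * (\<i> * f)"
    by (simp add: sinh_field_def field_simps)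
  finally show "fourier_coeff (2 * ellip_K k) (\<lambda>u. of_real (zeta_im k u v)) m =
    of_real (sinh (pi * m * v / ellip_K k)) * (\<i> * fourier_coeff (2 * ellip_K k) (\<lambda>u. zeta_cx k (Complex u 0)) m)"
    by (simp add: a_def f_def p_def)
  define f' where "f' = fourier_coeff p (\<lambda>u. zeta_cx' k (Complex u 0)) m"
  have f': "f' = 2 * pi * \<i> * m / p * f"
    unfolding f'_def f_def
  proof (rule fourier_coeff_vector_derivative[OF p])
    fix u
    have "(zeta_cx k has_field_derivative zeta_cx' k (of_real u)) (at (of_real u))"
      using ellip_K_pos[OF comp_modulus_bounds(1,2)[OF k]] by (intro zeta_cx_deriv k) simp
    then show "((\<lambda>u. zeta_cx k (Complex u 0)) has_vector_derivative zeta_cx' k (Complex u 0)) (at u)"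
      by (simp only: complex_of_real_def[symmetric] has_vector_derivative_real_field)
    show "continuous_on {0..p} (\<lambda>u. zeta_cx' k (Complex u 0))"
      using ellip_K_pos[OF comp_modulus_bounds(1,2)[OF k]] by (intro continuous_zeta_lines k) simp
    show "zeta_cx k (Complex p 0) = zeta_cx k (Complex 0 0)"
      using per(1)[of "Complex 0 0"] by (simp add: complex_of_real_def plus_complex.code)
  qed
  have hol: "(zeta_cx' k has_field_derivative deriv (zeta_cx' k) z) (at z)" if "\<bar>Im z\<bar> < ellip_K (comp_modulus k)" for z
    using that by (intro holomorphic_derivI[OF zeta_cx'_holomorphic[OF k]])
      (auto simp: zeta_strip_def intro!: open_Collect_less continuous_intros)
  note shift' = fourier_coeff_line_shift[OF p _ hol per(2)]
  have "(\<lambda>u. of_real (zeta_R k u v)) = (\<lambda>u. (1 / 2) * zeta_cx' k (Complex u v) + (1 / 2) * zeta_cx' k (Complex u (- v)))"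
  proof
    fix u
    have "zeta_cx' k (Complex u (- v)) = cnj (zeta_cx' k (Complex u v))"
      using zeta_cx'_cnj[OF k, of "Complex u v"] by (simp add: complex_cnj)
    then show "of_real (zeta_R k u v) = (1 / 2) * zeta_cx' k (Complex u v) + (1 / 2) * zeta_cx' k (Complex u (- v))"
      by (simp add: complex_eq_iff zeta_cx'_def)
  qed
  then have "fourier_coeff p (\<lambda>u. of_real (zeta_R k u v)) m =
      (1 / 2) * (exp (- a) * f') + (1 / 2) * (exp a * f')"
    by (simp only: fourier_coeff_lincomb[OF continuous_zeta_lines(2)[OF k v] continuous_zeta_lines(2)[OF k v']]
        shift'[OF v, of m] shift'[OF v', of m] f'_def a a')
  also have "\<dots> = of_real (cosh a) * f'"
    by (simp add: cosh_field_def field_simps)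
  finally show "fourier_coeff (2 * ellip_K k) (\<lambda>u. of_real (zeta_R k u v)) m =
    of_real (pi * m / ellip_K k * cosh (pi * m * v / ellip_K k)) * (\<i> * fourier_coeff (2 * ellip_K k) (\<lambda>u. zeta_cx k (Complex u 0)) m)"
    by (simp add: a_def f' p_def) (simp add: f_def p_def)
qed

text \<open>The unknown coefficient on the real line is found by letting v tend to K' in the
  preceding formula: sinh is continuous, and the mass pi of \<open>zeta_P\<close> is tested against
  an exponential that equals 1 at both endpoints. \<open>zeta_Y\<close> is constant in u and enters
  only the mean.\<close>

lemma fourier_coeff_zeta_limit:
  assumes k: "0 < k" "k < 1"
  shows "of_real (sinh (pi * m * ellip_K (comp_modulus k) / ellip_K k)) * (\<i> * fourier_coeff (2 * ellip_K k) (\<lambda>u. zeta_cx k (Complex u 0)) m)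
    = of_real (pi / (2 * ellip_K k) - (if m = 0 then zeta_Y k (ellip_K (comp_modulus k)) else 0))"
proof -
  define p where "p = 2 * ellip_K k"
  have p: "p > 0" using ellip_K_pos[OF k] by (simp add: p_def)
  define K' where "K' = ellip_K (comp_modulus k)"
  have K': "K' > 0" using ellip_K_pos[OF comp_modulus_bounds(1,2)[OF k]] by (simp add: K'_def)
  define f where "f = fourier_coeff p (\<lambda>u. zeta_cx k (Complex u 0)) m"
  have ev: "\<forall>\<^sub>F v in at_left K'. \<bar>v\<bar> < K'"
    using eventually_at_left_real[OF K'] by eventually_elim auto
  have "((\<lambda>v. 1 / p * integral {0..p} (\<lambda>u. complex_of_real (zeta_P k u v) * fourier_exp p (- m) u) - of_real (if m = 0 then zeta_Y k v else 0))
      \<longlongrightarrow> of_real (1 / p) * (complex_of_real pi * 1) - complex_of_real (if m = 0 then zeta_Y k K' else 0)) (at_left K')"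
  proof (intro tendsto_intros)
    show "((\<lambda>v. integral {0..p} (\<lambda>u. complex_of_real (zeta_P k u v) * fourier_exp p (- m) u)) \<longlongrightarrow> complex_of_real pi * 1) (at_left K')"
      unfolding p_def K'_def
    proof (rule zeta_P_limit[OF k])
      show "continuous_on {0..2 * ellip_K k} (fourier_exp (2 * ellip_K k) (- m))"
        using ellip_K_pos[OF k] by (intro continuous_intros) auto
      show "fourier_exp (2 * ellip_K k) (- m) (2 * ellip_K k) = 1"
        using fourier_exp_shift[of "2 * ellip_K k" "-m" 0] ellip_K_pos[OF k] by simp
    qed simp
    have "isCont (zeta_Y k) K'" using zeta_Y_deriv[OF k] by (rule DERIV_isCont)
    then show "((\<lambda>v. if m = 0 then zeta_Y k v else 0) \<longlongrightarrow> (if m = 0 then zeta_Y k K' else 0)) (at_left K')"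
      by (simp add: isCont_def filterlim_at_split)
  qed
  moreover have "\<forall>\<^sub>F v in at_left K'. 1 / p * integral {0..p} (\<lambda>u. complex_of_real (zeta_P k u v) * fourier_exp p (- m) u) - of_real (if m = 0 then zeta_Y k v else 0)
      = of_real (sinh (pi * m * v / ellip_K k)) * (\<i> * f)"
    using ev
  proof eventually_elim
    case (elim v)
    then have v: "\<bar>v\<bar> < ellip_K (comp_modulus k)" by (simp add: K'_def)
    have "of_real (sinh (pi * m * v / ellip_K k)) * (\<i> * f) = fourier_coeff p (\<lambda>u. 1 * of_real (zeta_P k u v) + (-1) * of_real (zeta_Y k v)) m"
      using fourier_coeff_zeta_im_aux[OF k v, of m] by (simp add: p_def f_def zeta_im_def)
    also have "\<dots> = 1 * fourier_coeff p (\<lambda>u. of_real (zeta_P k u v)) m + (-1) * fourier_coeff p (\<lambda>u. of_real (zeta_Y k v)) m"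
      by (intro fourier_coeff_lincomb continuous_zeta_lines k v continuous_intros)
    also have "\<dots> = 1 / p * integral {0..p} (\<lambda>u. complex_of_real (zeta_P k u v) * fourier_exp p (- m) u) - of_real (if m = 0 then zeta_Y k v else 0)"
      by (simp only: fourier_coeff_const[OF p] fourier_coeff_eq[OF continuous_zeta_lines(3)[OF k v]]) simp
    finally show ?case by simp
  qed
  ultimately have "((\<lambda>v. of_real (sinh (pi * m * v / ellip_K k)) * (\<i> * f)) \<longlongrightarrow>
      of_real (1 / p) * (complex_of_real pi * 1) - complex_of_real (if m = 0 then zeta_Y k K' else 0)) (at_left K')"
    by (rule Lim_transform_eventually)
  moreover have "isCont (\<lambda>v. of_real (sinh (pi * m * v / ellip_K k)) * (\<i> * f)) K'"
    using ellip_K_pos[OF k] by (intro continuous_intros) auto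
  then have "((\<lambda>v. of_real (sinh (pi * m * v / ellip_K k)) * (\<i> * f)) \<longlongrightarrow> of_real (sinh (pi * m * K' / ellip_K k)) * (\<i> * f)) (at_left K')"
    by (simp only: isCont_def filterlim_at_split)
  ultimately have "of_real (sinh (pi * m * K' / ellip_K k)) * (\<i> * f) = of_real (1 / p) * (complex_of_real pi * 1) - complex_of_real (if m = 0 then zeta_Y k K' else 0)"
    by (rule tendsto_unique[OF trivial_limit_at_left_real, rotated])
  then show ?thesis by (simp add: f_def p_def K'_def)
qed

text \<open>This is Legendre's relation: \<open>jacobi_zeta\<close> vanishes at \<open>K'\<close>.\<close>

lemma zeta_Y_K':
  assumes k: "0 < k" "k < 1"
  shows "zeta_Y k (ellip_K (comp_modulus k)) = pi / (2 * ellip_K k)"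
proof -
  have "of_real (pi / (2 * ellip_K k) - zeta_Y k (ellip_K (comp_modulus k))) = (0::complex)"
    using fourier_coeff_zeta_limit[OF k, of 0] by simp
  then show ?thesis by (simp only: of_real_eq_0_iff)
qed

text \<open>Legendre's relation brings the linear term to its classical form, which later matches
  the term 8 pi \<delta> K / (L^2 K') of \<open>wave_speed\<close>.\<close>

lemma zeta_Y_eq:
  assumes k: "0 < k" "k < 1"
  shows "zeta_Y k v = jacobi_zeta (comp_modulus k) v + pi * v / (2 * ellip_K k * ellip_K (comp_modulus k))"
proof -
  have "(ellip_E k / ellip_K k - 1 + ellip_E (comp_modulus k) / ellip_K (comp_modulus k)) * ellip_K (comp_modulus k) = pi / (2 * ellip_K k)"
    using zeta_Y_K'[OF k] jacobi_zeta_K[OF comp_modulus_bounds(1,2)[OF k]] by (simp add: zeta_Y_def)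
  then have "ellip_E k / ellip_K k - 1 + ellip_E (comp_modulus k) / ellip_K (comp_modulus k) = pi / (2 * ellip_K k) / ellip_K (comp_modulus k)"
    using ellip_K_pos[OF comp_modulus_bounds(1,2)[OF k]] by (metis less_irrefl nonzero_mult_div_cancel_right)
  then show ?thesis by (simp add: zeta_Y_def)
qed

text \<open>For \<open>m = 0\<close> the quotients are \<open>0 / 0 = 0\<close>, which is the correct mean value.\<close>

lemma fourier_coeff_zeta_im:
  assumes k: "0 < k" "k < 1" and v: "\<bar>v\<bar> < ellip_K (comp_modulus k)"
  shows "fourier_coeff (2 * ellip_K k) (\<lambda>u. of_real (zeta_im k u v)) m =
    of_real (pi / (2 * ellip_K k) * (sinh (pi * m * v / ellip_K k) / sinh (pi * m * ellip_K (comp_modulus k) / ellip_K k)))"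
    and fourier_coeff_zeta_R: "fourier_coeff (2 * ellip_K k) (\<lambda>u. of_real (zeta_R k u v)) m =
    of_real (pi / (2 * ellip_K k) * (pi * m / ellip_K k * cosh (pi * m * v / ellip_K k) / sinh (pi * m * ellip_K (comp_modulus k) / ellip_K k)))"
proof -
  define f where "f = \<i> * fourier_coeff (2 * ellip_K k) (\<lambda>u. zeta_cx k (Complex u 0)) m"
  have f: "f = of_real (pi / (2 * ellip_K k) / sinh (pi * m * ellip_K (comp_modulus k) / ellip_K k))" if "m \<noteq> 0"
  proof -
    have "sinh (pi * m * ellip_K (comp_modulus k) / ellip_K k) \<noteq> 0"
      using that ellip_K_pos[OF k] ellip_K_pos[OF comp_modulus_bounds(1,2)[OF k]] by simp
    then show ?thesis using fourier_coeff_zeta_limit[OF k, of m] that by (simp add: f_def field_simps)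
  qed
  note aux = fourier_coeff_zeta_im_aux[OF k v, of m, folded f_def] fourier_coeff_zeta_R_aux[OF k v, of m, folded f_def]
  show "fourier_coeff (2 * ellip_K k) (\<lambda>u. of_real (zeta_im k u v)) m =
    of_real (pi / (2 * ellip_K k) * (sinh (pi * m * v / ellip_K k) / sinh (pi * m * ellip_K (comp_modulus k) / ellip_K k)))"
    unfolding aux using f by (cases "m = 0") simp_all
  show "fourier_coeff (2 * ellip_K k) (\<lambda>u. of_real (zeta_R k u v)) m =
    of_real (pi / (2 * ellip_K k) * (pi * m / ellip_K k * cosh (pi * m * v / ellip_K k) / sinh (pi * m * ellip_K (comp_modulus k) / ellip_K k)))"
    unfolding aux using f by (cases "m = 0") (simp_all add: mult_ac)
qed

section \<open>Trigonometric series and smooth curves\<close>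

definition trig_series :: "real \<Rightarrow> (int \<Rightarrow> complex) \<Rightarrow> real \<Rightarrow> complex" where
  "trig_series p a x = (\<Sum>\<^sub>\<infinity>m. a m * fourier_exp p m x)"

lemma continuous_fourier_exp: "continuous_on S (fourier_exp p m)"
  by (cases "p = 0") (auto intro!: continuous_intros)

lemma trig_series_uniform_limit:
  assumes "(\<lambda>m. norm (a m)) summable_on UNIV"
  shows "uniform_limit S (\<lambda>X x. \<Sum>m\<in>X. a m * fourier_exp p m x) (trig_series p a) (finite_subsets_at_top UNIV)"
  unfolding trig_series_def[abs_def]
  by (rule Weierstrass_m_test_general[OF _ assms]) (simp add: norm_mult)

lemma continuous_trig_series:
  assumes "(\<lambda>m. norm (a m)) summable_on UNIV"
  shows "continuous_on S (trig_series p a)"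
proof (rule uniform_limit_theorem[OF _ trig_series_uniform_limit[OF assms]])
  show "\<forall>\<^sub>F X in finite_subsets_at_top UNIV. continuous_on S (\<lambda>x. \<Sum>m\<in>X. a m * fourier_exp p m x)"
    by (intro always_eventually allI continuous_on_sum continuous_on_mult continuous_on_const continuous_fourier_exp)
qed simp

lemma trig_series_periodic:
  assumes "p \<noteq> 0"
  shows "trig_series p a (x + p) = trig_series p a x"
  by (simp only: trig_series_def fourier_exp_shift[OF assms])

text \<open>Uniform convergence allows integration along finite index sets, and the integral is
  constant as soon as the set contains \<open>n\<close>.\<close>

lemma fourier_coeff_trig_series:
  assumes p: "p > 0" and a: "(\<lambda>m. norm (a m)) summable_on UNIV"
  shows "fourier_coeff p (trig_series p a) n = a n"
proof -
  let ?F = "finite_subsets_at_top (UNIV :: int set)"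
  have U: "uniform_limit {0..p} (\<lambda>X x. (\<Sum>m\<in>X. a m * fourier_exp p m x) * fourier_exp p (- n) x)
      (\<lambda>x. trig_series p a x * fourier_exp p (- n) x) ?F"
  proof -
    have "uniform_limit {0..p} (\<lambda>X x. \<Sum>m\<in>X. a m * fourier_exp p m x * fourier_exp p (- n) x)
        (\<lambda>x. \<Sum>\<^sub>\<infinity>m. a m * fourier_exp p m x * fourier_exp p (- n) x) ?F"
      by (rule Weierstrass_m_test_general[OF _ a]) (simp only: norm_mult norm_fourier_exp mult_1_right order_refl)
    moreover have "(\<lambda>m. a m * fourier_exp p m x) summable_on UNIV" for x
      by (rule abs_summable_summable) (use a in \<open>simp only: norm_mult norm_fourier_exp mult_1_right\<close>)
    ultimately show ?thesis
      by (simp only: trig_series_def infsum_cmult_left sum_distrib_right)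
  qed
  have c: "continuous_on {0..p} (\<lambda>x::real. (\<Sum>m\<in>X. a m * fourier_exp p m x) * fourier_exp p (- n) x)" for X :: "int set"
    by (intro continuous_on_sum continuous_on_mult continuous_on_const continuous_fourier_exp)
  obtain I J where I: "\<And>X. ((\<lambda>x. (\<Sum>m\<in>X. a m * fourier_exp p m x) * fourier_exp p (- n) x) has_integral I X) {0..p}"
    and J: "((\<lambda>x. trig_series p a x * fourier_exp p (- n) x) has_integral J) {0..p}" and lim: "(I \<longlongrightarrow> J) ?F"
    using uniform_limit_integral[OF U c finite_subsets_at_top_neq_bot] by blast
  have "I X = complex_of_real p * a n" if X: "finite X" "n \<in> X" for X
  proof -
    have eq: "fourier_exp p m x * fourier_exp p (- n) x = fourier_exp p (m - n) x" for m :: int and x :: real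
      using fourier_exp_add[of m "-n" x p] by simp
    have E: "(\<lambda>x::real. (\<Sum>m\<in>X. a m * fourier_exp p m x) * fourier_exp p (- n) x) = (\<lambda>x. \<Sum>m\<in>X. a m * fourier_exp p (m - n) x)"
      unfolding sum_distrib_right by (intro ext sum.cong refl) (subst mult.assoc, simp only: eq)
    have "I X = integral {0..p} (\<lambda>x. \<Sum>m\<in>X. a m * fourier_exp p (m - n) x)"
      using integral_unique[OF I[of X]] unfolding E by (rule sym)
    also have "\<dots> = (\<Sum>m\<in>X. integral {0..p} (\<lambda>x. a m * fourier_exp p (m - n) x))"
      by (rule integral_sum[OF X(1)]) (intro integrable_continuous_real continuous_intros continuous_fourier_exp)
    also have "\<dots> = (\<Sum>m\<in>X. if m = n then p * a n else 0)"
      by (intro sum.cong refl) (simp only: integral_mult_right integral_fourier_exp[OF p], simp)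
    finally show ?thesis using X by simp
  qed
  then have "\<forall>\<^sub>F X in ?F. I X = p * a n"
    unfolding eventually_finite_subsets_at_top by (intro exI[of _ "{n}"]) auto
  then have "(I \<longlongrightarrow> p * a n) ?F" by (rule tendsto_eventually)
  then have "J = p * a n" by (rule tendsto_unique[OF finite_subsets_at_top_neq_bot lim])
  then show ?thesis using p J by (simp add: fourier_coeff_eq continuous_trig_series[OF a] integral_unique)
qed

text \<open>The uniqueness theorem applies to the difference of \<open>f\<close> and the series.
  Used both for the wave and for its image under the operator.\<close>

lemma fourier_series_eq:
  assumes p: "p > 0" and cont: "continuous_on UNIV f" and per: "\<And>x. f (x + p) = f x"
    and coeff: "\<And>m. fourier_coeff p f m = a m" and a: "(\<lambda>m. norm (a m)) summable_on UNIV"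
  shows "f = trig_series p a"
proof
  fix x
  have "1 * f x + (-1) * trig_series p a x = 0"
  proof (rule fourier_coeff_unique_zero[OF p])
    show "continuous_on UNIV (\<lambda>x. 1 * f x + (-1) * trig_series p a x)"
      by (intro continuous_intros cont continuous_trig_series a)
    show "1 * f (x + p) + (-1) * trig_series p a (x + p) = 1 * f x + (-1) * trig_series p a x" for x
      using trig_series_periodic[of p a x] p per[of x] by simp
    show "fourier_coeff p (\<lambda>x. 1 * f x + (-1) * trig_series p a x) m = 0" for m
      by (subst fourier_coeff_lincomb)
         (auto simp: coeff fourier_coeff_trig_series[OF p a] intro: continuous_on_subset[OF cont] continuous_trig_series[OF a])
  qed
  then show "f x = trig_series p a x" by simp
qed

lemma summable_exp_decay:
  fixes \<epsilon> :: real
  assumes e: "\<epsilon> > 0"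
  shows "(\<lambda>m::int. (1 + (real_of_int m)\<^sup>2) ^ n * exp (- \<epsilon> * \<bar>real_of_int m\<bar>)) summable_on UNIV"
proof -
  let ?f = "\<lambda>m::int. (1 + (real_of_int m)\<^sup>2) ^ n * exp (- \<epsilon> * \<bar>real_of_int m\<bar>)"
  have "summable (\<lambda>m::nat. (1 + (real m)\<^sup>2) ^ n * exp (- \<epsilon> * real m))"
  proof (rule summable_comparison_test_bigo)
    show "summable (\<lambda>m. norm (exp (- \<epsilon> / 2) ^ m))" using e by (simp add: norm_power)
    have "(\<lambda>m. (1 + (real m)\<^sup>2) ^ n * exp (- \<epsilon> * real m)) \<in> O(\<lambda>m. exp (- \<epsilon> / 2 * real m))"
      using e by real_asymp
    then show "(\<lambda>m. (1 + (real m)\<^sup>2) ^ n * exp (- \<epsilon> * real m)) \<in> O(\<lambda>m. exp (- \<epsilon> / 2) ^ m)"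
      by (simp add: exp_of_nat_mult[symmetric] mult_ac)
  qed
  then have nat: "(\<lambda>m::nat. (1 + (real m)\<^sup>2) ^ n * exp (- \<epsilon> * real m)) summable_on UNIV"
    by (rule summable_nonneg_imp_summable_on) simp
  have "?f summable_on (range int)"
    by (subst summable_on_reindex) (use nat in \<open>simp_all add: o_def\<close>)
  \<comment> \<open>\<open>Suc\<close> keeps 0 out of the negative half, so that the two ranges are
    disjoint.\<close>
  moreover have "?f summable_on (range (\<lambda>m. - int (Suc m)))"
  proof (subst summable_on_reindex)
    show "inj (\<lambda>m. - int (Suc m))" by (auto simp: inj_def)
    have "(\<lambda>m::nat. (1 + (real m)\<^sup>2) ^ n * exp (- \<epsilon> * real m)) summable_on (range Suc)"
      using nat by (rule summable_on_subset_banach) simp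
    then show "(?f \<circ> (\<lambda>m. - int (Suc m))) summable_on UNIV"
      by (subst (asm) summable_on_reindex) (simp_all add: o_def power2_commute[of 1] power2_commute[of "-1"] algebra_simps)
  qed
  moreover have "range int \<inter> range (\<lambda>m. - int (Suc m)) = {}" by auto
  ultimately have "?f summable_on (range int \<union> range (\<lambda>m. - int (Suc m)))"
    by (rule summable_on_Un_disjoint)
  moreover have "x \<in> range int \<union> range (\<lambda>m. - int (Suc m))" for x :: int
    by (cases x rule: int_cases) auto
  then have "range int \<union> range (\<lambda>m. - int (Suc m)) = UNIV" by blast
  ultimately show ?thesis by simp
qed

lemma summable_comparison_exp:
  fixes \<epsilon> :: real and a :: "int \<Rightarrow> complex"
  assumes e: "\<epsilon> > 0" and a: "\<And>m. cmod (a m) \<le> M * exp (- \<epsilon> * \<bar>real_of_int m\<bar>)"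
  shows "(\<lambda>m. norm (a m)) summable_on UNIV"
    "(\<lambda>m::int. (1 + (real_of_int m)\<^sup>2) ^ n * (cmod (a m))\<^sup>2) summable_on UNIV"
    "(\<Sum>\<^sub>\<infinity>m. (1 + (real_of_int m)\<^sup>2) ^ n * (cmod (a m))\<^sup>2) \<le> M\<^sup>2 * (\<Sum>\<^sub>\<infinity>m. (1 + (real_of_int m)\<^sup>2) ^ n * exp (- (2 * \<epsilon>) * \<bar>real_of_int m\<bar>))"
proof -
  have "(\<lambda>m::int. M * exp (- \<epsilon> * \<bar>real_of_int m\<bar>)) summable_on UNIV"
    using summable_exp_decay[OF e, of 0] by (intro summable_on_cmult_right) simp
  then show "(\<lambda>m. norm (a m)) summable_on UNIV"
    by (rule summable_on_comparison_test) (use a in auto)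
  have "2 * \<epsilon> > 0" using e by simp
  note S = summable_on_cmult_right[OF summable_exp_decay[OF this, of n], of "M\<^sup>2"]
  have le: "(1 + (real_of_int m)\<^sup>2) ^ n * (cmod (a m))\<^sup>2 \<le> M\<^sup>2 * ((1 + (real_of_int m)\<^sup>2) ^ n * exp (- (2 * \<epsilon>) * \<bar>real_of_int m\<bar>))" for m
  proof -
    have "(cmod (a m))\<^sup>2 \<le> (M * exp (- \<epsilon> * \<bar>real_of_int m\<bar>))\<^sup>2" by (intro power_mono a) simp
    also have "\<dots> = M\<^sup>2 * exp (- (2 * \<epsilon>) * \<bar>real_of_int m\<bar>)"
      by (simp add: power_mult_distrib flip: exp_double)
    finally have "(1 + (real_of_int m)\<^sup>2) ^ n * (cmod (a m))\<^sup>2 \<le> (1 + (real_of_int m)\<^sup>2) ^ n * (M\<^sup>2 * exp (- (2 * \<epsilon>) * \<bar>real_of_int m\<bar>))"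
      by (intro mult_left_mono) simp_all
    then show ?thesis by (simp only: mult.left_commute)
  qed
  show 2: "(\<lambda>m::int. (1 + (real_of_int m)\<^sup>2) ^ n * (cmod (a m))\<^sup>2) summable_on UNIV"
    by (rule summable_on_comparison_test[OF S]) (use le in auto)
  have "(\<Sum>\<^sub>\<infinity>m. (1 + (real_of_int m)\<^sup>2) ^ n * (cmod (a m))\<^sup>2) \<le> (\<Sum>\<^sub>\<infinity>m. M\<^sup>2 * ((1 + (real_of_int m)\<^sup>2) ^ n * exp (- (2 * \<epsilon>) * \<bar>real_of_int m\<bar>)))"
    by (rule infsum_mono[OF 2 S]) (rule le)
  also have "\<dots> = M\<^sup>2 * (\<Sum>\<^sub>\<infinity>m. (1 + (real_of_int m)\<^sup>2) ^ n * exp (- (2 * \<epsilon>) * \<bar>real_of_int m\<bar>))"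
    by (rule infsum_cmult_right) (rule summable_exp_decay[OF \<open>2 * \<epsilon> > 0\<close>])
  finally show "(\<Sum>\<^sub>\<infinity>m. (1 + (real_of_int m)\<^sup>2) ^ n * (cmod (a m))\<^sup>2) \<le> M\<^sup>2 * (\<Sum>\<^sub>\<infinity>m. (1 + (real_of_int m)\<^sup>2) ^ n * exp (- (2 * \<epsilon>) * \<bar>real_of_int m\<bar>))" .
qed

lemma L2_per_continuous:
  assumes "continuous_on UNIV g" "\<And>x. g (x + L) = g x"
  shows "g \<in> L2_per L"
proof -
  have c: "continuous_on {0..L} g" "continuous_on {0..L} (\<lambda>x. (cmod (g x))\<^sup>2)"
    using continuous_on_subset[OF assms(1)] by (auto intro!: continuous_intros)
  have "set_borel_measurable lborel {0..L} g"
    using borel_measurable_continuous_onI[OF assms(1)] by (simp add: set_borel_measurable_def)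
  then show ?thesis using assms(2) borel_integrable_atLeastAtMost'[OF c(2)] by (simp add: L2_per_def)
qed

lemma trig_series_H_per:
  fixes \<epsilon> :: real and a :: "int \<Rightarrow> complex"
  assumes p: "p > 0" and e: "\<epsilon> > 0" and a: "\<And>m. cmod (a m) \<le> M * exp (- \<epsilon> * \<bar>real_of_int m\<bar>)" and a0: "a 0 = 0"
  shows "trig_series p a \<in> H_per n p \<inter> H_0 p"
proof -
  note s = summable_comparison_exp[OF e a]
  have L2: "trig_series p a \<in> L2_per p"
    using trig_series_periodic[of p a] p by (intro L2_per_continuous continuous_trig_series s(1)) auto
  have "1 / p * (LBINT x:{0..p}. trig_series p a x) = 0"
    using fourier_coeff_0[OF continuous_trig_series[OF s(1)], of p p] a0 fourier_coeff_trig_series[OF p s(1), of 0] by simp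
  then have "(LBINT x:{0..p}. trig_series p a x) = 0" using p by simp
  then show ?thesis using L2 s(2)[of n] by (simp add: H_per_def H_0_def fourier_coeff_trig_series[OF p s(1)])
qed

lemma trig_series_lincomb:
  assumes "(\<lambda>m. norm (a m)) summable_on UNIV" "(\<lambda>m. norm (b m)) summable_on UNIV"
  shows "trig_series p (\<lambda>m. c * a m + d * b m) x = c * trig_series p a x + d * trig_series p b x"
proof -
  have s: "(\<lambda>m. a m * fourier_exp p m x) summable_on UNIV" if "(\<lambda>m. norm (a m)) summable_on UNIV" for a
    by (rule abs_summable_summable) (use that in \<open>simp only: norm_mult norm_fourier_exp mult_1_right\<close>)
  have "trig_series p (\<lambda>m. c * a m + d * b m) x = (\<Sum>\<^sub>\<infinity>m. c * (a m * fourier_exp p m x) + d * (b m * fourier_exp p m x))"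
    by (simp only: trig_series_def distrib_right mult.assoc)
  also have "\<dots> = c * trig_series p a x + d * trig_series p b x"
    unfolding trig_series_def using s[OF assms(1)] s[OF assms(2)]
    by (simp only: infsum_add summable_on_cmult_right infsum_cmult_right)
  finally show ?thesis .
qed

text \<open>Each point of the half ball is the centre of a disc of radius \<rho>/4 inside the large
  ball, so Cauchy's inequality costs a factor that depends only on j and \<rho>. A bound
  \<open>B\<close> that decays in the Fourier index is thus passed on to all derivatives.\<close>

lemma higher_deriv_bound:
  assumes g: "g holomorphic_on ball w \<rho>" "\<And>z. z \<in> ball w \<rho> \<Longrightarrow> cmod (g z) \<le> B" and \<rho>: "\<rho> > 0"
    and z: "z \<in> ball w (\<rho> / 2)"
  shows "cmod ((deriv ^^ j) g z) \<le> fact j / (\<rho> / 4) ^ j * B"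
proof -
  have sub: "cball z (\<rho> / 4) \<subseteq> ball w \<rho>"
  proof
    fix y assume "y \<in> cball z (\<rho> / 4)"
    then show "y \<in> ball w \<rho>" using z dist_triangle[of w y z] \<rho> by (simp add: dist_commute)
  qed
  have "cmod ((deriv ^^ j) g z) \<le> fact j * B / (\<rho> / 4) ^ j"
  proof (rule Cauchy_inequality)
    show "g holomorphic_on ball z (\<rho> / 4)"
      using holomorphic_on_subset[OF g(1)] sub ball_subset_cball by blast
    show "continuous_on (cball z (\<rho> / 4)) g"
      by (rule holomorphic_on_imp_continuous_on[OF holomorphic_on_subset[OF g(1) sub]])
    show "cmod (g x) \<le> B" if "cmod (z - x) = \<rho> / 4" for x
      using that sub by (intro g(2)) (auto simp: dist_norm)
  qed (use \<rho> in simp)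
  then show ?thesis by simp
qed

text \<open>First-order Taylor formula for the j-th derivative, with the remainder controlled by the
  derivative of order j + 2. The estimate stays proportional to \<open>B\<close>.\<close>

lemma higher_deriv_difference_quotient:
  assumes g: "g holomorphic_on ball w \<rho>" "\<And>z. z \<in> ball w \<rho> \<Longrightarrow> cmod (g z) \<le> B" and \<rho>: "\<rho> > 0"
    and z: "z \<in> ball w (\<rho> / 2)" "z \<noteq> w"
  shows "cmod (((deriv ^^ j) g z - (deriv ^^ j) g w) / (z - w) - (deriv ^^ Suc j) g w)
    \<le> fact (j + 2) / (\<rho> / 4) ^ (j + 2) * B * cmod (z - w)"
proof -
  let ?f = "\<lambda>i. (deriv ^^ (j + i)) g" and ?B = "fact (j + 2) / (\<rho> / 4) ^ (j + 2) * B"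
  have "cmod (?f 0 z - (\<Sum>i\<le>1. ?f i w * (z - w) ^ i / fact i)) \<le> ?B * cmod (z - w) ^ Suc 1 / fact 1"
  proof (rule complex_Taylor)
    show "convex (ball w (\<rho> / 2))" by simp
    fix x assume x: "x \<in> ball w (\<rho> / 2)"
    then have x': "x \<in> ball w \<rho>" using \<rho> by simp
    have hd: "(deriv ^^ n) g holomorphic_on ball w \<rho>" for n
      by (rule holomorphic_higher_deriv[OF g(1)]) simp
    show "(?f i has_field_derivative ?f (Suc i) x) (at x within ball w (\<rho> / 2))" for i
      using holomorphic_derivI[OF hd open_ball x'] by simp
    show "cmod (?f (Suc 1) x) \<le> ?B"
      using higher_deriv_bound[OF g \<rho> x, of "j + 2"] by (simp add: numeral_2_eq_2)
  qed (use z \<rho> in auto)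
  then have *: "cmod ((deriv ^^ j) g z - (deriv ^^ j) g w - (deriv ^^ Suc j) g w * (z - w)) \<le> ?B * cmod (z - w) * cmod (z - w)"
    by (simp add: diff_diff_eq power2_eq_square mult.assoc)
  have "((deriv ^^ j) g z - (deriv ^^ j) g w) / (z - w) - (deriv ^^ Suc j) g w =
    ((deriv ^^ j) g z - (deriv ^^ j) g w - (deriv ^^ Suc j) g w * (z - w)) / (z - w)"
    using z(2) by (simp add: diff_divide_distrib)
  also have "cmod \<dots> \<le> ?B * cmod (z - w)"
    using * z(2) by (simp add: norm_divide pos_divide_le_eq)
  finally show ?thesis .
qed

lemma H_per_norm_trig_series_le:
  fixes \<epsilon> :: real and a :: "int \<Rightarrow> complex"
  assumes p: "p > 0" and e: "\<epsilon> > 0" and a: "\<And>m. cmod (a m) \<le> M * exp (- \<epsilon> * \<bar>real_of_int m\<bar>)" and M: "M \<ge> 0"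
  shows "H_per_norm n p (trig_series p a) \<le>
    M * sqrt (p * (\<Sum>\<^sub>\<infinity>m. (1 + (real_of_int m)\<^sup>2) ^ n * exp (- (2 * \<epsilon>) * \<bar>real_of_int m\<bar>)))"
proof -
  note s = summable_comparison_exp[OF e a]
  have "H_per_norm n p (trig_series p a) = sqrt (p * (\<Sum>\<^sub>\<infinity>m. (1 + (real_of_int m)\<^sup>2) ^ n * (cmod (a m))\<^sup>2))"
    by (simp add: H_per_norm_def fourier_coeff_trig_series[OF p s(1)])
  also have "\<dots> \<le> sqrt (p * (M\<^sup>2 * (\<Sum>\<^sub>\<infinity>m. (1 + (real_of_int m)\<^sup>2) ^ n * exp (- (2 * \<epsilon>) * \<bar>real_of_int m\<bar>))))"
    using p s(3)[of n] by (intro real_sqrt_le_mono mult_left_mono) auto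
  also have "\<dots> = M * sqrt (p * (\<Sum>\<^sub>\<infinity>m. (1 + (real_of_int m)\<^sup>2) ^ n * exp (- (2 * \<epsilon>) * \<bar>real_of_int m\<bar>)))"
    using M by (simp add: real_sqrt_mult)
  finally show ?thesis .
qed

text \<open>The derivatives of the curve are the series of the termwise complex derivatives. Locally
  uniform exponential decay outweighs the powers of m in the norm, and the vanishing of
  \<open>C 0\<close> keeps all derivatives in \<open>H_0\<close>.\<close>

lemma smooth_curve_trig_series:
  fixes C :: "int \<Rightarrow> complex \<Rightarrow> complex"
  assumes L: "L > 0" and C0: "C 0 = (\<lambda>_. 0)"
    and loc: "\<And>k. k \<in> I \<Longrightarrow> \<exists>\<rho>>0. \<exists>\<epsilon>>0. \<exists>M\<ge>0. \<forall>m. C m holomorphic_on ball (of_real k) \<rho> \<and>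
       (\<forall>z\<in>ball (of_real k) \<rho>. cmod (C m z) \<le> M * exp (- \<epsilon> * \<bar>real_of_int m\<bar>))"
    and f: "\<And>k. k \<in> I \<Longrightarrow> f k = trig_series L (\<lambda>m. C m (of_real k))"
  shows "smooth_curve n L I f"
proof -
  define c where "c = (\<lambda>j k m. (deriv ^^ j) (C m) (complex_of_real k))"
  define D where "D = (\<lambda>j k. trig_series L (c j k))"
  have c0: "c j k 0 = 0" for j k
  proof -
    have "(deriv ^^ j) (\<lambda>_. 0 :: complex) = (\<lambda>_. 0)" by (induction j) auto
    then show ?thesis by (simp add: c_def C0)
  qed
  have main: "D j k \<in> H_per n L \<inter> H_0 L \<and>
      ((\<lambda>t. H_per_norm n L (\<lambda>x. (D j t x - D j k x) / (t - k) - D (Suc j) k x)) \<longlongrightarrow> 0) (at k within I)"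
    if k: "k \<in> I" for j k
  proof -
    obtain \<rho> \<epsilon> M where \<rho>: "\<rho> > 0" and \<epsilon>: "\<epsilon> > 0" and M: "M \<ge> 0"
      and hol: "\<And>m. C m holomorphic_on ball (of_real k) \<rho>"
      and bd: "\<And>m z. z \<in> ball (of_real k) \<rho> \<Longrightarrow> cmod (C m z) \<le> M * exp (- \<epsilon> * \<bar>real_of_int m\<bar>)"
      using loc[OF k] by metis
    define N where "N = (\<lambda>j. fact j / (\<rho> / 4) ^ j * M)"
    have N0: "N j \<ge> 0" for j using \<rho> M by (simp add: N_def)
    have cb: "cmod (c j t m) \<le> N j * exp (- \<epsilon> * \<bar>real_of_int m\<bar>)" if "\<bar>t - k\<bar> < \<rho> / 2" for j t m
      using higher_deriv_bound[OF hol bd \<rho>, of "of_real t" j m] that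
      by (simp add: c_def N_def dist_norm abs_minus_commute mult.assoc flip: of_real_diff)
    have k0: "\<bar>k - k\<bar> < \<rho> / 2" using \<rho> by simp
    define S where "S = sqrt (L * (\<Sum>\<^sub>\<infinity>m. (1 + (real_of_int m)\<^sup>2) ^ n * exp (- (2 * \<epsilon>) * \<bar>real_of_int m\<bar>)))"
    have "((\<lambda>t. H_per_norm n L (\<lambda>x. (D j t x - D j k x) / (t - k) - D (Suc j) k x)) \<longlongrightarrow> 0) (at k within I)"
    proof (rule Lim_null_comparison)
      show "((\<lambda>t. N (j + 2) * \<bar>t - k\<bar> * S) \<longlongrightarrow> 0) (at k within I)"
        by (rule tendsto_eq_intros refl)+ auto
      have "\<forall>\<^sub>F t in at k within I. t \<noteq> k \<and> \<bar>t - k\<bar> < \<rho> / 2"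
        unfolding eventually_at using \<rho> by (intro exI[of _ "\<rho> / 2"]) (auto simp: dist_norm)
      then show "\<forall>\<^sub>F t in at k within I. norm (H_per_norm n L (\<lambda>x. (D j t x - D j k x) / (t - k) - D (Suc j) k x)) \<le> N (j + 2) * \<bar>t - k\<bar> * S"
      proof eventually_elim
        case (elim t)
        \<comment> \<open>The coefficients of the difference quotient minus the derivative, nested
          with factors 1 and -1 so that \<open>trig_series_lincomb\<close> applies twice.\<close>
        define b where "b = (\<lambda>m. 1 * (1 / (complex_of_real t - of_real k) * c j t m + (- 1 / (of_real t - of_real k)) * c j k m) + (- 1) * c (Suc j) k m)"
        have b_eq: "b m = ((deriv ^^ j) (C m) (of_real t) - (deriv ^^ j) (C m) (of_real k)) / (of_real t - of_real k) - (deriv ^^ Suc j) (C m) (of_real k)" for m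
          by (simp add: b_def c_def diff_divide_distrib)
        note sm = summable_comparison_exp(1)[OF \<epsilon> cb]
        have s1: "(\<lambda>m. norm (1 / (complex_of_real t - of_real k) * c j t m + (- 1 / (of_real t - of_real k)) * c j k m)) summable_on UNIV"
        proof (rule summable_on_comparison_test)
          show "(\<lambda>m. norm (1 / (complex_of_real t - of_real k)) * norm (c j t m) + norm (- 1 / (complex_of_real t - of_real k)) * norm (c j k m)) summable_on UNIV"
            using elim k0 by (intro summable_on_add summable_on_cmult_right sm) auto
          show "norm (1 / (complex_of_real t - of_real k) * c j t m + (- 1 / (of_real t - of_real k)) * c j k m)
            \<le> norm (1 / (complex_of_real t - of_real k)) * norm (c j t m) + norm (- 1 / (complex_of_real t - of_real k)) * norm (c j k m)" for m
            using norm_triangle_ineq by (simp only: norm_mult[symmetric])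
        qed auto
        have "trig_series L b x = (D j t x - D j k x) / (t - k) - D (Suc j) k x" for x
          unfolding b_def using elim k0
          by (subst trig_series_lincomb[OF s1 sm], simp, subst trig_series_lincomb[OF sm sm])
             (simp_all add: D_def diff_divide_distrib)
        then have eq: "(\<lambda>x. (D j t x - D j k x) / (t - k) - D (Suc j) k x) = trig_series L b" by (simp add: fun_eq_iff)
        have "H_per_norm n L (trig_series L b) \<le> (N (j + 2) * \<bar>t - k\<bar>) * S"
          unfolding S_def
        proof (rule H_per_norm_trig_series_le[OF L \<epsilon>])
          fix m
          have "cmod (b m) \<le> fact (j + 2) / (\<rho> / 4) ^ (j + 2) * (M * exp (- \<epsilon> * \<bar>real_of_int m\<bar>)) * cmod (complex_of_real t - of_real k)"
            unfolding b_eq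
            by (rule higher_deriv_difference_quotient[OF hol bd \<rho>])
               (use elim in \<open>auto simp: dist_norm abs_minus_commute simp flip: of_real_diff\<close>)
          also have "cmod (complex_of_real t - of_real k) = \<bar>t - k\<bar>" by (simp flip: of_real_diff)
          finally show "cmod (b m) \<le> N (j + 2) * \<bar>t - k\<bar> * exp (- \<epsilon> * \<bar>real_of_int m\<bar>)"
            by (simp only: N_def mult_ac)
        qed (use N0 in simp)
        moreover have "H_per_norm n L (trig_series L b) \<ge> 0"
          unfolding H_per_norm_def using L by (intro real_sqrt_ge_zero mult_nonneg_nonneg infsum_nonneg) auto
        ultimately show ?case unfolding eq by simp
      qed
    qed
    moreover have "D j k \<in> H_per n L \<inter> H_0 L"
      unfolding D_def by (rule trig_series_H_per[OF L \<epsilon> cb[OF k0] c0])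
    ultimately show ?thesis by blast
  qed
  have "D 0 k = f k" if "k \<in> I" for k using f[OF that] by (simp add: D_def c_def)
  then show ?thesis unfolding smooth_curve_def using main by blast
qed

section \<open>Analytic dependence on the modulus\<close>

text \<open>The argument is the parameter \<open>k\<^sup>2\<close>, not the modulus.\<close>

definition ellip_K_cx :: "complex \<Rightarrow> complex" where
  "ellip_K_cx w = integral {0..pi/2} (\<lambda>t. 1 / csqrt (1 - w * (complex_of_real (sin t))\<^sup>2))"

text \<open>Keeps the radicand in the right half-plane, away from the branch cut of
  \<open>csqrt\<close>. The region Re w < 1 contains both z^2 and 1 - z^2 for z near a real modulus
  in (0, 1).\<close>

lemma ellip_K_cx_arg:
  assumes "Re w < 1"
  shows "0 < Re (1 - w * (complex_of_real (sin t))\<^sup>2)"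
proof -
  have "Re w * (sin t)\<^sup>2 < 1"
  proof (cases "Re w \<le> 0")
    case True
    then have "Re w * (sin t)\<^sup>2 \<le> 0" by (simp add: mult_nonpos_nonneg)
    then show ?thesis by linarith
  next
    case False
    then have "Re w * (sin t)\<^sup>2 \<le> Re w * 1" by (intro mult_left_mono) (auto simp: abs_square_le_1)
    then show ?thesis using assms by linarith
  qed
  then show ?thesis by (simp flip: of_real_power)
qed

lemma ellip_K_cx_holomorphic: "ellip_K_cx holomorphic_on {w. Re w < 1}"
proof -
  let ?U = "{w. Re w < 1}"
  let ?q = "\<lambda>w t. 1 - w * (complex_of_real (sin t))\<^sup>2"
  have arg: "?q w t \<notin> \<real>\<^sub>\<le>\<^sub>0" if "w \<in> ?U" for w t
    using ellip_K_cx_arg[of w t] that complex_nonpos_Reals_iff[of "?q w t"] by auto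
  have nz: "?q w t \<noteq> 0" if "w \<in> ?U" for w t
    using ellip_K_cx_arg[of w t] that by (metis less_irrefl mem_Collect_eq zero_complex.simps(1))
  have ccs: "continuous_on (?U \<times> S) (\<lambda>(w, t). csqrt (?q w t))" for S
  proof -
    have "continuous_on {z. 0 < Re z} csqrt"
      by (intro continuous_at_imp_continuous_on ballI continuous_at_csqrt) (auto simp: complex_nonpos_Reals_iff)
    then show ?thesis
      unfolding split_beta
      by (rule continuous_on_compose2) (use ellip_K_cx_arg in \<open>auto intro!: continuous_intros\<close>)
  qed
  have "(\<lambda>w. integral (cbox 0 (pi/2)) (\<lambda>t. 1 / csqrt (?q w t))) holomorphic_on ?U"
  proof (rule leibniz_rule_holomorphic)
    fix w t assume w: "w \<in> ?U"
    show "((\<lambda>w. 1 / csqrt (?q w t)) has_field_derivative (complex_of_real (sin t))\<^sup>2 / (2 * csqrt (?q w t)) / (csqrt (?q w t) * csqrt (?q w t))) (at w within ?U)"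
      by (rule derivative_eq_intros arg[OF w] refl)+ (use nz[OF w] in auto)
  next
    fix w assume w: "w \<in> ?U"
    have "continuous_on (cbox 0 (pi/2)) (\<lambda>t. csqrt (?q w t))"
      by (rule continuous_on_compose2[OF ccs[of UNIV, unfolded split_beta], of _ "\<lambda>t. (w, t)", simplified])
         (use w in \<open>auto intro!: continuous_intros\<close>)
    then show "(\<lambda>t. 1 / csqrt (?q w t)) integrable_on cbox 0 (pi/2)"
      by (intro integrable_continuous continuous_intros) (use nz[OF w] in auto)
  next
    show "continuous_on (?U \<times> cbox 0 (pi/2)) (\<lambda>(w, t). (complex_of_real (sin t))\<^sup>2 / (2 * csqrt (?q w t)) / (csqrt (?q w t) * csqrt (?q w t)))"
      using ccs[of "cbox 0 (pi/2)"] nz unfolding split_beta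
      by (intro continuous_intros) auto
    show "convex ?U" by (rule convex_halfspace_Re_lt)
  qed
  then show ?thesis by (simp add: ellip_K_cx_def[abs_def] cbox_interval)
qed

lemma ellip_K_cx_of_real:
  assumes "0 < k" "k < 1"
  shows "ellip_K_cx (of_real (k\<^sup>2)) = of_real (ellip_K k)"
proof -
  note c = cont_inv_Delta[OF assms, of "{0..pi/2}"]
  have "ellip_K k = integral {0..pi/2} (\<lambda>t. 1 / sqrt (1 - k\<^sup>2 * (sin t)\<^sup>2))"
    unfolding ellip_K_def zero_ereal_def
    by (rule interval_integral_eq_integral[OF _ borel_integrable_atLeastAtMost'[OF c]]) simp
  moreover have "complex_of_real (integral {0..pi/2} (\<lambda>t. 1 / sqrt (1 - k\<^sup>2 * (sin t)\<^sup>2))) =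
      integral {0..pi/2} (\<lambda>t. complex_of_real (1 / sqrt (1 - k\<^sup>2 * (sin t)\<^sup>2)))"
    using integral_linear[OF integrable_continuous_real[OF c] bounded_linear_of_real[where 'a = complex]]
    unfolding o_def by (rule sym)
  moreover have "complex_of_real (1 / sqrt (1 - k\<^sup>2 * (sin t)\<^sup>2)) = 1 / csqrt (1 - of_real (k\<^sup>2) * (sin t)\<^sup>2)" for t
  proof -
    have "csqrt (1 - of_real (k\<^sup>2) * (sin t)\<^sup>2) = csqrt (of_real (1 - k\<^sup>2 * (sin t)\<^sup>2))" by simp
    also have "\<dots> = of_real (sqrt (1 - k\<^sup>2 * (sin t)\<^sup>2))"
      using Delta_sq_pos[OF assms, of t] csqrt_of_real_nonneg[of "of_real (1 - k\<^sup>2 * (sin t)\<^sup>2)"] by simp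
    finally show ?thesis by simp
  qed
  ultimately show ?thesis unfolding ellip_K_cx_def by simp
qed

text \<open>Minus the logarithm of the nome. The parameter 1 - z^2 avoids a square root for the
  complementary modulus.\<close>

definition period_ratio_cx :: "complex \<Rightarrow> complex" where
  "period_ratio_cx z = pi * ellip_K_cx (1 - z\<^sup>2) / ellip_K_cx (z\<^sup>2)"

definition period_ratio :: "real \<Rightarrow> real" where
  "period_ratio k = pi * ellip_K (comp_modulus k) / ellip_K k"

lemma period_ratio_cx_of_real:
  assumes "0 < k" "k < 1"
  shows "period_ratio_cx (of_real k) = of_real (period_ratio k)"
  using ellip_K_cx_of_real[OF assms] ellip_K_cx_of_real[OF comp_modulus_bounds(1,2)[OF assms]]
  by (simp add: period_ratio_cx_def period_ratio_def comp_modulus_bounds(3)[OF assms])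

section \<open>Decay of the Fourier coefficients\<close>

lemma norm_sinh_ge: "sinh \<bar>Re z\<bar> \<le> cmod (sinh z)"
proof -
  have "2 * sinh \<bar>Re z\<bar> = \<bar>exp (Re z) - exp (- Re z)\<bar>"
    by (cases "Re z \<ge> 0") (auto simp: sinh_field_def abs_if)
  also have "\<dots> \<le> cmod (exp z - exp (- z))"
    using norm_triangle_ineq3[of "exp z" "exp (- z)"] by (simp add: norm_exp_eq_Re)
  also have "\<dots> = 2 * cmod (sinh z)" by (simp add: sinh_field_def norm_divide)
  finally show ?thesis by simp
qed

lemma exp_bound_sinh:
  fixes r x :: real
  assumes "0 < r" "r \<le> x"
  shows "exp x * ((1 - exp (- 2 * r)) / 2) \<le> sinh x"
proof -
  have "exp (- x) = exp x * exp (- 2 * x)" by (simp flip: exp_add)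
  then have "sinh x = exp x * ((1 - exp (- 2 * x)) / 2)" by (simp add: sinh_field_def algebra_simps)
  moreover have "exp (- 2 * x) \<le> exp (- 2 * r)" using assms by simp
  ultimately show ?thesis by (simp add: mult_left_mono)
qed

text \<open>The numerator grows at most like exp(a|m|), the denominator at least like exp(r|m|),
  uniformly for Re w >= r; for a < r the difference r - a is a decay rate.\<close>

lemma sinh_quotient_bound:
  fixes a r :: real and w :: complex and m :: int
  assumes a: "0 \<le> a" and r: "0 < r" and w: "r \<le> Re w" and m: "m \<noteq> 0"
  shows "cmod (sinh (of_int m * w)) \<ge> exp (r * \<bar>real_of_int m\<bar>) * ((1 - exp (- 2 * r)) / 2)"
    "cmod (of_real (sinh (m * a)) / sinh (of_int m * w)) \<le> 1 / (1 - exp (- 2 * r)) * exp (- (r - a) * \<bar>real_of_int m\<bar>)"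
proof -
  have m1: "1 \<le> \<bar>real_of_int m\<bar>" using m by linarith
  have "r * 1 \<le> r * \<bar>real_of_int m\<bar>" using m1 r by (intro mult_left_mono) auto
  then have "exp (r * \<bar>real_of_int m\<bar>) * ((1 - exp (- 2 * r)) / 2) \<le> sinh (r * \<bar>real_of_int m\<bar>)"
    using r by (intro exp_bound_sinh) auto
  also have "\<dots> \<le> sinh \<bar>Re (of_int m * w)\<bar>"
    using r w m1 by (auto simp: abs_mult mult.commute intro!: mult_right_mono)
  also have "\<dots> \<le> cmod (sinh (of_int m * w))" by (rule norm_sinh_ge)
  finally show 1: "cmod (sinh (of_int m * w)) \<ge> exp (r * \<bar>real_of_int m\<bar>) * ((1 - exp (- 2 * r)) / 2)" .
  have "\<bar>sinh (m * a)\<bar> = sinh (\<bar>real_of_int m\<bar> * a)"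
    using a by (simp add: abs_mult flip: sinh_real_abs)
  also have "\<dots> \<le> exp (\<bar>real_of_int m\<bar> * a) / 2"
    by (simp add: sinh_field_def)
  finally have 2: "\<bar>sinh (m * a)\<bar> \<le> exp (\<bar>real_of_int m\<bar> * a) / 2" .
  have pos: "0 < (1 - exp (- 2 * r)) / 2" using r by simp
  have "cmod (of_real (sinh (m * a)) / sinh (of_int m * w)) = \<bar>sinh (m * a)\<bar> / cmod (sinh (of_int m * w))"
    by (simp add: norm_divide)
  also have "\<dots> \<le> (exp (\<bar>real_of_int m\<bar> * a) / 2) / (exp (r * \<bar>real_of_int m\<bar>) * ((1 - exp (- 2 * r)) / 2))"
    using pos by (intro frac_le 1 2) auto
  also have "\<dots> = 1 / (1 - exp (- 2 * r)) * (exp (\<bar>real_of_int m\<bar> * a) / exp (r * \<bar>real_of_int m\<bar>))" by simp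
  also have "exp (\<bar>real_of_int m\<bar> * a) / exp (r * \<bar>real_of_int m\<bar>) = exp (- (r - a) * \<bar>real_of_int m\<bar>)"
    by (simp add: algebra_simps flip: exp_diff)
  finally show "cmod (of_real (sinh (m * a)) / sinh (of_int m * w)) \<le> 1 / (1 - exp (- 2 * r)) * exp (- (r - a) * \<bar>real_of_int m\<bar>)" .
qed

text \<open>The ratio is taken at a complex modulus so that each coefficient extends off the real
  interval. For m = 0 the quotient is 0 / 0 = 0, the mean value of the wave.\<close>

definition wave_coeff :: "real \<Rightarrow> real \<Rightarrow> int \<Rightarrow> complex \<Rightarrow> complex" where
  "wave_coeff L \<delta> m z = 2 * pi / L * (of_real (sinh (m * (2 * pi * \<delta> / L))) / sinh (of_int m * period_ratio_cx z))"

lemma wave_coeff_local_bound: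
  assumes L: "L > 0" and \<delta>: "\<delta> > 0" and k: "0 < k" "k < 1" and r: "2 * pi * \<delta> / L < period_ratio k"
  shows "\<exists>\<rho>>0. \<exists>\<epsilon>>0. \<exists>M\<ge>0. \<forall>m. wave_coeff L \<delta> m holomorphic_on ball (of_real k) \<rho> \<and>
       (\<forall>z\<in>ball (of_real k) \<rho>. cmod (wave_coeff L \<delta> m z) \<le> M * exp (- \<epsilon> * \<bar>real_of_int m\<bar>))"
proof -
  define a where "a = 2 * pi * \<delta> / L"
  have a: "a > 0" using L \<delta> by (simp add: a_def)
  \<comment> \<open>The midpoint leaves a gap on both sides: the real part of the ratio stays above
    \<open>r1\<close> near k, and \<open>r1 - a\<close> is the decay rate.\<close>
  define r1 where "r1 = (a + period_ratio k) / 2"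
  have r1: "a < r1" "r1 < period_ratio k" using r by (simp_all add: r1_def a_def)
  \<comment> \<open>On \<open>U\<close> both integrals are holomorphic, \<open>V\<close> excludes
    zeros of the denominator, and \<open>W\<close> keeps the ratio above \<open>r1\<close>. None of
    them depends on m, so one ball serves all coefficients.\<close>
  define U where "U = {z :: complex. Re (z\<^sup>2) < 1} \<inter> {z. Re (1 - z\<^sup>2) < 1}"
  have oU: "open U" unfolding U_def by (intro open_Int open_Collect_less continuous_intros)
  have comp: "(\<lambda>z. ellip_K_cx (h z)) holomorphic_on U" if "h holomorphic_on U" "\<And>z. z \<in> U \<Longrightarrow> Re (h z) < 1" for h
    using holomorphic_on_compose_gen[OF that(1) ellip_K_cx_holomorphic] that(2) by (auto simp: o_def)
  have hK: "(\<lambda>z. ellip_K_cx (z\<^sup>2)) holomorphic_on U" "(\<lambda>z. ellip_K_cx (1 - z\<^sup>2)) holomorphic_on U"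
    by (rule comp; auto simp: U_def intro!: holomorphic_intros)+
  define V where "V = {z \<in> U. ellip_K_cx (z\<^sup>2) \<noteq> 0}"
  have "V = U \<inter> (\<lambda>z. ellip_K_cx (z\<^sup>2)) -` (- {0})" by (auto simp: V_def)
  then have oV: "open V"
    using continuous_open_preimage[OF holomorphic_on_imp_continuous_on[OF hK(1)] oU open_Compl[OF closed_singleton]] by simp
  have VU: "V \<subseteq> U" by (auto simp: V_def)
  have hr: "period_ratio_cx holomorphic_on V"
    unfolding period_ratio_cx_def[abs_def]
    by (intro holomorphic_intros holomorphic_on_subset[OF hK(1) VU] holomorphic_on_subset[OF hK(2) VU]) (auto simp: V_def)
  define W where "W = {z \<in> V. Re (period_ratio_cx z) > r1}"
  have "continuous_on V (\<lambda>z. Re (period_ratio_cx z))"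
    by (intro continuous_intros holomorphic_on_imp_continuous_on hr)
  from continuous_open_preimage[OF this oV open_greaterThan[of r1]]
  have "open (V \<inter> (\<lambda>z. Re (period_ratio_cx z)) -` {r1<..})" .
  moreover have "V \<inter> (\<lambda>z. Re (period_ratio_cx z)) -` {r1<..} = W" by (auto simp: W_def)
  ultimately have oW: "open W" by simp
  have "of_real k \<in> W"
  proof -
    have "k\<^sup>2 < 1" "0 < k\<^sup>2" using k by (simp_all add: power_less_one_iff)
    then have "of_real k \<in> U" by (simp add: U_def flip: of_real_power)
    moreover have "ellip_K_cx ((of_real k)\<^sup>2) \<noteq> 0"
      using ellip_K_cx_of_real[OF k] ellip_K_pos[OF k] by simp
    ultimately show ?thesis using r1 period_ratio_cx_of_real[OF k] by (simp add: W_def V_def)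
  qed
  then obtain \<rho> where \<rho>: "\<rho> > 0" "ball (of_real k) \<rho> \<subseteq> W"
    using oW open_contains_ball by blast
  define M where "M = 2 * pi / L * (1 / (1 - exp (- 2 * r1)))"
  have r1p: "r1 > 0" using a r1 by simp
  have M: "M \<ge> 0" using L r1p by (simp add: M_def)
  have "wave_coeff L \<delta> m holomorphic_on ball (of_real k) \<rho> \<and>
       (\<forall>z\<in>ball (of_real k) \<rho>. cmod (wave_coeff L \<delta> m z) \<le> M * exp (- (r1 - a) * \<bar>real_of_int m\<bar>))" for m
  proof (cases "m = 0")
    case True
    then show ?thesis using M by (simp add: wave_coeff_def[abs_def])
  next
    case False
    have b: "r1 \<le> Re (period_ratio_cx z)" if "z \<in> ball (of_real k) \<rho>" for z
      using that \<rho>(2) by (force simp: W_def)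
    have nz: "sinh (of_int m * period_ratio_cx z) \<noteq> 0" if "z \<in> ball (of_real k) \<rho>" for z
    proof -
      have "0 < exp (r1 * \<bar>real_of_int m\<bar>) * ((1 - exp (- 2 * r1)) / 2)" using r1p by simp
      also have "\<dots> \<le> cmod (sinh (of_int m * period_ratio_cx z))"
        using sinh_quotient_bound(1)[OF less_imp_le[OF a] r1p b[OF that] False] .
      finally show ?thesis by auto
    qed
    have "period_ratio_cx holomorphic_on ball (of_real k) \<rho>"
      using holomorphic_on_subset[OF hr] \<rho>(2) by (auto simp: W_def)
    then have "wave_coeff L \<delta> m holomorphic_on ball (of_real k) \<rho>"
      unfolding wave_coeff_def[abs_def] using nz L
      by (auto intro!: holomorphic_intros simp: sinh_field_def)
    moreover have "cmod (wave_coeff L \<delta> m z) \<le> M * exp (- (r1 - a) * \<bar>real_of_int m\<bar>)" if z: "z \<in> ball (of_real k) \<rho>" for z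
    proof -
      have "cmod (wave_coeff L \<delta> m z) = 2 * pi / L * cmod (of_real (sinh (m * a)) / sinh (of_int m * period_ratio_cx z))"
        using L by (simp add: wave_coeff_def a_def norm_mult norm_divide)
      also have "\<dots> \<le> 2 * pi / L * (1 / (1 - exp (- 2 * r1)) * exp (- (r1 - a) * \<bar>real_of_int m\<bar>))"
        using L sinh_quotient_bound(2)[OF less_imp_le[OF a] r1p b[OF z] False]
        by (intro mult_left_mono) auto
      finally show ?thesis by (simp only: M_def mult.assoc)
    qed
    ultimately show ?thesis by blast
  qed
  then show ?thesis using \<rho>(1) M r1(1) by (intro exI[of _ \<rho>] exI[of _ "r1 - a"] exI[of _ M] conjI) auto
qed

section \<open>Bounds for K and K' at small modulus\<close>

lemma ellip_K_le_pi:
  assumes "0 < k" "k < 1 / 2"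
  shows "ellip_K k \<le> pi"
proof -
  have k1: "k < 1" using assms by simp
  \<comment> \<open>For k < 1/2 the radicand is at least 3/4, hence at least (1/2)^2.\<close>
  have "1 / sqrt (1 - k\<^sup>2 * (sin t)\<^sup>2) \<le> 2" for t
  proof -
    have "k\<^sup>2 \<le> (1/2)\<^sup>2" using assms by (intro power_mono) auto
    moreover have "k\<^sup>2 * (sin t)\<^sup>2 \<le> k\<^sup>2 * 1" by (intro mult_left_mono) (auto simp: abs_square_le_1)
    ultimately have "(1/2)\<^sup>2 \<le> 1 - k\<^sup>2 * (sin t)\<^sup>2" by (simp add: power2_eq_square)
    then have "1 / 2 \<le> sqrt (1 - k\<^sup>2 * (sin t)\<^sup>2)" by (rule real_le_rsqrt)
    moreover from this have "0 < sqrt (1 - k\<^sup>2 * (sin t)\<^sup>2)" by linarith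
    ultimately show ?thesis by (simp only: pos_divide_le_eq)
  qed
  then have "ellip_F k 0 - 2 * 0 \<ge> ellip_F k (pi/2) - 2 * (pi/2)"
    by (intro DERIV_nonpos_imp_nonincreasing[of 0 "pi/2" "\<lambda>x. ellip_F k x - 2 * x"])
       (auto intro!: exI derivative_eq_intros ellip_F_deriv[OF assms(1) k1])
  then show ?thesis by (simp add: ellip_F_half_pi)
qed

text \<open>The radicand is cos^2 x + k^2 sin^2 x <= (cos x + k sin x)^2 <= (pi/2 - x + k)^2. Hence
  K' is at least the integral of 1 / (pi/2 - x + k) over [0, pi/2], which is ln ((pi/2 + k) / k).
  This logarithmic growth supplies the threshold for k.\<close>

lemma ellip_K_comp_ge:
  assumes k: "0 < k" "k < 1"
  shows "- ln k \<le> ellip_K (comp_modulus k)"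
proof -
  note k' = comp_modulus_bounds[OF k]
  let ?G = "\<lambda>x. ellip_F (comp_modulus k) x + ln (pi/2 - x + k)"
  have "?G 0 \<le> ?G (pi/2)"
  proof (rule DERIV_nonneg_imp_nondecreasing[of 0 "pi/2" ?G])
    fix x :: real assume x: "0 \<le> x" "x \<le> pi/2"
    have p: "pi/2 - x + k > 0" using x k by simp
    have D: "(?G has_real_derivative 1 / sqrt (1 - (comp_modulus k)\<^sup>2 * (sin x)\<^sup>2) - 1 / (pi/2 - x + k)) (at x)"
      using p by (auto intro!: derivative_eq_intros ellip_F_deriv[OF k'(1,2)])
    have s0: "0 \<le> sin x" "0 \<le> cos x" using x by (auto intro: sin_ge_zero cos_ge_zero)
    have "cos x \<le> pi/2 - x" using sin_x_le_x[of "pi/2 - x"] x by (simp add: sin_diff)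
    moreover have "k * sin x \<le> k * 1" using k by (intro mult_left_mono) auto
    ultimately have le: "cos x + k * sin x \<le> pi/2 - x + k" by simp
    have "1 - (comp_modulus k)\<^sup>2 * (sin x)\<^sup>2 = (cos x)\<^sup>2 + (k * sin x)\<^sup>2"
      unfolding k'(3) cos_squared_eq by algebra
    also have "\<dots> \<le> (cos x + k * sin x)\<^sup>2" using s0 k by (simp add: power2_sum)
    also have "\<dots> \<le> (pi/2 - x + k)\<^sup>2" using le s0 k by (intro power_mono) auto
    finally have "sqrt (1 - (comp_modulus k)\<^sup>2 * (sin x)\<^sup>2) \<le> pi/2 - x + k"
      using p by (intro real_le_lsqrt) auto
    then have "1 / (pi/2 - x + k) \<le> 1 / sqrt (1 - (comp_modulus k)\<^sup>2 * (sin x)\<^sup>2)"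
      using Delta_sq_pos[OF k'(1,2), of x] p by (intro divide_left_mono mult_pos_pos) auto
    with D show "\<exists>y. (?G has_real_derivative y) (at x) \<and> 0 \<le> y" by auto
  qed simp
  then have "ln (pi/2 + k) - ln k \<le> ellip_K (comp_modulus k)" by (simp add: ellip_F_half_pi)
  moreover have "0 \<le> ln (pi/2 + k)" using pi_gt3 k by (intro ln_ge_zero) auto
  ultimately show ?thesis by linarith
qed

section \<open>The wave\<close>

context
  fixes L \<delta> k :: real
  assumes L: "L > 0" and \<delta>: "\<delta> > 0" and k: "0 < k" "k < 1" and r: "2 * pi * \<delta> / L < period_ratio k"
begin

private definition b where "b = 2 * ellip_K k / L * \<delta>"

text \<open>Assumption \<open>r\<close> is 2 \<delta> K / (L K') < 1 multiplied by pi K' / K; it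
  places the line at height \<open>b\<close> inside the strip.\<close>

private lemma b_bounds: "0 < b" "b < ellip_K (comp_modulus k)" "\<bar>b\<bar> < ellip_K (comp_modulus k)"
proof -
  show "0 < b" using L \<delta> ellip_K_pos[OF k] by (simp add: b_def)
  have "2 * pi * \<delta> / L * ellip_K k < pi * ellip_K (comp_modulus k)"
    using r ellip_K_pos[OF k] by (simp add: period_ratio_def pos_less_divide_eq)
  then have "pi * b < pi * ellip_K (comp_modulus k)" by (simp add: b_def mult_ac)
  then show "b < ellip_K (comp_modulus k)" by simp
  with \<open>0 < b\<close> show "\<bar>b\<bar> < ellip_K (comp_modulus k)" by simp
qed

lemma wave_eq: "wave L \<delta> k x = of_real (4 * ellip_K k / L * zeta_im k (2 * ellip_K k / L * x) b)"
proof -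
  define z where "z = Complex (2 * ellip_K k / L * x) b"
  have z: "of_real (2 * ellip_K k / L) * (of_real x + \<i> * of_real \<delta>) = z"
    "of_real (2 * ellip_K k / L) * (of_real x - \<i> * of_real \<delta>) = cnj z"
    by (simp_all add: z_def b_def complex_eq_iff)
  have "z \<in> zeta_strip k" "cnj z \<in> zeta_strip k"
    using b_bounds by (simp_all add: zeta_strip_def z_def)
  then have "wave L \<delta> k x = 2 * ellip_K k * \<i> / L * (cnj (zeta_cx k z) - zeta_cx k z)"
    unfolding wave_def z by (simp add: jacobi_zeta_ext_eq[OF k] zeta_cx_cnj[OF k])
  also have "cnj (zeta_cx k z) - zeta_cx k z = - 2 * \<i> * of_real (zeta_im k (2 * ellip_K k / L * x) b)"
    by (simp add: complex_eq_iff zeta_cx_def z_def)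
  finally show ?thesis by simp
qed

private lemma continuous_zeta_im: "continuous_on S (\<lambda>u. complex_of_real (zeta_im k u b))"
  "continuous_on S (\<lambda>u. complex_of_real (zeta_R k u b))"
proof -
  have "continuous_on S (\<lambda>u. Im (zeta_cx k (Complex u b)))" "continuous_on S (\<lambda>u. Re (zeta_cx' k (Complex u b)))"
    by (intro continuous_intros continuous_zeta_lines k b_bounds)+
  then show "continuous_on S (\<lambda>u. complex_of_real (zeta_im k u b))" "continuous_on S (\<lambda>u. complex_of_real (zeta_R k u b))"
    by (simp_all add: zeta_cx_def zeta_cx'_def continuous_on_of_real)
qed

private lemma rescale_shift: "2 * ellip_K k / L * (x + L) = 2 * ellip_K k / L * x + 2 * ellip_K k"
  using L by (simp add: field_simps)

lemma continuous_wave: "continuous_on S (wave L \<delta> k)"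
  unfolding wave_eq[abs_def] of_real_mult
  by (intro continuous_intros continuous_on_compose2[OF continuous_zeta_im(1)[of UNIV]]) (use L in auto)

lemma wave_periodic: "wave L \<delta> k (x + L) = wave L \<delta> k x"
  unfolding wave_eq rescale_shift zeta_shift[OF k] ..

private lemma sinh_of_real': "sinh (of_int m * complex_of_real x) = of_real (sinh (of_int m * x))"
  by (simp add: sinh_field_def flip: exp_of_real)

lemma fourier_coeff_wave: "fourier_coeff L (wave L \<delta> k) m = wave_coeff L \<delta> m (of_real k)"
proof -
  \<comment> \<open>A scalar multiple written as a combination of two terms, the form in which
    \<open>fourier_coeff_lincomb\<close> applies.\<close>
  define g where "g = (\<lambda>u. of_real (4 * ellip_K k / L) * complex_of_real (zeta_im k u b) + 0 * complex_of_real (zeta_im k u b))"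
  have K: "2 * ellip_K k > 0" using ellip_K_pos[OF k] by simp
  have cg: "continuous_on S g" for S unfolding g_def by (intro continuous_intros continuous_zeta_im)
  have "wave L \<delta> k = (\<lambda>x. g (2 * ellip_K k / L * x))" by (simp add: wave_eq g_def fun_eq_iff)
  then have "fourier_coeff L (wave L \<delta> k) m = fourier_coeff (2 * ellip_K k) g m"
    using fourier_coeff_scale[OF L K cg] by simp
  also have "\<dots> = of_real (4 * ellip_K k / L * (pi / (2 * ellip_K k) * (sinh (pi * m * b / ellip_K k) / sinh (pi * m * ellip_K (comp_modulus k) / ellip_K k))))"
    unfolding g_def fourier_coeff_lincomb[OF continuous_zeta_im(1) continuous_zeta_im(1)] fourier_coeff_zeta_im[OF k b_bounds(3)]
    by simp
  also have "4 * ellip_K k / L * (pi / (2 * ellip_K k) * (sinh (pi * m * b / ellip_K k) / sinh (pi * m * ellip_K (comp_modulus k) / ellip_K k)))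
     = 2 * pi / L * (sinh (m * (2 * pi * \<delta> / L)) / sinh (m * period_ratio k))"
  proof -
    have "pi * m * b / ellip_K k = m * (2 * pi * \<delta> / L)" using K by (simp add: b_def)
    moreover have "pi * m * ellip_K (comp_modulus k) / ellip_K k = m * period_ratio k" by (simp add: period_ratio_def)
    ultimately show ?thesis using K by simp
  qed
  finally show ?thesis
    by (simp add: wave_coeff_def period_ratio_cx_of_real[OF k] sinh_of_real')
qed

private lemma coeff_bound:
  obtains \<epsilon> M where "\<epsilon> > 0" "M \<ge> 0" "\<And>m. cmod (wave_coeff L \<delta> m (of_real k)) \<le> M * exp (- \<epsilon> * \<bar>real_of_int m\<bar>)"
  using wave_coeff_local_bound[OF L \<delta> k r] by (meson centre_in_ball)

lemma wave_eq_trig_series: "wave L \<delta> k = trig_series L (\<lambda>m. wave_coeff L \<delta> m (of_real k))"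
proof -
  obtain \<epsilon> M where e: "\<epsilon> > 0" and bd: "\<And>m. cmod (wave_coeff L \<delta> m (of_real k)) \<le> M * exp (- \<epsilon> * \<bar>real_of_int m\<bar>)"
    using coeff_bound by metis
  show ?thesis
    by (rule fourier_series_eq[OF L continuous_wave wave_periodic fourier_coeff_wave summable_comparison_exp(1)[OF e bd]])
qed

lemma wave_H_per: "wave L \<delta> k \<in> H_per n L \<inter> H_0 L"
proof -
  obtain \<epsilon> M where e: "\<epsilon> > 0" and bd: "\<And>m. cmod (wave_coeff L \<delta> m (of_real k)) \<le> M * exp (- \<epsilon> * \<bar>real_of_int m\<bar>)"
    using coeff_bound by metis
  show ?thesis unfolding wave_eq_trig_series
    by (rule trig_series_H_per[OF L e bd]) (simp add: wave_coeff_def)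
qed

text \<open>For m other than 0 the argument of coth has modulus at least \<open>a\<close>, so coth
  is bounded by 1/q and the symbol grows linearly. The weight 1 + m^2 is the one that
  \<open>summable_exp_decay\<close> handles.\<close>

lemma symbol_bound:
  obtains C where "\<And>m. \<bar>symbol L \<delta> m\<bar> \<le> C * (1 + (real_of_int m)\<^sup>2)"
proof
  define a where "a = 2 * pi * \<delta> / L"
  have a: "a > 0" using L \<delta> by (simp add: a_def)
  define q where "q = (1 - exp (- 2 * a)) / 2"
  have q: "q > 0" using a by (simp add: q_def)
  fix m :: int
  show "\<bar>symbol L \<delta> m\<bar> \<le> (2 * pi / L * (1 / q) + 1 / \<delta>) * (1 + (real_of_int m)\<^sup>2)"
  proof (cases "m = 0")
    case True
    then show ?thesis using L \<delta> q by (simp add: symbol_def)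
  next
    case False
    define y where "y = \<bar>real_of_int m\<bar> * a"
    have m1: "1 \<le> \<bar>real_of_int m\<bar>" using False by linarith
    then have "1 * a \<le> \<bar>real_of_int m\<bar> * a" using a by (intro mult_right_mono) auto
    then have s: "exp y * q \<le> sinh y" unfolding q_def y_def using a by (intro exp_bound_sinh) auto
    have ay: "\<bar>2 * pi * m * \<delta> / L\<bar> = y" using L \<delta> by (simp add: y_def a_def abs_mult)
    have "\<bar>cosh z / sinh z\<bar> = cosh \<bar>z\<bar> / sinh \<bar>z\<bar>" for z :: real by simp
    then have "\<bar>cosh (2 * pi * m * \<delta> / L) / sinh (2 * pi * m * \<delta> / L)\<bar> = cosh y / sinh y"
      unfolding ay[symmetric] .
    also have "\<dots> \<le> exp y / (exp y * q)"
    proof (rule frac_le)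
      have "exp (- y) \<le> exp y" using a by (simp add: y_def)
      then show "cosh y \<le> exp y" by (simp add: cosh_field_def)
    qed (use s q in auto)
    also have "\<dots> = 1 / q" by simp
    finally have ct: "\<bar>cosh (2 * pi * m * \<delta> / L) / sinh (2 * pi * m * \<delta> / L)\<bar> \<le> 1 / q" .
    have "\<bar>real_of_int m\<bar> * 1 \<le> \<bar>real_of_int m\<bar> * \<bar>real_of_int m\<bar>" using m1 by (intro mult_left_mono) auto
    then have m2: "\<bar>real_of_int m\<bar> \<le> 1 + (real_of_int m)\<^sup>2" by (simp add: power2_eq_square)
    have "\<bar>symbol L \<delta> m\<bar> \<le> \<bar>2 * pi * m / L * (cosh (2 * pi * m * \<delta> / L) / sinh (2 * pi * m * \<delta> / L))\<bar> + \<bar>1 / \<delta>\<bar>"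
      using False by (simp only: symbol_def if_False abs_triangle_ineq4)
    also have "\<bar>2 * pi * m / L * (cosh (2 * pi * m * \<delta> / L) / sinh (2 * pi * m * \<delta> / L))\<bar>
        = (2 * pi / L * \<bar>cosh (2 * pi * m * \<delta> / L) / sinh (2 * pi * m * \<delta> / L)\<bar>) * \<bar>real_of_int m\<bar>"
      using L by (simp add: abs_mult)
    also have "\<dots> \<le> (2 * pi / L * (1 / q)) * (1 + (real_of_int m)\<^sup>2)"
      using ct m2 L q by (intro mult_mono mult_left_mono) auto
    also have "\<bar>1 / \<delta>\<bar> \<le> 1 / \<delta> * (1 + (real_of_int m)\<^sup>2)"
      using mult_left_mono[of 1 "1 + (real_of_int m)\<^sup>2" "1 / \<delta>"] \<delta> by simp
    finally show ?thesis by (simp only: distrib_right add_left_mono add_right_mono)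
  qed
qed

text \<open>The candidate for the image of the wave under the operator. The factor 8 K^2 / L^2 is
  the amplitude 4K/L of the wave times 2K/L from rescaling the derivative.\<close>

private definition h where
  "h x = 1 * complex_of_real (8 * (ellip_K k)\<^sup>2 / L\<^sup>2 * zeta_R k (2 * ellip_K k / L * x) b) + (- 1 / \<delta>) * wave L \<delta> k x"

private lemma continuous_R: "continuous_on S (\<lambda>x. complex_of_real (8 * (ellip_K k)\<^sup>2 / L\<^sup>2 * zeta_R k (2 * ellip_K k / L * x) b))"
  unfolding of_real_mult
  by (intro continuous_intros continuous_on_compose2[OF continuous_zeta_im(2)[of UNIV]]) (use L in auto)

private lemma fourier_coeff_h: "fourier_coeff L h m = of_real (symbol L \<delta> m) * fourier_coeff L (wave L \<delta> k) m"
proof -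
  define g where "g = (\<lambda>u. of_real (8 * (ellip_K k)\<^sup>2 / L\<^sup>2) * complex_of_real (zeta_R k u b) + 0 * complex_of_real (zeta_R k u b))"
  have K: "2 * ellip_K k > 0" using ellip_K_pos[OF k] by simp
  have cg: "continuous_on S g" for S unfolding g_def by (intro continuous_intros continuous_zeta_im)
  have "(\<lambda>x. complex_of_real (8 * (ellip_K k)\<^sup>2 / L\<^sup>2 * zeta_R k (2 * ellip_K k / L * x) b)) = (\<lambda>x. g (2 * ellip_K k / L * x))"
    by (simp add: g_def fun_eq_iff)
  then have "fourier_coeff L (\<lambda>x. complex_of_real (8 * (ellip_K k)\<^sup>2 / L\<^sup>2 * zeta_R k (2 * ellip_K k / L * x) b)) m = fourier_coeff (2 * ellip_K k) g m"
    using fourier_coeff_scale[OF L K cg] by simp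
  also have "\<dots> = of_real (8 * (ellip_K k)\<^sup>2 / L\<^sup>2 * (pi / (2 * ellip_K k) * (pi * m / ellip_K k * cosh (pi * m * b / ellip_K k) / sinh (pi * m * ellip_K (comp_modulus k) / ellip_K k))))"
    unfolding g_def fourier_coeff_lincomb[OF continuous_zeta_im(2) continuous_zeta_im(2)] fourier_coeff_zeta_R[OF k b_bounds(3)]
    by simp
  also have "8 * (ellip_K k)\<^sup>2 / L\<^sup>2 * (pi / (2 * ellip_K k) * (pi * m / ellip_K k * cosh (pi * m * b / ellip_K k) / sinh (pi * m * ellip_K (comp_modulus k) / ellip_K k)))
     = 2 * pi * m / L * (2 * pi / L * (cosh (m * (2 * pi * \<delta> / L)) / sinh (m * period_ratio k)))"
  proof -
    have "pi * m * b / ellip_K k = m * (2 * pi * \<delta> / L)" using K by (simp add: b_def)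
    moreover have "pi * m * ellip_K (comp_modulus k) / ellip_K k = m * period_ratio k" by (simp add: period_ratio_def)
    ultimately show ?thesis using K by (simp add: power2_eq_square)
  qed
  finally have R: "fourier_coeff L (\<lambda>x. complex_of_real (8 * (ellip_K k)\<^sup>2 / L\<^sup>2 * zeta_R k (2 * ellip_K k / L * x) b)) m =
    of_real (2 * pi * m / L * (2 * pi / L * (cosh (m * (2 * pi * \<delta> / L)) / sinh (m * period_ratio k))))" .
  have W: "fourier_coeff L (wave L \<delta> k) m = of_real (2 * pi / L * (sinh (m * (2 * pi * \<delta> / L)) / sinh (m * period_ratio k)))"
    by (simp add: fourier_coeff_wave wave_coeff_def period_ratio_cx_of_real[OF k] sinh_of_real')
  have "fourier_coeff L h m = 1 * complex_of_real (2 * pi * m / L * (2 * pi / L * (cosh (m * (2 * pi * \<delta> / L)) / sinh (m * period_ratio k))))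
     + complex_of_real (- 1 / \<delta>) * complex_of_real (2 * pi / L * (sinh (m * (2 * pi * \<delta> / L)) / sinh (m * period_ratio k)))"
    unfolding h_def[abs_def] fourier_coeff_lincomb[OF continuous_R continuous_wave] R W ..
  also have "\<dots> = of_real (symbol L \<delta> m * (2 * pi / L * (sinh (m * (2 * pi * \<delta> / L)) / sinh (m * period_ratio k))))"
  proof (cases "m = 0")
    case False
    \<comment> \<open>With S the sinh at 2 pi m \<delta> / L this is coth times sinh = cosh. The
      mean m = 0, where S vanishes, is treated separately.\<close>
    have gen: "X * (B * (C / T)) + (- 1 / \<delta>) * (B * (S / T)) = (X * (C / S) - 1 / \<delta>) * (B * (S / T))"
      if "S \<noteq> 0" for X B C S T :: real
    proof -
      have "inverse S * S = 1" using that by simp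
      then show ?thesis unfolding divide_inverse by algebra
    qed
    from False have "sinh (m * (2 * pi * \<delta> / L)) \<noteq> 0" using L \<delta> by simp
    moreover have "2 * pi * m * \<delta> / L = m * (2 * pi * \<delta> / L)" by simp
    ultimately have "2 * pi * m / L * (2 * pi / L * (cosh (m * (2 * pi * \<delta> / L)) / sinh (m * period_ratio k)))
        + (- 1 / \<delta>) * (2 * pi / L * (sinh (m * (2 * pi * \<delta> / L)) / sinh (m * period_ratio k)))
      = symbol L \<delta> m * (2 * pi / L * (sinh (m * (2 * pi * \<delta> / L)) / sinh (m * period_ratio k)))"
      using False gen by (simp only: symbol_def if_False)
    from arg_cong[OF this, of complex_of_real] show ?thesis by (simp only: of_real_mult of_real_add mult_1_left)
  qed simp
  finally show ?thesis by (simp only: W of_real_mult)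
qed

text \<open>\<open>h\<close> is continuous and periodic, and its coefficients are those prescribed
  by the multiplier and absolutely summable; so it equals the series in \<open>M_op\<close> at every
  point.\<close>

lemma M_op_wave: "M_op L \<delta> (wave L \<delta> k) = h"
proof -
  obtain \<epsilon> M where e: "\<epsilon> > 0" and M: "M \<ge> 0" and bd: "\<And>m. cmod (wave_coeff L \<delta> m (of_real k)) \<le> M * exp (- \<epsilon> * \<bar>real_of_int m\<bar>)"
    using coeff_bound by metis
  obtain C where C: "\<And>m. \<bar>symbol L \<delta> m\<bar> \<le> C * (1 + (real_of_int m)\<^sup>2)" using symbol_bound by blast
  have "(\<lambda>m. norm (of_real (symbol L \<delta> m) * fourier_coeff L (wave L \<delta> k) m)) summable_on UNIV"
  proof (rule summable_on_comparison_test)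
    show "(\<lambda>m::int. (C * M) * ((1 + (real_of_int m)\<^sup>2) ^ 1 * exp (- \<epsilon> * \<bar>real_of_int m\<bar>))) summable_on UNIV"
      by (rule summable_on_cmult_right[OF summable_exp_decay[OF e]])
    show "norm (of_real (symbol L \<delta> m) * fourier_coeff L (wave L \<delta> k) m) \<le> (C * M) * ((1 + (real_of_int m)\<^sup>2) ^ 1 * exp (- \<epsilon> * \<bar>real_of_int m\<bar>))" for m
    proof -
      have "norm (of_real (symbol L \<delta> m) * fourier_coeff L (wave L \<delta> k) m) = \<bar>symbol L \<delta> m\<bar> * cmod (wave_coeff L \<delta> m (of_real k))"
        by (simp add: norm_mult fourier_coeff_wave)
      also have "\<dots> \<le> (C * (1 + (real_of_int m)\<^sup>2)) * (M * exp (- \<epsilon> * \<bar>real_of_int m\<bar>))"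
        using C[of m] by (intro mult_mono C bd) auto
      finally show ?thesis by (simp add: mult_ac)
    qed
  qed simp
  moreover have "h (x + L) = h x" for x
    unfolding h_def rescale_shift zeta_shift[OF k] wave_periodic ..
  moreover have "continuous_on UNIV h"
    unfolding h_def[abs_def] by (intro continuous_intros continuous_R continuous_wave)
  ultimately have "h = trig_series L (\<lambda>m. of_real (symbol L \<delta> m) * fourier_coeff L (wave L \<delta> k) m)"
    by (intro fourier_series_eq[OF L _ _ fourier_coeff_h])
  then show ?thesis by (simp only: M_op_def[abs_def] trig_series_def[abs_def])
qed

lemma wave_equation:
  "- wave_speed L \<delta> k * wave L \<delta> k x + (wave L \<delta> k x)\<^sup>2 - M_op L \<delta> (wave L \<delta> k) x
         = 1 / L * (LBINT y:{0..L}. (wave L \<delta> k y)\<^sup>2)"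
proof -
  note k' = comp_modulus_bounds[OF k]
  define K K' Y p q where "K = ellip_K k" and "K' = ellip_K (comp_modulus k)" and "Y = zeta_Y k b"
    and "p = zeta_p (comp_modulus k) b" and "q = zeta_p' (comp_modulus k) b / (2 * p)"
  have K: "K > 0" "K' > 0" using ellip_K_pos[OF k] ellip_K_pos[OF k'(1,2)] by (simp_all add: K_def K'_def)
  have "p > 0"
    unfolding p_def zeta_p_def using b_bounds
    by (intro mult_pos_pos jacobi_sn_pos jacobi_cn_pos jacobi_dn_pos k'(1,2)) auto
  \<comment> \<open>The argument in \<open>wave_speed\<close> is 2b, so duplication leads to values
    at \<open>b\<close>; the term with pi is absorbed by the linear part of
    \<open>zeta_Y\<close>.\<close>
  have speed: "wave_speed L \<delta> k = 1 / \<delta> - 4 * K / L * (2 * Y + q)"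
  proof -
    have u: "4 * \<delta> * ellip_K k / L = 2 * b" by (simp add: b_def)
    have "wave_speed L \<delta> k = 1 / \<delta> - 8 * pi * \<delta> * K / (L\<^sup>2 * K') - 4 * K / L * (jacobi_zeta (comp_modulus k) (2 * b)
        + jacobi_cn (comp_modulus k) (2 * b) * jacobi_dn (comp_modulus k) (2 * b) / jacobi_sn (comp_modulus k) (2 * b))"
      unfolding wave_speed_def Let_def u K_def K'_def by (simp add: distrib_left)
    also have "jacobi_zeta (comp_modulus k) (2 * b)
        + jacobi_cn (comp_modulus k) (2 * b) * jacobi_dn (comp_modulus k) (2 * b) / jacobi_sn (comp_modulus k) (2 * b)
      = 2 * jacobi_zeta (comp_modulus k) b + q"
      using \<open>p > 0\<close> unfolding q_def p_def by (intro jacobi_zeta_duplication k'(1,2)) auto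
    also have "jacobi_zeta (comp_modulus k) b = Y - pi * b / (2 * K * K')"
      by (simp add: Y_def zeta_Y_eq[OF k] K_def K'_def)
    also have "pi * b / (2 * K * K') = pi * \<delta> / (L * K')"
      using K by (simp add: b_def K_def)
    also have "8 * pi * \<delta> * K / (L\<^sup>2 * K') = 4 * K / L * (2 * (pi * \<delta> / (L * K')))"
      by (simp add: power2_eq_square mult_ac)
    finally show ?thesis by algebra
  qed
  \<comment> \<open>What remains of the left side after inserting the wave as a multiple of P - Y
    and R as a quadratic in P: the terms in P^2 cancel, and those in P cancel because of the factor
    2Y + q in the speed.\<close>
  define c0 where "c0 = 16 * K\<^sup>2 / L\<^sup>2 * (((jacobi_dn (comp_modulus k) b)\<^sup>2 - 1 + ellip_E k / ellip_K k) / 2 - Y\<^sup>2 - q * Y)"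
  have eq: "- wave_speed L \<delta> k * wave L \<delta> k x + (wave L \<delta> k x)\<^sup>2 - h x = of_real c0" for x
  proof -
    define P where "P = zeta_P k (2 * ellip_K k / L * x) b"
    define s where "s = 4 * K / L"
    have w: "wave L \<delta> k x = of_real (s * (P - Y))"
      by (simp add: wave_eq zeta_im_def P_def Y_def K_def s_def)
    have R: "zeta_R k (2 * ellip_K k / L * x) b = 2 * q * P + 2 * P\<^sup>2 - ((jacobi_dn (comp_modulus k) b)\<^sup>2 - 1 + ellip_E k / ellip_K k)"
      using \<open>p > 0\<close> by (simp add: zeta_R_def P_def zeta_P_def q_def p_def)
    have s2: "8 * (ellip_K k)\<^sup>2 / L\<^sup>2 = s\<^sup>2 / 2" "16 * K\<^sup>2 / L\<^sup>2 = s\<^sup>2"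
      by (simp_all add: s_def K_def power_divide power_mult_distrib)
    have "- (1 / \<delta> - s * (2 * Y + q)) * (s * (P - Y)) + (s * (P - Y))\<^sup>2
        - (1 * (s\<^sup>2 / 2 * (2 * q * P + 2 * P\<^sup>2 - ((jacobi_dn (comp_modulus k) b)\<^sup>2 - 1 + ellip_E k / ellip_K k))) + (- 1 / \<delta>) * (s * (P - Y)))
      = s\<^sup>2 * (((jacobi_dn (comp_modulus k) b)\<^sup>2 - 1 + ellip_E k / ellip_K k) / 2 - Y\<^sup>2 - q * Y)"
      by (simp add: algebra_simps power2_eq_square)
    from arg_cong[OF this, of complex_of_real] show ?thesis
      unfolding h_def w R s2 speed c0_def s_def[symmetric]
      by (simp only: of_real_mult of_real_add of_real_diff of_real_minus of_real_power of_real_divide of_real_1)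
  qed
  \<comment> \<open>Solved for the square in order to take mean values: the wave and
    \<open>h\<close> have mean 0, so \<open>c0\<close> is the mean of the square.\<close>
  have sq: "(\<lambda>x. (wave L \<delta> k x)\<^sup>2) = (\<lambda>x. 1 * (1 * of_real c0 + of_real (wave_speed L \<delta> k) * wave L \<delta> k x) + 1 * h x)"
    using eq by (simp add: fun_eq_iff algebra_simps)
  have ch: "continuous_on S h" for S
    unfolding h_def[abs_def] by (intro continuous_intros continuous_R continuous_wave)
  have "1 / L * (LBINT y:{0..L}. (wave L \<delta> k y)\<^sup>2) = fourier_coeff L (\<lambda>x. (wave L \<delta> k x)\<^sup>2) 0"
    by (subst fourier_coeff_0) (auto intro!: continuous_intros continuous_wave)
  also have "\<dots> = 1 * fourier_coeff L (\<lambda>x. 1 * of_real c0 + of_real (wave_speed L \<delta> k) * wave L \<delta> k x) 0 + 1 * fourier_coeff L h 0"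
    unfolding sq by (intro fourier_coeff_lincomb continuous_intros continuous_wave ch)
  also have "fourier_coeff L (\<lambda>x. 1 * of_real c0 + of_real (wave_speed L \<delta> k) * wave L \<delta> k x) 0 =
      1 * fourier_coeff L (\<lambda>x. of_real c0) 0 + of_real (wave_speed L \<delta> k) * fourier_coeff L (wave L \<delta> k) 0"
    by (intro fourier_coeff_lincomb continuous_intros continuous_wave)
  also have "fourier_coeff L (wave L \<delta> k) 0 = 0" by (simp add: fourier_coeff_wave wave_coeff_def)
  also have "fourier_coeff L h 0 = 0" by (simp add: fourier_coeff_h symbol_def)
  also have "fourier_coeff L (\<lambda>x. of_real c0) 0 = of_real c0" by (simp add: fourier_coeff_const[OF L])
  finally show ?thesis using eq[of x] by (simp add: M_op_wave)
qed

end

theorem theorem3p1: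
  fixes L \<delta> :: real
  assumes "L > 0" and "\<delta> > 0"
  shows "\<exists>k1. 0 < k1 \<and> k1 < 1 \<and>
    (\<forall>k\<in>{0<..<k1}. 2 * \<delta> / L * (ellip_K k / ellip_K (comp_modulus k)) < 1) \<and>
    (\<forall>k\<in>{0<..<k1}. \<forall>x. wave L \<delta> k x \<in> \<real>) \<and>
    (\<forall>n::nat. (\<forall>k\<in>{0<..<k1}. wave L \<delta> k \<in> H_per n L \<inter> H_0 L) \<and>
       smooth_curve n L {0<..<k1} (wave L \<delta>)) \<and>
    (\<forall>k\<in>{0<..<k1}. \<forall>x::real.
       - wave_speed L \<delta> k * wave L \<delta> k x + (wave L \<delta> k x)\<^sup>2 - M_op L \<delta> (wave L \<delta> k) x
         = 1 / L * (LBINT y:{0..L}. (wave L \<delta> k y)\<^sup>2))"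
proof -
  \<comment> \<open>The exponential makes -ln k, and with it K', exceed 2 pi \<delta> / L, while k <
    1/2 keeps 2 \<delta> K / L below that number or equal to it.\<close>
  define k1 where "k1 = min (1 / 2) (exp (- (2 * pi * \<delta> / L)))"
  have k1: "0 < k1" "k1 < 1" by (simp_all add: k1_def)
  \<comment> \<open>\<open>K \<le> \<pi>\<close> and \<open>K' \<ge> - ln k\<close> for small \<open>k\<close>\<close>
  have range: "0 < k \<and> k < 1 \<and> 2 * pi * \<delta> / L < period_ratio k \<and> 2 * \<delta> / L * (ellip_K k / ellip_K (comp_modulus k)) < 1"
    if "k \<in> {0<..<k1}" for k
  proof -
    have k: "0 < k" "k < 1 / 2" "k < exp (- (2 * pi * \<delta> / L))" using that by (auto simp: k1_def)
    then have k1': "k < 1" by simp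
    have K: "ellip_K k > 0" "ellip_K (comp_modulus k) > 0"
      using ellip_K_pos[OF k(1) k1'] ellip_K_pos[OF comp_modulus_bounds(1,2)[OF k(1) k1']] by auto
    have "ln k < - (2 * pi * \<delta> / L)" using k by (metis exp_gt_zero ln_exp ln_less_cancel_iff)
    then have "2 * pi * \<delta> / L < ellip_K (comp_modulus k)" using ellip_K_comp_ge[OF k(1) k1'] by linarith
    moreover have "2 * \<delta> / L * ellip_K k \<le> 2 * \<delta> / L * pi"
      using ellip_K_le_pi[OF k(1,2)] assms by (intro mult_left_mono) auto
    ultimately have *: "2 * \<delta> / L * ellip_K k < ellip_K (comp_modulus k)" by (simp add: mult_ac)
    then have "2 * \<delta> / L * (ellip_K k / ellip_K (comp_modulus k)) < 1"
      using K(2) by (simp only: times_divide_eq_right pos_divide_less_eq mult_1_left)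
    moreover have "pi * (2 * \<delta> / L * ellip_K k) < pi * ellip_K (comp_modulus k)" using * by (intro mult_strict_left_mono) auto
    then have "2 * pi * \<delta> / L < period_ratio k"
      using K(1) by (simp add: period_ratio_def pos_less_divide_eq mult_ac)
    ultimately show ?thesis using k(1) k1' by blast
  qed
  have real: "wave L \<delta> k x \<in> \<real>" if "k \<in> {0<..<k1}" for k x
    using wave_eq[OF assms] range[OF that] by simp
  have smooth: "smooth_curve n L {0<..<k1} (wave L \<delta>)" for n
  proof (rule smooth_curve_trig_series[OF assms(1), where C = "wave_coeff L \<delta>"])
    show "wave_coeff L \<delta> 0 = (\<lambda>_. 0)" by (simp add: wave_coeff_def fun_eq_iff)
    fix k assume "k \<in> {0<..<k1}"
    note k = range[OF this]
    show "\<exists>\<rho>>0. \<exists>\<epsilon>>0. \<exists>M\<ge>0. \<forall>m. wave_coeff L \<delta> m holomorphic_on ball (of_real k) \<rho> \<and>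
       (\<forall>z\<in>ball (of_real k) \<rho>. cmod (wave_coeff L \<delta> m z) \<le> M * exp (- \<epsilon> * \<bar>real_of_int m\<bar>))"
      using k by (intro wave_coeff_local_bound assms) auto
    show "wave L \<delta> k = trig_series L (\<lambda>m. wave_coeff L \<delta> m (of_real k))"
      using k by (intro wave_eq_trig_series assms) auto
  qed
  show ?thesis
    using k1 range real smooth wave_H_per[OF assms] wave_equation[OF assms]
    by (intro exI[of _ k1] conjI ballI allI) blast+
qed

end
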